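(* (i) For $n \geq 3$, let $G = \mathrm{GL}_n(\mathbf K)$ for a countable field $\mathbf K$ which is not an algebraic extension of a finite field. Then there exists an uncountable family $(\pi_t)_t$ of pairwise non equivalent infinite dimensional irreducible unitary representations of $G$ which are traceable. Moreover, the representations $\pi_t$ all have a trivial central character, that is, the $\pi_t$'s are representations of $\mathrm{PGL}_n(\mathbf K)$. (ii) Let $G = \mathrm{SL}_n(\mathbf Z)$ for $n \geq 3$. Then there exists an infinite family of pairwise non equivalent infinite dimensional irreducible unitary representations of $G$ which are traceable.
   Context: All groups are considered as discrete groups. Unitary representations of $G$ are homomorphisms $\pi: G \to U(\mathcal H)$ into the unitary group of a complex separable Hilbert space $\mathcal H$; equivalence means unitary equivalence. The maximal $C^*$-algebra $C^*(G)$ is the completion of the group algebra $\mathbf C[G]$ for the norm $f \mapsto \sup_\pi \|\pi(f)\|$, the supremum being over all unitary representations $\pi$ of $G$ on separable Hilbert spaces; every unitary representation $\pi$ of $G$ extends uniquely to a $*$-representation $\pi : C^*(G) \to \mathcal B(\mathcal H)$. An irreducible unitary representation $(\pi, \mathcal H)$ of $G$ is traceable if $\pi(C^*(G))$ (equivalently, the $C^*$-subalgebra of $\mathcal B(\mathcal H)$ generated by $\pi(G)$) contains the algebra of compact operators on $\mathcal H$. *)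

theory Defs
  imports
    "HOL-Analysis.Analysis"
    "HOL-Algebra.Coset"
    "HOL-Algebra.Finite_Extensions"
    "HOL-Algebra.Algebraic_Closure_Type"
begin

section \<open>Complex separable Hilbert spaces\<close>

text \<open>The complex inner product is linear in the first argument. Its real part is the real inner
  product of the underlying real Hilbert space, so that the norm and the topology are those
  provided by \<^class>\<open>real_inner\<close>.\<close>

class separable_complex_hilbert = real_inner + complete_space +
  fixes scaleC :: "complex \<Rightarrow> 'a \<Rightarrow> 'a"  (infixr \<open>*\<^sub>C\<close> 75)
    and cinner :: "'a \<Rightarrow> 'a \<Rightarrow> complex"
  assumes scaleC_add_right: "c *\<^sub>C (x + y) = c *\<^sub>C x + c *\<^sub>C y"
    and scaleC_add_left: "(c + d) *\<^sub>C x = c *\<^sub>C x + d *\<^sub>C x"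
    and scaleC_scaleC: "c *\<^sub>C d *\<^sub>C x = (c * d) *\<^sub>C x"
    and scaleR_scaleC: "r *\<^sub>R x = complex_of_real r *\<^sub>C x"
    and cinner_commute: "cinner x y = cnj (cinner y x)"
    and cinner_add_left: "cinner (x + y) z = cinner x z + cinner y z"
    and cinner_scaleC_left: "cinner (c *\<^sub>C x) y = c * cinner x y"
    and inner_cinner: "inner x y = Re (cinner x y)"
    and separable: "\<exists>D. countable D \<and> (\<forall>x. \<forall>e>0. \<exists>y\<in>D. dist y x < e)"

global_interpretation complex_vector:
  vector_space "scaleC :: complex \<Rightarrow> 'a \<Rightarrow> 'a::separable_complex_hilbert"
  defines csubspace = complex_vector.subspace
    and cspan = complex_vector.span
proof
  fix c d :: complex and x y :: 'a
  show "c *\<^sub>C (x + y) = c *\<^sub>C x + c *\<^sub>C y" by (rule scaleC_add_right)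
  show "(c + d) *\<^sub>C x = c *\<^sub>C x + d *\<^sub>C x" by (rule scaleC_add_left)
  show "c *\<^sub>C d *\<^sub>C x = (c * d) *\<^sub>C x" by (rule scaleC_scaleC)
  show "1 *\<^sub>C x = x" using scaleR_scaleC[of 1 x] by simp
qed

definition infinite_dim :: "'a::separable_complex_hilbert itself \<Rightarrow> bool" where
  "infinite_dim _ \<longleftrightarrow> \<not> (\<exists>B :: 'a set. finite B \<and> cspan B = UNIV)"

lemma bounded_linear_scaleC:
  "bounded_linear (\<lambda>x. c *\<^sub>C (x :: 'a::separable_complex_hilbert))"
proof (rule bounded_linear_intro[where K = "cmod c"])
  fix x y :: 'a and r :: real
  show "c *\<^sub>C (x + y) = c *\<^sub>C x + c *\<^sub>C y" by (rule scaleC_add_right)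
  show "c *\<^sub>C r *\<^sub>R x = r *\<^sub>R c *\<^sub>C x"
    by (simp add: scaleR_scaleC scaleC_scaleC mult.commute)
  have right: "cinner z (c *\<^sub>C w) = cnj c * cinner z w" for z w :: 'a
    using cinner_commute[of z "c *\<^sub>C w"] cinner_commute[of z w]
    by (simp add: cinner_scaleC_left)
  have "cinner (c *\<^sub>C x) (c *\<^sub>C x) = complex_of_real ((cmod c)\<^sup>2) * cinner x x"
    by (simp only: cinner_scaleC_left right complex_norm_square mult_ac)
  then have "(norm (c *\<^sub>C x))\<^sup>2 = (cmod c)\<^sup>2 * (norm x)\<^sup>2"
    by (simp add: power2_norm_eq_inner inner_cinner)
  then have "norm (c *\<^sub>C x) = norm x * cmod c"
    by (metis mult.commute norm_ge_zero mult_nonneg_nonneg power2_eq_iff_nonneg power_mult_distrib)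
  then show "norm (c *\<^sub>C x) \<le> norm x * cmod c" by simp
qed

section \<open>Bounded operators\<close>

text \<open>Elements of the type of \<^emph>\<open>real\<close> bounded linear maps that are complex linear. The operator
  norm does not depend on the scalar field.\<close>

definition clinear_op ::
  "('a::separable_complex_hilbert \<Rightarrow>\<^sub>L 'b::separable_complex_hilbert) \<Rightarrow> bool" where
  "clinear_op T \<longleftrightarrow> (\<forall>c x. blinfun_apply T (c *\<^sub>C x) = c *\<^sub>C blinfun_apply T x)"

definition scale_op ::
  "complex \<Rightarrow> ('a::separable_complex_hilbert \<Rightarrow>\<^sub>L 'b::separable_complex_hilbert) \<Rightarrow> ('a \<Rightarrow>\<^sub>L 'b)" where
  "scale_op c T = Blinfun (\<lambda>x. c *\<^sub>C blinfun_apply T x)"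

lemma scale_op_apply [simp]: "blinfun_apply (scale_op c T) x = c *\<^sub>C blinfun_apply T x"
  unfolding scale_op_def
  by (subst bounded_linear_Blinfun_apply)
     (auto intro: bounded_linear_compose[OF bounded_linear_scaleC] blinfun.bounded_linear_right)

definition is_adjoint ::
  "('a::separable_complex_hilbert \<Rightarrow>\<^sub>L 'b::separable_complex_hilbert) \<Rightarrow> ('b \<Rightarrow>\<^sub>L 'a) \<Rightarrow> bool" where
  "is_adjoint T S \<longleftrightarrow>
     (\<forall>x y. cinner (blinfun_apply T x) y = cinner x (blinfun_apply S y))"

definition unitary ::
  "('a::separable_complex_hilbert \<Rightarrow>\<^sub>L 'b::separable_complex_hilbert) \<Rightarrow> bool" where
  "unitary U \<longleftrightarrow> clinear_op U \<and> surj (blinfun_apply U) \<and>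
     (\<forall>x y. cinner (blinfun_apply U x) (blinfun_apply U y) = cinner x y)"

definition compact_op :: "('a::separable_complex_hilbert \<Rightarrow>\<^sub>L 'a) \<Rightarrow> bool" where
  "compact_op T \<longleftrightarrow> clinear_op T \<and> compact (closure (blinfun_apply T ` cball 0 1))"

text \<open>Closedness refers to the operator norm. The adjoint of a bounded complex linear operator
  exists and is unique, so the universally quantified \<open>S\<close> is just the adjoint of \<open>T\<close>.\<close>

definition cstar_subalgebra :: "('a::separable_complex_hilbert \<Rightarrow>\<^sub>L 'a) set \<Rightarrow> bool" where
  "cstar_subalgebra A \<longleftrightarrow>
     A \<subseteq> Collect clinear_op \<and> 0 \<in> A \<and>
     (\<forall>S\<in>A. \<forall>T\<in>A. S + T \<in> A) \<and>
     (\<forall>c. \<forall>T\<in>A. scale_op c T \<in> A) \<and>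
     (\<forall>S\<in>A. \<forall>T\<in>A. S o\<^sub>L T \<in> A) \<and>
     (\<forall>T\<in>A. \<forall>S. is_adjoint T S \<longrightarrow> S \<in> A) \<and>
     closed A"

definition cstar_generated ::
  "('a::separable_complex_hilbert \<Rightarrow>\<^sub>L 'a) set \<Rightarrow> ('a \<Rightarrow>\<^sub>L 'a) set" where
  "cstar_generated M = \<Inter>{A. cstar_subalgebra A \<and> M \<subseteq> A}"

section \<open>Unitary representations\<close>

definition unitary_group :: "('h::separable_complex_hilbert \<Rightarrow>\<^sub>L 'h) monoid" where
  "unitary_group = \<lparr>carrier = {U. unitary U}, mult = (o\<^sub>L), one = id_blinfun\<rparr>"

definition unitary_rep ::
  "('g, 'm) monoid_scheme \<Rightarrow> ('g \<Rightarrow> ('h::separable_complex_hilbert \<Rightarrow>\<^sub>L 'h)) \<Rightarrow> bool" where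
  "unitary_rep G \<pi> \<longleftrightarrow> \<pi> \<in> hom G unitary_group"

definition irreducible_rep ::
  "('g, 'm) monoid_scheme \<Rightarrow> ('g \<Rightarrow> ('h::separable_complex_hilbert \<Rightarrow>\<^sub>L 'h)) \<Rightarrow> bool" where
  "irreducible_rep G \<pi> \<longleftrightarrow> unitary_rep G \<pi> \<and> (UNIV :: 'h set) \<noteq> {0} \<and>
     (\<forall>V. csubspace V \<and> closed V \<and> (\<forall>g\<in>carrier G. blinfun_apply (\<pi> g) ` V \<subseteq> V)
        \<longrightarrow> V = {0} \<or> V = UNIV)"

definition equivalent_reps ::
  "('g, 'm) monoid_scheme \<Rightarrow> ('g \<Rightarrow> ('h::separable_complex_hilbert \<Rightarrow>\<^sub>L 'h)) \<Rightarrow>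
   ('g \<Rightarrow> ('k::separable_complex_hilbert \<Rightarrow>\<^sub>L 'k)) \<Rightarrow> bool" where
  "equivalent_reps G \<pi> \<rho> \<longleftrightarrow>
     (\<exists>U :: 'h \<Rightarrow>\<^sub>L 'k. unitary U \<and> (\<forall>g\<in>carrier G. U o\<^sub>L \<pi> g = \<rho> g o\<^sub>L U))"

text \<open>The C*-algebra generated by the operators \<open>\<pi> g\<close> is the image under \<open>\<pi>\<close> of the maximal
  C*-algebra of \<open>G\<close>.\<close>

definition traceable ::
  "('g, 'm) monoid_scheme \<Rightarrow> ('g \<Rightarrow> ('h::separable_complex_hilbert \<Rightarrow>\<^sub>L 'h)) \<Rightarrow> bool" where
  "traceable G \<pi> \<longleftrightarrow>
     irreducible_rep G \<pi> \<and> {T. compact_op T} \<subseteq> cstar_generated (\<pi> ` carrier G)"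

section \<open>Groups and fields\<close>

definition center :: "('g, 'm) monoid_scheme \<Rightarrow> 'g set" where
  "center G = {z \<in> carrier G. \<forall>g\<in>carrier G. z \<otimes>\<^bsub>G\<^esub> g = g \<otimes>\<^bsub>G\<^esub> z}"

text \<open>In an irreducible representation the center acts by scalars; the central character is
  trivial if all these scalars are 1.\<close>

definition trivial_central_character ::
  "('g, 'm) monoid_scheme \<Rightarrow> ('g \<Rightarrow> ('h::separable_complex_hilbert \<Rightarrow>\<^sub>L 'h)) \<Rightarrow> bool" where
  "trivial_central_character G \<pi> \<longleftrightarrow> (\<forall>z\<in>center G. \<pi> z = id_blinfun)"

definition GL :: "('k::field ^ 'n ^ 'n) monoid" where
  "GL = \<lparr>carrier = {A. invertible A}, mult = (**), one = mat 1\<rparr>"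

definition PGL :: "('k::field ^ 'n ^ 'n) set monoid" where
  "PGL = GL Mod center GL"

definition SL_int :: "(int ^ 'n ^ 'n) monoid" where
  "SL_int = \<lparr>carrier = {A. det A = 1}, mult = (**), one = mat 1\<rparr>"

text \<open>If a field is an algebraic extension of a finite field, the latter may be taken to be a
  subfield.\<close>

definition algebraic_over_finite_field :: "'k::field itself \<Rightarrow> bool" where
  "algebraic_over_finite_field _ \<longleftrightarrow>
     (\<exists>F. subfield F (ring_of_type_algebra :: 'k ring) \<and> finite F \<and>
        (\<forall>x. ring.algebraic (ring_of_type_algebra :: 'k ring) F x))"

section \<open>The Hilbert space of square-summable sequences\<close>

text \<open>Every infinite dimensional separable complex Hilbert space is isometrically isomorphic to
  this one.\<close>

typedef ell2 = "{f :: nat \<Rightarrow> complex. summable (\<lambda>n. (cmod (f n))\<^sup>2)}"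
  morphisms coord Abs_ell2
  by (rule exI[of _ "\<lambda>_. 0"]) simp

setup_lifting type_definition_ell2

lemma summable_coord: "summable (\<lambda>n. (cmod (coord f n))\<^sup>2)"
  using coord[of f] by simp

lemma summable_square_add:
  fixes f g :: "nat \<Rightarrow> complex"
  assumes "summable (\<lambda>n. (cmod (f n))\<^sup>2)" "summable (\<lambda>n. (cmod (g n))\<^sup>2)"
  shows "summable (\<lambda>n. (cmod (f n + g n))\<^sup>2)"
proof (rule summable_comparison_test')
  show "summable (\<lambda>n. 2 * (cmod (f n))\<^sup>2 + 2 * (cmod (g n))\<^sup>2)"
    by (intro summable_add summable_mult assms)
  fix n
  have "(cmod (f n + g n))\<^sup>2 \<le> (cmod (f n) + cmod (g n))\<^sup>2"
    by (intro power_mono norm_triangle_ineq) simp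
  also have "\<dots> \<le> 2 * (cmod (f n))\<^sup>2 + 2 * (cmod (g n))\<^sup>2"
    using zero_le_power2[of "cmod (f n) - cmod (g n)"] by (simp add: power2_eq_square algebra_simps)
  finally show "norm ((cmod (f n + g n))\<^sup>2) \<le> 2 * (cmod (f n))\<^sup>2 + 2 * (cmod (g n))\<^sup>2" by simp
qed

lemma summable_square_mult:
  fixes f :: "nat \<Rightarrow> complex"
  assumes "summable (\<lambda>n. (cmod (f n))\<^sup>2)"
  shows "summable (\<lambda>n. (cmod (c * f n))\<^sup>2)"
  by (simp add: norm_mult power_mult_distrib summable_mult assms)

lemma summable_cinner: "summable (\<lambda>n. coord f n * cnj (coord g n))"
proof (rule summable_comparison_test')
  show "summable (\<lambda>n. (cmod (coord f n))\<^sup>2 + (cmod (coord g n))\<^sup>2)"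
    by (intro summable_add summable_coord)
  fix n
  have "cmod (coord f n) * cmod (coord g n) * 2 \<le> (cmod (coord f n))\<^sup>2 + (cmod (coord g n))\<^sup>2"
    using zero_le_power2[of "cmod (coord f n) - cmod (coord g n)"]
    by (simp add: power2_eq_square algebra_simps)
  moreover have "0 \<le> cmod (coord f n) * cmod (coord g n)" by simp
  ultimately show "norm (coord f n * cnj (coord g n)) \<le> (cmod (coord f n))\<^sup>2 + (cmod (coord g n))\<^sup>2"
    unfolding norm_mult complex_mod_cnj by linarith
qed

instantiation ell2 :: real_vector
begin

lift_definition zero_ell2 :: ell2 is "\<lambda>_. 0" by simp
lift_definition plus_ell2 :: "ell2 \<Rightarrow> ell2 \<Rightarrow> ell2" is "\<lambda>f g n. f n + g n"
  by (rule summable_square_add)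
lift_definition uminus_ell2 :: "ell2 \<Rightarrow> ell2" is "\<lambda>f n. - f n" by simp
lift_definition minus_ell2 :: "ell2 \<Rightarrow> ell2 \<Rightarrow> ell2" is "\<lambda>f g n. f n - g n"
  using summable_square_add[where g = "\<lambda>n. - g n" for g] by simp
lift_definition scaleR_ell2 :: "real \<Rightarrow> ell2 \<Rightarrow> ell2" is "\<lambda>r f n. complex_of_real r * f n"
  by (rule summable_square_mult)

instance
  by standard (transfer; simp add: algebra_simps)+

end

instantiation ell2 :: real_inner
begin

lift_definition inner_ell2 :: "ell2 \<Rightarrow> ell2 \<Rightarrow> real" is "\<lambda>f g. Re (\<Sum>n. f n * cnj (g n))" .
definition norm_ell2 :: "ell2 \<Rightarrow> real" where "norm_ell2 f = sqrt (inner f f)"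
definition sgn_ell2 :: "ell2 \<Rightarrow> ell2" where "sgn_ell2 f = f /\<^sub>R norm f"
definition dist_ell2 :: "ell2 \<Rightarrow> ell2 \<Rightarrow> real" where "dist_ell2 f g = norm (f - g)"
definition uniformity_ell2 :: "(ell2 \<times> ell2) filter" where
  "uniformity_ell2 = (INF e\<in>{0<..}. principal {(f, g). dist f g < e})"
definition open_ell2 :: "ell2 set \<Rightarrow> bool" where
  "open_ell2 U \<longleftrightarrow> (\<forall>f\<in>U. \<forall>\<^sub>F (f', g) in uniformity. f' = f \<longrightarrow> g \<in> U)"

lemma inner_ell2_eq: "inner f g = (\<Sum>n. Re (coord f n * cnj (coord g n)))"
  unfolding inner_ell2.rep_eq by (rule Re_suminf[OF summable_cinner])

lemma inner_ell2_self: "inner f f = (\<Sum>n. (cmod (coord f n))\<^sup>2)"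
  unfolding inner_ell2_eq by (simp only: complex_norm_square[symmetric] Re_complex_of_real)

instance
proof
  fix f g h :: ell2 and r :: real
  note summ = summable_Re[OF summable_cinner]
  show "dist f g = norm (f - g)" by (rule dist_ell2_def)
  show "sgn f = f /\<^sub>R norm f" by (rule sgn_ell2_def)
  show "uniformity = (INF e\<in>{0<..}. principal {(f :: ell2, g). dist f g < e})"
    by (rule uniformity_ell2_def)
  show "open U \<longleftrightarrow> (\<forall>f\<in>U. \<forall>\<^sub>F (f', g) in uniformity. f' = f \<longrightarrow> g \<in> U)" for U :: "ell2 set"
    by (rule open_ell2_def)
  show "inner f g = inner g f"
    unfolding inner_ell2_eq by (simp add: mult.commute)
  show "inner (f + g) h = inner f h + inner g h"
    unfolding inner_ell2_eq suminf_add[OF summ summ]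
    by (simp add: plus_ell2.rep_eq algebra_simps)
  show "inner (r *\<^sub>R f) g = r * inner f g"
    unfolding inner_ell2_eq suminf_mult[OF summ, symmetric]
    by (simp add: scaleR_ell2.rep_eq algebra_simps)
  show "0 \<le> inner f f"
    unfolding inner_ell2_self by (rule suminf_nonneg[OF summable_coord]) simp
  show "inner f f = 0 \<longleftrightarrow> f = 0"
    unfolding inner_ell2_self
    by (subst suminf_eq_zero_iff[OF summable_coord])
       (auto simp: coord_inject[symmetric] zero_ell2.rep_eq)
  show "norm f = sqrt (inner f f)" by (rule norm_ell2_def)
qed

end

lemma norm_ell2_square: "(norm f)\<^sup>2 = (\<Sum>n. (cmod (coord f n))\<^sup>2)"
  by (simp add: power2_norm_eq_inner inner_ell2_self)

lemma sum_coord_le_norm: "(\<Sum>n<m. (cmod (coord f n))\<^sup>2) \<le> (norm f)\<^sup>2"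
  unfolding norm_ell2_square by (rule sum_le_suminf[OF summable_coord]) auto

lemma cmod_coord_le_norm: "cmod (coord f n) \<le> norm f"
proof -
  have "(cmod (coord f n))\<^sup>2 \<le> (\<Sum>k<Suc n. (cmod (coord f k))\<^sup>2)"
    by (simp add: sum_nonneg)
  also have "\<dots> \<le> (norm f)\<^sup>2" by (rule sum_coord_le_norm)
  finally show ?thesis by (rule power2_le_imp_le) simp
qed

instance ell2 :: complete_space
proof
  fix u :: "nat \<Rightarrow> ell2"
  assume u: "Cauchy u"
  have "Cauchy (\<lambda>k. coord (u k) n)" for n
  proof (rule metric_CauchyI)
    fix e :: real
    assume "e > 0"
    then obtain M where M: "\<And>i j. i \<ge> M \<Longrightarrow> j \<ge> M \<Longrightarrow> dist (u i) (u j) < e"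
      using metric_CauchyD[OF u] by blast
    have "dist (coord (u i) n) (coord (u j) n) < e" if "i \<ge> M" "j \<ge> M" for i j
      using cmod_coord_le_norm[of "u i - u j" n] M[OF that]
      by (simp add: dist_norm minus_ell2.rep_eq)
    then show "\<exists>M. \<forall>i\<ge>M. \<forall>j\<ge>M. dist (coord (u i) n) (coord (u j) n) < e" by blast
  qed
  then obtain g where g: "\<And>n. (\<lambda>k. coord (u k) n) \<longlonglongrightarrow> g n"
    unfolding Cauchy_convergent_iff convergent_def by metis
  have tail: "\<exists>M. \<forall>i\<ge>M. \<forall>m. (\<Sum>n<m. (cmod (coord (u i) n - g n))\<^sup>2) \<le> e\<^sup>2" if e: "e > 0" for e :: real
  proof -
    obtain M where M: "\<And>i j. i \<ge> M \<Longrightarrow> j \<ge> M \<Longrightarrow> dist (u i) (u j) < e"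
      using metric_CauchyD[OF u e] by blast
    have "(\<Sum>n<m. (cmod (coord (u i) n - g n))\<^sup>2) \<le> e\<^sup>2" if i: "i \<ge> M" for i m
    proof (rule LIMSEQ_le_const2)
      show "(\<lambda>j. \<Sum>n<m. (cmod (coord (u i) n - coord (u j) n))\<^sup>2)
              \<longlonglongrightarrow> (\<Sum>n<m. (cmod (coord (u i) n - g n))\<^sup>2)"
        by (intro tendsto_intros g)
      have "(\<Sum>n<m. (cmod (coord (u i) n - coord (u j) n))\<^sup>2) \<le> e\<^sup>2" if j: "j \<ge> M" for j
      proof -
        have "(\<Sum>n<m. (cmod (coord (u i) n - coord (u j) n))\<^sup>2) \<le> (norm (u i - u j))\<^sup>2"
          using sum_coord_le_norm[of "u i - u j" m] by (simp add: minus_ell2.rep_eq)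
        also have "\<dots> \<le> e\<^sup>2"
          using M[OF i j] by (intro power_mono) (auto simp: dist_norm)
        finally show ?thesis .
      qed
      then show "\<exists>N. \<forall>j\<ge>N. (\<Sum>n<m. (cmod (coord (u i) n - coord (u j) n))\<^sup>2) \<le> e\<^sup>2" by blast
    qed
    then show ?thesis by blast
  qed
  have summ: "summable (\<lambda>n. (cmod (coord (u i) n - g n))\<^sup>2)"
    if "\<And>m. (\<Sum>n<m. (cmod (coord (u i) n - g n))\<^sup>2) \<le> e\<^sup>2" for i and e :: real
    by (rule bounded_imp_summable[where B = "e\<^sup>2"])
       (simp_all only: lessThan_Suc_atMost[symmetric] that zero_le_power2)
  obtain M where M: "\<And>i m. i \<ge> M \<Longrightarrow> (\<Sum>n<m. (cmod (coord (u i) n - g n))\<^sup>2) \<le> 1\<^sup>2"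
    using tail[OF zero_less_one] by blast
  have "summable (\<lambda>n. (cmod (- (coord (u M) n - g n) + coord (u M) n))\<^sup>2)"
    using summ[OF M[OF order_refl]]
    by (intro summable_square_add summable_coord) (simp only: norm_minus_cancel)
  then have G: "coord (Abs_ell2 g) = g"
    by (subst Abs_ell2_inverse) auto
  have "u \<longlonglongrightarrow> Abs_ell2 g"
  proof (rule metric_LIMSEQ_I)
    fix e :: real
    assume e: "e > 0"
    have "e / 2 > 0" using e by simp
    then obtain N where N: "\<And>i m. i \<ge> N \<Longrightarrow> (\<Sum>n<m. (cmod (coord (u i) n - g n))\<^sup>2) \<le> (e / 2)\<^sup>2"
      using tail by blast
    have "dist (u i) (Abs_ell2 g) < e" if i: "i \<ge> N" for i
    proof -
      have "(norm (u i - Abs_ell2 g))\<^sup>2 \<le> (e / 2)\<^sup>2"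
        unfolding norm_ell2_square minus_ell2.rep_eq G
        by (rule suminf_le_const[OF summ[OF N[OF i]] N[OF i]])
      then have "norm (u i - Abs_ell2 g) \<le> e / 2"
        by (rule power2_le_imp_le) (use e in simp)
      then show ?thesis using e by (simp add: dist_norm)
    qed
    then show "\<exists>N. \<forall>i\<ge>N. dist (u i) (Abs_ell2 g) < e" by blast
  qed
  then show "convergent u" unfolding convergent_def by blast
qed

lemma rational_complex_approx:
  assumes "e > 0"
  shows "\<exists>q :: rat \<times> rat. (cmod (z - Complex (of_rat (fst q)) (of_rat (snd q))))\<^sup>2 < e"
proof -
  define d where "d = sqrt e / 2"
  have d: "d > 0" using assms by (simp add: d_def)
  obtain a where a: "Re z - d < of_rat a" "of_rat a < Re z + d"
    using of_rat_dense[of "Re z - d" "Re z + d"] d by auto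
  obtain b where b: "Im z - d < of_rat b" "of_rat b < Im z + d"
    using of_rat_dense[of "Im z - d" "Im z + d"] d by auto
  have "(Re z - of_rat a)\<^sup>2 \<le> d\<^sup>2" "(Im z - of_rat b)\<^sup>2 \<le> d\<^sup>2"
    using a b d by (auto simp: abs_le_square_iff[symmetric])
  moreover have "d\<^sup>2 = e / 4" using assms by (simp add: d_def power_divide)
  ultimately have "(cmod (z - Complex (of_rat a) (of_rat b)))\<^sup>2 < e"
    using assms by (simp add: cmod_power2)
  then show ?thesis by (intro exI[of _ "(a, b)"]) simp
qed

instantiation ell2 :: separable_complex_hilbert
begin

lift_definition scaleC_ell2 :: "complex \<Rightarrow> ell2 \<Rightarrow> ell2" is "\<lambda>c f n. c * f n"
  by (rule summable_square_mult)
lift_definition cinner_ell2 :: "ell2 \<Rightarrow> ell2 \<Rightarrow> complex" is "\<lambda>f g. \<Sum>n. f n * cnj (g n)" .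

instance
proof
  fix f g h :: ell2 and c d :: complex and r :: real
  show "c *\<^sub>C (f + g) = c *\<^sub>C f + c *\<^sub>C g" by transfer (simp add: algebra_simps)
  show "(c + d) *\<^sub>C f = c *\<^sub>C f + d *\<^sub>C f" by transfer (simp add: algebra_simps)
  show "c *\<^sub>C d *\<^sub>C f = (c * d) *\<^sub>C f" by transfer (simp add: algebra_simps)
  show "r *\<^sub>R f = complex_of_real r *\<^sub>C f" by transfer simp
  show "cinner f g = cnj (cinner g f)"
  proof -
    have "cnj (cinner g f) = (\<Sum>n. cnj (coord g n * cnj (coord f n)))"
      unfolding cinner_ell2.rep_eq
      by (rule sums_unique)
         (simp only: sums_cnj summable_sums[OF summable_cinner])
    then show ?thesis by (simp add: cinner_ell2.rep_eq mult.commute)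
  qed
  show "cinner (f + g) h = cinner f h + cinner g h"
    unfolding cinner_ell2.rep_eq suminf_add[OF summable_cinner summable_cinner]
    by (simp add: plus_ell2.rep_eq algebra_simps)
  show "cinner (c *\<^sub>C f) g = c * cinner f g"
    unfolding cinner_ell2.rep_eq suminf_mult[OF summable_cinner, symmetric]
    by (simp add: scaleC_ell2.rep_eq algebra_simps)
  show "inner f g = Re (cinner f g)"
    by (simp add: inner_ell2.rep_eq cinner_ell2.rep_eq)
next
  define s :: "(rat \<times> rat) list \<Rightarrow> nat \<Rightarrow> complex" where
    "s q n = (if n < length q then Complex (of_rat (fst (q ! n))) (of_rat (snd (q ! n))) else 0)" for q n
  have "summable (\<lambda>n. (cmod (s q n))\<^sup>2)" for q
    by (rule summable_finite[of "{..<length q}"]) (auto simp: s_def)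
  then have s: "coord (Abs_ell2 (s q)) = s q" for q
    by (subst Abs_ell2_inverse) auto
  have "\<exists>y\<in>range (\<lambda>q. Abs_ell2 (s q)). dist y f < e" if e: "e > 0" for f e
  proof -
    have e2: "e\<^sup>2 / 2 > 0" using e by simp
    obtain m where m: "norm (\<Sum>n. (cmod (coord f (n + m)))\<^sup>2) < e\<^sup>2 / 2"
      using suminf_exist_split[OF e2 summable_coord] by blast
    have "e\<^sup>2 / 2 / (real m + 1) > 0" using e by simp
    then have "\<forall>n. \<exists>q :: rat \<times> rat. (cmod (coord f n - Complex (of_rat (fst q)) (of_rat (snd q))))\<^sup>2
        < e\<^sup>2 / 2 / (real m + 1)"
      using rational_complex_approx by blast
    then obtain a :: "nat \<Rightarrow> rat \<times> rat" where
      a: "\<And>n. (cmod (coord f n - Complex (of_rat (fst (a n))) (of_rat (snd (a n)))))\<^sup>2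
        < e\<^sup>2 / 2 / (real m + 1)"
      by metis
    define q where "q = map a [0..<m]"
    define y where "y = Abs_ell2 (s q)"
    have y: "coord y n = (if n < m then Complex (of_rat (fst (a n))) (of_rat (snd (a n))) else 0)" for n
      by (simp add: y_def s s_def q_def)
    have "(norm (f - y))\<^sup>2 = (\<Sum>n. (cmod (coord (f - y) (n + m)))\<^sup>2) + (\<Sum>n<m. (cmod (coord (f - y) n))\<^sup>2)"
      unfolding norm_ell2_square by (rule suminf_split_initial_segment[OF summable_coord])
    also have "(\<Sum>n. (cmod (coord (f - y) (n + m)))\<^sup>2) = (\<Sum>n. (cmod (coord f (n + m)))\<^sup>2)"
      by (simp add: minus_ell2.rep_eq y)
    also have "\<dots> < e\<^sup>2 / 2" using m by simp
    also have "(\<Sum>n<m. (cmod (coord (f - y) n))\<^sup>2) \<le> real (card {..<m}) * (e\<^sup>2 / 2 / (real m + 1))"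
      by (rule sum_bounded_above) (use a in \<open>auto simp: minus_ell2.rep_eq y intro: less_imp_le\<close>)
    also have "\<dots> \<le> e\<^sup>2 / 2"
      by (simp add: field_simps)
    finally have "(norm (f - y))\<^sup>2 < e\<^sup>2" by simp
    then have "norm (f - y) < e" by (rule power2_less_imp_less) (use e in simp)
    then have "dist y f < e" by (simp add: dist_norm norm_minus_commute)
    then show ?thesis unfolding y_def by blast
  qed
  then show "\<exists>D :: ell2 set. countable D \<and> (\<forall>f. \<forall>e>0. \<exists>y\<in>D. dist y f < e)"
    by (intro exI[of _ "range (\<lambda>q. Abs_ell2 (s q))"]) auto
qed

end

end

theory Submission
  imports Defs
begin

text \<open>All representations here are monomial: a unitary character \<open>\<theta>\<close> of a subgroup \<open>L\<close> of \<open>G\<close> is induced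
  to \<open>G\<close>, which acts on the square-summable functions on \<open>G/L\<close> by permuting the basis vectors up to
  phases. If a norm-closed algebra of operators contains the operators of \<open>G\<close> and the projection
  onto the line spanned by the basis vector of the coset \<open>L\<close>, then multiplying this projection on
  both sides by operators of \<open>G\<close> gives all matrix units, and so all compact operators. Therefore
  it suffices to find this projection in every closed
  algebra that contains the operators of \<open>G\<close>: taking the algebra of all operators that preserve a given
  closed subspace proves irreducibility, and taking C*-algebras proves traceability.

  The projection is found in two steps. Let \<open>H\<close> be a union of finitely many cosets of \<open>L\<close>. Assume
  that \<open>G - H\<close> is covered by \<open>q\<close> sets \<open>C i\<close>, each a union of cosets of \<open>L\<close> and having \<open>q + 1\<close> pairwise
  disjoint translates under elements \<open>g i k\<close> that fix the basis vectors of the cosets in \<open>H\<close>. A unit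
  vector \<open>f\<close> that vanishes on \<open>H\<close> has at least the fraction \<open>1/q\<close> of its square norm on some \<open>C i\<close>, but
  it has at most \<open>1/(q+1)\<close> of it on one of the translates. Hence some \<open>g i k\<close> moves \<open>f\<close> by an amount that
  depends on \<open>q\<close> only (\<open>displacement\<close>). So the mean of the identity and the operators of the \<open>g i k\<close> is
  a strict contraction off \<open>H\<close> and the identity on \<open>H\<close>, and its powers converge in norm to the
  restriction to \<open>H\<close>. Phases do no harm, as only absolute values enter. In the second step, elements
  of \<open>G\<close> that act diagonally on the finitely many basis vectors belonging to \<open>H\<close>, with different
  eigenvalues, cut out the basis vector of \<open>L\<close>.

  For \<open>GL\<close> over a field \<open>K\<close>, \<open>L = H\<close> is the stabilizer of a line and \<open>G/L\<close> is the projective space. As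
  \<open>K\<close> is not algebraic over a finite field, it has a subring that is not a field, and by Zorn's lemma a
  valuation ring \<open>V\<close> different from \<open>K\<close> (\<open>valuation_ring_exists\<close>). The sectors \<open>C i\<close> consist of the lines
  whose \<open>i\<close>-th coordinate divides all others, apart from the coordinate of the fixed line, with
  respect to \<open>V\<close>; transvections with entries outside \<open>V\<close> move a sector off itself. The characters are
  \<open>\<psi> (det g / a ^ n)\<close>, where \<open>a\<close> is the eigenvalue on the line and \<open>\<psi>\<close> a character of the
  multiplicative group of \<open>K\<close>; they are trivial on scalars. An element \<open>t\<close> of \<open>V\<close> without inverse in
  \<open>V\<close> has infinite order, and since the unit circle is divisible, \<open>\<psi> t\<close> can be any point of the circle.
  Different \<open>\<psi>\<close> give inequivalent representations, because \<open>L\<close> has no finite orbit in \<open>G/L\<close> besides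
  its fixed point (\<open>equivalent_monomial\<close>).

  For \<open>SL\<close> over the integers, the usual absolute value takes the place of the valuation, and \<open>H\<close> is
  again the stabilizer of a line. It has too few characters, so \<open>L\<close> is a subgroup of finite index in
  \<open>H\<close>: up to a common sign it fixes the vector spanning the line, and it fixes one more vector up to multiples of the first and modulo \<open>m\<close>. The
  transvections into the fixed line act on the basis vectors belonging to \<open>H\<close> by different characters
  with values in the \<open>m\<close>-th roots of unity, which single out \<open>L\<close> and make \<open>m\<close> an invariant of the representation.\<close>

(* Between matrix entries, the dollar sign is to denote vector components only. *)
no_notation fps_nth (infixl "$" 75)

section \<open>Operators on square-summable sequences\<close>

lemmas coord_simps [simp] = zero_ell2.rep_eq plus_ell2.rep_eq minus_ell2.rep_eq uminus_ell2.rep_eq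
  scaleR_ell2.rep_eq scaleC_ell2.rep_eq

lemma ell2_eqI: "(\<And>k. coord f k = coord g k) \<Longrightarrow> f = g"
  by (simp add: coord_inject[symmetric] fun_eq_iff)

lemma coord_sum [simp]: "coord (\<Sum>i\<in>I. f i) k = (\<Sum>i\<in>I. coord (f i) k)"
  by (induction I rule: infinite_finite_induct) auto

lift_definition ket :: "nat \<Rightarrow> ell2" is "\<lambda>k n. if n = k then 1 else 0"
  subgoal for k by (rule summable_finite[of "{k}"]) auto
  done

lemma coord_ket [simp]: "coord (ket k) n = (if n = k then 1 else 0)"
  by (simp add: ket.rep_eq)

lemma norm_scaleC: "norm (c *\<^sub>C (f :: ell2)) = cmod c * norm f"
proof -
  have "(norm (c *\<^sub>C f))\<^sup>2 = (cmod c * norm f)\<^sup>2"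
    by (simp add: norm_ell2_square norm_mult power_mult_distrib suminf_mult summable_coord)
  then show ?thesis by simp
qed

lemma norm_ket: "norm (ket k) = 1"
proof -
  have "(norm (ket k))\<^sup>2 = 1\<^sup>2"
    unfolding norm_ell2_square by (subst suminf_finite[of "{k}"]) auto
  then show ?thesis by (rule power2_eq_imp_eq) simp_all
qed

text \<open>Both the diagonal projections and the operators of a monomial representation have this
  form. It is a contraction if \<open>\<tau>\<close> is injective and the weights \<open>c\<close> are bounded by 1.\<close>

definition weighted_comp :: "(nat \<Rightarrow> nat) \<Rightarrow> (nat \<Rightarrow> complex) \<Rightarrow> ell2 \<Rightarrow>\<^sub>L ell2" where
  "weighted_comp \<tau> c = Blinfun (\<lambda>f. Abs_ell2 (\<lambda>k. c k * coord f (\<tau> k)))"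

context
  fixes \<tau> :: "nat \<Rightarrow> nat" and c :: "nat \<Rightarrow> complex"
  assumes inj: "inj \<tau>" and c: "\<And>k. cmod (c k) \<le> 1"
begin

lemma weighted_comp_partial:
  "(\<Sum>k<n. (cmod (c k * coord f (\<tau> k)))\<^sup>2) \<le> (norm f)\<^sup>2"
proof -
  have "(\<Sum>k<n. (cmod (c k * coord f (\<tau> k)))\<^sup>2) \<le> (\<Sum>k<n. (cmod (coord f (\<tau> k)))\<^sup>2)"
    by (intro sum_mono power_mono) (auto simp: norm_mult c mult_left_le_one_le)
  also have "\<dots> = (\<Sum>k\<in>\<tau> ` {..<n}. (cmod (coord f k))\<^sup>2)"
    by (simp add: sum.reindex inj_on_subset[OF inj])
  also have "\<dots> \<le> (norm f)\<^sup>2"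
    unfolding norm_ell2_square by (intro sum_le_suminf summable_coord) auto
  finally show ?thesis .
qed

lemma weighted_comp_summable: "summable (\<lambda>k. (cmod (c k * coord f (\<tau> k)))\<^sup>2)"
  by (rule bounded_imp_summable[where B = "(norm f)\<^sup>2"])
     (simp_all only: lessThan_Suc_atMost[symmetric] weighted_comp_partial zero_le_power2)

private lemma coord_Abs:
  "coord (Abs_ell2 (\<lambda>k. c k * coord f (\<tau> k))) = (\<lambda>k. c k * coord f (\<tau> k))"
  by (rule Abs_ell2_inverse) (simp add: weighted_comp_summable)

private lemma norm_Abs: "norm (Abs_ell2 (\<lambda>k. c k * coord f (\<tau> k))) \<le> norm f"
proof (rule power2_le_imp_le)
  show "(norm (Abs_ell2 (\<lambda>k. c k * coord f (\<tau> k))))\<^sup>2 \<le> (norm f)\<^sup>2"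
    unfolding norm_ell2_square[of "Abs_ell2 _"] coord_Abs
    by (rule suminf_le_const[OF weighted_comp_summable weighted_comp_partial])
qed simp

lemma coord_weighted_comp: "coord (weighted_comp \<tau> c f) k = c k * coord f (\<tau> k)"
proof -
  have "bounded_linear (\<lambda>f. Abs_ell2 (\<lambda>k. c k * coord f (\<tau> k)))"
  proof (rule bounded_linear_intro[where K = 1])
    fix f g :: ell2 and r :: real
    show "Abs_ell2 (\<lambda>k. c k * coord (f + g) (\<tau> k))
        = Abs_ell2 (\<lambda>k. c k * coord f (\<tau> k)) + Abs_ell2 (\<lambda>k. c k * coord g (\<tau> k))"
      by (rule ell2_eqI, subst coord_Abs) (simp add: coord_Abs algebra_simps)
    show "Abs_ell2 (\<lambda>k. c k * coord (r *\<^sub>R f) (\<tau> k)) = r *\<^sub>R Abs_ell2 (\<lambda>k. c k * coord f (\<tau> k))"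
      by (rule ell2_eqI, subst coord_Abs) (simp add: coord_Abs algebra_simps)
  qed (simp add: norm_Abs)
  then show ?thesis
    by (simp add: weighted_comp_def bounded_linear_Blinfun_apply coord_Abs)
qed

lemma norm_weighted_comp_le: "norm (weighted_comp \<tau> c f) \<le> norm f"
proof -
  have "weighted_comp \<tau> c f = Abs_ell2 (\<lambda>k. c k * coord f (\<tau> k))"
    by (rule ell2_eqI) (simp add: coord_weighted_comp coord_Abs)
  then show ?thesis by (simp add: norm_Abs)
qed

lemma clinear_weighted_comp: "clinear_op (weighted_comp \<tau> c)"
  by (auto simp: clinear_op_def coord_weighted_comp intro!: ell2_eqI)

end

definition cut :: "nat set \<Rightarrow> ell2 \<Rightarrow>\<^sub>L ell2" where
  "cut S = weighted_comp id (\<lambda>k. of_bool (k \<in> S))"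

lemma coord_cut [simp]: "coord (cut S f) k = (if k \<in> S then coord f k else 0)"
  unfolding cut_def by (subst coord_weighted_comp) auto

lemma norm_cut_le: "norm (cut S f) \<le> norm f"
  unfolding cut_def by (rule norm_weighted_comp_le) auto

lemma sum_cut_disjoint:
  assumes "finite I" "disjoint_family_on S I"
  shows "(\<Sum>i\<in>I. (norm (cut (S i) f))\<^sup>2) \<le> (norm f)\<^sup>2"
proof -
  have "(\<Sum>i\<in>I. (norm (cut (S i) f))\<^sup>2) = (\<Sum>k. \<Sum>i\<in>I. (cmod (coord (cut (S i) f) k))\<^sup>2)"
    unfolding norm_ell2_square by (rule suminf_sum[symmetric, OF summable_coord])
  also have "\<dots> \<le> (\<Sum>k. (cmod (coord f k))\<^sup>2)"
  proof (intro suminf_le summable_sum summable_coord)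
    fix k
    show "(\<Sum>i\<in>I. (cmod (coord (cut (S i) f) k))\<^sup>2) \<le> (cmod (coord f k))\<^sup>2"
    proof (cases "\<exists>i\<in>I. k \<in> S i")
      case True
      then obtain j where j: "j \<in> I" "k \<in> S j" by blast
      have "(\<Sum>i\<in>I. (cmod (coord (cut (S i) f) k))\<^sup>2) = (\<Sum>i\<in>I. if i = j then (cmod (coord f k))\<^sup>2 else 0)"
        using assms(2) j by (intro sum.cong) (auto simp: disjoint_family_on_def)
      then show ?thesis using assms(1) j by simp
    qed (auto intro!: sum_nonpos)
  qed
  finally show ?thesis by (simp add: norm_ell2_square)
qed

lemma sum_cut_cover:
  assumes "finite I" "\<And>k. coord f k \<noteq> 0 \<Longrightarrow> \<exists>i\<in>I. k \<in> S i"
  shows "(norm f)\<^sup>2 \<le> (\<Sum>i\<in>I. (norm (cut (S i) f))\<^sup>2)"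
proof -
  have "(norm f)\<^sup>2 \<le> (\<Sum>k. \<Sum>i\<in>I. (cmod (coord (cut (S i) f) k))\<^sup>2)"
    unfolding norm_ell2_square
  proof (intro suminf_le summable_sum summable_coord)
    fix k
    show "(cmod (coord f k))\<^sup>2 \<le> (\<Sum>i\<in>I. (cmod (coord (cut (S i) f) k))\<^sup>2)"
    proof (cases "coord f k = 0")
      case False
      then obtain j where j: "j \<in> I" "k \<in> S j" using assms(2) by blast
      then have "(cmod (coord f k))\<^sup>2 = (cmod (coord (cut (S j) f) k))\<^sup>2" by simp
      also have "\<dots> \<le> (\<Sum>i\<in>I. (cmod (coord (cut (S i) f) k))\<^sup>2)"
        using assms(1) j by (intro member_le_sum) auto
      finally show ?thesis .
    qed (simp add: sum_nonneg)
  qed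
  also have "\<dots> = (\<Sum>i\<in>I. (norm (cut (S i) f))\<^sup>2)"
    unfolding norm_ell2_square by (rule suminf_sum[OF summable_coord])
  finally show ?thesis .
qed

lemma cut_tendsto: "(\<lambda>n. cut {..<n} f) \<longlonglongrightarrow> f"
proof (rule metric_LIMSEQ_I)
  fix r :: real assume r: "r > 0"
  then obtain N where N: "\<And>n. n \<ge> N \<Longrightarrow> norm (\<Sum>k. (cmod (coord f (k + n)))\<^sup>2) < r\<^sup>2"
    using suminf_exist_split[OF _ summable_coord, of "r\<^sup>2" f] by auto
  have "dist (cut {..<n} f) f < r" if n: "n \<ge> N" for n
  proof -
    have "(norm (cut {..<n} f - f))\<^sup>2
        = (\<Sum>k. (cmod (coord (cut {..<n} f - f) (k + n)))\<^sup>2) + (\<Sum>k<n. (cmod (coord (cut {..<n} f - f) k))\<^sup>2)"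
      unfolding norm_ell2_square by (rule suminf_split_initial_segment[OF summable_coord])
    also have "\<dots> = (\<Sum>k. (cmod (coord f (k + n)))\<^sup>2)" by simp
    also have "\<dots> < r\<^sup>2" using N[OF n] by simp
    finally show ?thesis
      unfolding dist_norm by (rule power2_less_imp_less) (use r in simp)
  qed
  then show "\<exists>N. \<forall>n\<ge>N. dist (cut {..<n} f) f < r" by blast
qed

definition matrix_unit :: "nat \<Rightarrow> nat \<Rightarrow> ell2 \<Rightarrow>\<^sub>L ell2" where
  "matrix_unit k l = Blinfun (\<lambda>f. coord f l *\<^sub>C ket k)"

lemma matrix_unit_apply [simp]: "matrix_unit k l f = coord f l *\<^sub>C ket k"
proof -
  have "norm (coord f l *\<^sub>C ket k) \<le> norm f * 1" for f
    by (simp add: norm_scaleC norm_ket cmod_coord_le_norm)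
  then have "bounded_linear (\<lambda>f. coord f l *\<^sub>C ket k)"
    by (intro bounded_linear_intro[where K = 1])
       (auto intro!: ell2_eqI simp: algebra_simps)
  then show ?thesis by (simp add: matrix_unit_def bounded_linear_Blinfun_apply)
qed

lemma cut_eq_sum_ket: "cut {..<n} f = (\<Sum>k<n. coord f k *\<^sub>C ket k)"
proof (rule ell2_eqI)
  fix k
  have "coord (\<Sum>l<n. coord f l *\<^sub>C ket l) k = (\<Sum>l<n. if l = k then coord f k else 0)"
    unfolding coord_sum by (rule sum.cong) auto
  then show "coord (cut {..<n} f) k = coord (\<Sum>l<n. coord f l *\<^sub>C ket l) k" by simp
qed

lemma infinite_dim_ell2: "infinite_dim TYPE(ell2)"
  unfolding infinite_dim_def
proof
  assume "\<exists>B :: ell2 set. finite B \<and> cspan B = UNIV"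
  then obtain B :: "ell2 set" where B: "finite B" "cspan B = UNIV" by blast
  have inj: "inj ket"
  proof (rule injI)
    fix k l assume "ket k = ket l"
    then have "coord (ket k) k = coord (ket l) k" by simp
    then show "k = l" by (simp split: if_splits)
  qed
  have "ket k \<notin> cspan (range ket - {ket k})" for k
  proof
    let ?V = "{f. coord f k = 0}"
    have "csubspace ?V" by (auto simp: complex_vector.subspace_def)
    moreover have "range ket - {ket k} \<subseteq> ?V" by auto
    ultimately have "cspan (range ket - {ket k}) \<subseteq> ?V" by (rule complex_vector.span_minimal[rotated])
    moreover assume "ket k \<in> cspan (range ket - {ket k})"
    ultimately have "ket k \<in> ?V" by blast
    then show False by simp
  qed
  then have "complex_vector.independent (range ket)"
    unfolding complex_vector.dependent_def by blast
  then have "finite (range ket)"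
    using complex_vector.independent_span_bound[OF B(1)] B(2) by blast
  then show False using inj finite_imageD by blast
qed

text \<open>This covers both C*-algebras of operators and the algebra of all operators that map a given closed
  subspace to itself. The same statement thus yields traceability in the first case and irreducibility
  in the second.\<close>

definition closed_algebra :: "(ell2 \<Rightarrow>\<^sub>L ell2) set \<Rightarrow> bool" where
  "closed_algebra A \<longleftrightarrow> 0 \<in> A \<and> (\<forall>S\<in>A. \<forall>T\<in>A. S + T \<in> A) \<and> (\<forall>c. \<forall>T\<in>A. scale_op c T \<in> A) \<and>
     (\<forall>S\<in>A. \<forall>T\<in>A. S o\<^sub>L T \<in> A) \<and> closed A"

lemma closed_algebra_sum:
  assumes "closed_algebra A" "\<And>i. i \<in> I \<Longrightarrow> f i \<in> A"
  shows "(\<Sum>i\<in>I. f i) \<in> A"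
  using assms(2) by (induction I rule: infinite_finite_induct)
    (use assms(1) in \<open>auto simp: closed_algebra_def\<close>)

text \<open>The \<open>k\<close>-th row \<open>a l\<close> of the matrix of \<open>T\<close> is square-summable: testing \<open>T\<close> on the sum of the vectors
  \<open>cnj (a l) *\<^sub>C ket l\<close> over \<open>l \<le> n\<close> gives \<open>s \<le> norm T * sqrt s\<close> for the partial sum \<open>s\<close> of the squares.\<close>

lemma functional_vector:
  fixes T :: "ell2 \<Rightarrow>\<^sub>L ell2"
  assumes T: "clinear_op T"
  shows "summable (\<lambda>l. (cmod (coord (T (ket l)) k))\<^sup>2)"
proof (rule bounded_imp_summable[where B = "(norm T)\<^sup>2"])
  fix n
  define a where "a l = coord (T (ket l)) k" for l
  define s where "s = (\<Sum>l<Suc n. (cmod (a l))\<^sup>2)"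
  define f where "f = (\<Sum>l<Suc n. cnj (a l) *\<^sub>C ket l)"
  have "coord f l = (if l < Suc n then cnj (a l) else 0)" for l
  proof -
    have "coord f l = (\<Sum>j<Suc n. if j = l then cnj (a l) else 0)"
      unfolding f_def coord_sum by (rule sum.cong) auto
    then show ?thesis by (simp del: sum.lessThan_Suc)
  qed
  then have "(norm f)\<^sup>2 = s"
    unfolding norm_ell2_square s_def by (subst suminf_finite[of "{..<Suc n}"]) auto
  have "T f = (\<Sum>l<Suc n. cnj (a l) *\<^sub>C T (ket l))"
    unfolding f_def blinfun.sum_right using T by (simp only: clinear_op_def)
  then have "coord (T f) k = (\<Sum>l<Suc n. cnj (a l) * a l)"
    by (simp only: coord_sum scaleC_ell2.rep_eq a_def)
  also have "\<dots> = complex_of_real s"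
    by (simp only: s_def of_real_sum complex_norm_square mult.commute)
  finally have "coord (T f) k = complex_of_real s" .
  moreover have "s \<ge> 0" by (simp add: s_def sum_nonneg del: sum.lessThan_Suc)
  ultimately have "s = cmod (coord (T f) k)" by simp
  also have "\<dots> \<le> norm T * norm f"
    using cmod_coord_le_norm norm_blinfun order_trans by blast
  finally have "s \<le> norm T * norm f" .
  then have "s * s \<le> (norm T * norm f) * (norm T * norm f)"
    by (intro mult_mono) (auto simp: s_def sum_nonneg simp del: sum.lessThan_Suc)
  also have "\<dots> = (norm T)\<^sup>2 * s"
    using \<open>(norm f)\<^sup>2 = s\<close> by (simp add: power2_eq_square mult_ac)
  finally have "s = 0 \<or> s \<le> (norm T)\<^sup>2"
    using \<open>(norm f)\<^sup>2 = s\<close>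
    by (metis mult_le_cancel_right zero_le_power2 order_le_less not_less)
  then have "s \<le> (norm T)\<^sup>2" by auto
  then show "(\<Sum>l\<le>n. (cmod (coord (T (ket l)) k))\<^sup>2) \<le> (norm T)\<^sup>2"
    by (simp only: s_def a_def lessThan_Suc_atMost)
qed auto

text \<open>The \<open>k\<close>-th coordinate of \<open>T f\<close> is the inner product of \<open>f\<close> with a fixed vector, whose tails tend to 0.\<close>

lemma matrix_entry_tail:
  fixes T :: "ell2 \<Rightarrow>\<^sub>L ell2"
  assumes T: "clinear_op T" and r: "r > 0"
  shows "\<exists>m. \<forall>n\<ge>m. \<forall>f. cmod (coord (T (f - cut {..<n} f)) k) \<le> r * norm f"
proof -
  have clin: "T (c *\<^sub>C f) = c *\<^sub>C T f" for c f using T by (simp add: clinear_op_def)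
  define u where "u = Abs_ell2 (\<lambda>l. cnj (coord (T (ket l)) k))"
  have u: "coord u l = cnj (coord (T (ket l)) k)" for l
    unfolding u_def using functional_vector[OF T, of k] by (subst Abs_ell2_inverse) auto
  obtain m where m: "\<And>n. n \<ge> m \<Longrightarrow> norm (cut {..<n} u - u) < r"
    using metric_LIMSEQ_D[OF cut_tendsto r, of u] by (auto simp: dist_norm)
  have rep: "coord (T g) k = cinner g u" for g
  proof -
    have "(\<lambda>n. coord (T (cut {..<n} g)) k) \<longlonglongrightarrow> coord (T g) k"
    proof -
      have "(\<lambda>n. T (cut {..<n} g)) \<longlonglongrightarrow> T g" by (intro tendsto_intros cut_tendsto)
      then have "(\<lambda>n. norm (T (cut {..<n} g) - T g)) \<longlonglongrightarrow> 0"
        by (simp add: LIM_zero_iff tendsto_norm_zero_iff)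
      then have "(\<lambda>n. coord (T (cut {..<n} g)) k - coord (T g) k) \<longlonglongrightarrow> 0"
        by (rule Lim_null_comparison[rotated])
           (metis (mono_tags, lifting) cmod_coord_le_norm eventuallyI minus_ell2.rep_eq)
      then show ?thesis by (simp add: LIM_zero_iff)
    qed
    moreover have "coord (T (cut {..<n} g)) k = (\<Sum>l<n. coord g l * cnj (coord u l))" for n
      by (simp add: cut_eq_sum_ket blinfun.sum_right clin u)
    moreover have "(\<lambda>n. \<Sum>l<n. coord g l * cnj (coord u l)) \<longlonglongrightarrow> cinner g u"
      unfolding cinner_ell2.rep_eq using summable_LIMSEQ[OF summable_cinner] .
    ultimately show ?thesis using LIMSEQ_unique by simp
  qed
  have "cmod (coord (T (f - cut {..<n} f)) k) \<le> r * norm f" if n: "n \<ge> m" for n f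
  proof -
    define z where "z = cinner f (u - cut {..<n} u)"
    have eq: "coord (T (f - cut {..<n} f)) k = z"
      unfolding rep z_def cinner_ell2.rep_eq by (rule suminf_cong) simp
    \<comment> \<open>The Cauchy--Schwarz inequality of the real inner product gives the complex one after a rotation.\<close>
    have "cinner (cnj z *\<^sub>C f) (u - cut {..<n} u) = cnj z * z"
      by (simp add: cinner_scaleC_left z_def)
    then have "(cmod z)\<^sup>2 = inner (cnj z *\<^sub>C f) (u - cut {..<n} u)"
      unfolding inner_cinner by (simp add: mult.commute flip: complex_norm_square)
    also have "\<dots> \<le> norm (cnj z *\<^sub>C f) * norm (u - cut {..<n} u)" by (rule norm_cauchy_schwarz)
    also have "\<dots> \<le> (cmod z * norm f) * r"
      unfolding norm_scaleC using m[OF n] by (intro mult_mono) (auto simp: norm_minus_commute)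
    finally have "cmod z * cmod z \<le> cmod z * (r * norm f)" by (simp add: power2_eq_square mult_ac)
    then have "cmod z \<le> r * norm f"
      using r by (cases "z = 0") auto
    then show ?thesis by (simp add: eq)
  qed
  then show ?thesis by blast
qed

text \<open>The truncations are contractions that converge pointwise to the identity, so they converge uniformly
  on the relatively compact image of the unit ball.\<close>

lemma compact_op_cut:
  assumes T: "compact_op T" and r: "r > 0"
  shows "\<exists>n. \<forall>f. norm (T f - cut {..<n} (T f)) \<le> r * norm f"
proof -
  define K where "K = closure (blinfun_apply T ` cball 0 1)"
  have K: "compact K" using T by (simp add: compact_op_def K_def)
  obtain F where F: "finite F" "K \<subseteq> (\<Union>x\<in>F. ball x (r/3))"
    using K r unfolding compact_eq_totally_bounded by (meson zero_less_divide_iff zero_less_numeral)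
  have "\<forall>x\<in>F. \<forall>\<^sub>F n in sequentially. dist (cut {..<n} x) x < r/3"
    using r by (intro ballI tendstoD[OF cut_tendsto]) auto
  then have "\<forall>\<^sub>F n in sequentially. \<forall>x\<in>F. dist (cut {..<n} x) x < r/3"
    using F(1) by (simp add: eventually_ball_finite_distrib)
  then obtain n where n: "\<And>x. x \<in> F \<Longrightarrow> dist (cut {..<n} x) x < r/3"
    by (auto simp: eventually_sequentially)
  have K_le: "norm (y - cut {..<n} y) \<le> r" if y: "y \<in> K" for y
  proof -
    obtain x where x: "x \<in> F" "norm (x - y) < r/3" using F(2) y by (auto simp: dist_norm)
    have "y - cut {..<n} y = (y - x) + (x - cut {..<n} x) + cut {..<n} (x - y)"
      by (simp add: blinfun.diff_right)
    also have "norm \<dots> \<le> norm (y - x) + norm (x - cut {..<n} x) + norm (cut {..<n} (x - y))"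
      by (meson norm_triangle_ineq add_right_mono order_trans)
    also have "\<dots> \<le> r/3 + r/3 + r/3"
      using x n[OF x(1)] norm_cut_le[of "{..<n}" "x - y"]
      by (intro add_mono) (auto simp: dist_norm norm_minus_commute)
    finally show ?thesis by simp
  qed
  have "norm (T f - cut {..<n} (T f)) \<le> r * norm f" for f
  proof (cases "f = 0")
    case False
    define g where "g = f /\<^sub>R norm f"
    have g: "f = norm f *\<^sub>R g" using False by (simp add: g_def)
    have "norm g \<le> 1" using False by (simp add: g_def)
    then have "T g \<in> K" unfolding K_def
      by (intro subsetD[OF closure_subset] imageI) simp
    then have "norm (T g - cut {..<n} (T g)) \<le> r" by (rule K_le)
    moreover have "T f - cut {..<n} (T f) = norm f *\<^sub>R (T g - cut {..<n} (T g))"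
      by (subst (1 2) g) (simp only: blinfun.scaleR_right scaleR_diff_right)
    ultimately show ?thesis by (simp add: mult.commute[of r] mult_left_mono)
  qed simp
  then show ?thesis by blast
qed

text \<open>Truncating the values of \<open>T\<close> leaves finitely many rows up to a small error, and each of these can be
  truncated as well. What remains is a finite combination of matrix units.\<close>

lemma compact_op_in_closed_algebra:
  assumes A: "closed_algebra A" and units: "\<And>k l. matrix_unit k l \<in> A" and T: "compact_op T"
  shows "T \<in> A"
proof -
  have clin: "T (c *\<^sub>C f) = c *\<^sub>C T f" for c f using T by (simp add: compact_op_def clinear_op_def)
  have "closed A" using A by (simp add: closed_algebra_def)
  moreover have "\<exists>S\<in>A. dist S T < r" if r: "r > 0" for r
  proof -
    obtain n where n: "\<And>f. norm (T f - cut {..<n} (T f)) \<le> r/3 * norm f"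
      using compact_op_cut[OF T, of "r/3"] r by auto
    define d where "d = r / 3 / (real n + 1)"
    have d: "d > 0" using r by (simp add: d_def)
    have "\<forall>k. \<exists>m. \<forall>j\<ge>m. \<forall>f. cmod (coord (T (f - cut {..<j} f)) k) \<le> d * norm f"
      using matrix_entry_tail[OF _ d] T by (auto simp: compact_op_def)
    then obtain M where M: "\<And>k j f. j \<ge> M k \<Longrightarrow> cmod (coord (T (f - cut {..<j} f)) k) \<le> d * norm f"
      by metis
    define m where "m = Max (M ` {..n})"
    have m: "M k \<le> m" if "k < n" for k using that by (auto simp: m_def)
    define S where "S = (\<Sum>k<n. \<Sum>l<m. scale_op (coord (T (ket l)) k) (matrix_unit k l))"
    have S: "S f = cut {..<n} (T (cut {..<m} f))" for f
    proof -
      have "S f = (\<Sum>k<n. (\<Sum>l<m. coord f l * coord (T (ket l)) k) *\<^sub>C ket k)"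
        unfolding S_def blinfun.sum_left scale_op_apply matrix_unit_apply scaleC_scaleC
          complex_vector.scale_sum_left by (simp only: mult.commute)
      also have "\<dots> = cut {..<n} (T (cut {..<m} f))"
        unfolding cut_eq_sum_ket[of n]
        by (simp only: cut_eq_sum_ket[of m] blinfun.sum_right clin coord_sum scaleC_ell2.rep_eq)
      finally show ?thesis .
    qed
    have "norm ((S - T) f) \<le> (2 * r / 3) * norm f" for f
    proof -
      have "norm (cut {..<n} (T (f - cut {..<m} f))) \<le> r/3 * norm f"
      proof -
        have "norm (cut {..<n} (T (f - cut {..<m} f)))
            \<le> (\<Sum>k<n. norm (coord (T (f - cut {..<m} f)) k *\<^sub>C ket k))"
          unfolding cut_eq_sum_ket[of n] by (rule norm_sum)
        also have "\<dots> \<le> (\<Sum>k<n. d * norm f)"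
        proof (rule sum_mono)
          fix k assume k: "k \<in> {..<n}"
          show "norm (coord (T (f - cut {..<m} f)) k *\<^sub>C ket k) \<le> d * norm f"
            using M[OF m, of k f] k by (simp add: norm_scaleC norm_ket)
        qed
        also have "\<dots> = (real n * d) * norm f" by simp
        also have "\<dots> \<le> r/3 * norm f"
          using r by (intro mult_right_mono) (auto simp: d_def field_simps)
        finally show ?thesis .
      qed
      moreover have "(S - T) f = - (T f - cut {..<n} (T f)) - cut {..<n} (T (f - cut {..<m} f))"
        by (simp add: blinfun.diff_left blinfun.diff_right S)
      ultimately show ?thesis
        using n[of f] norm_triangle_ineq4[of "- (T f - cut {..<n} (T f))" "cut {..<n} (T (f - cut {..<m} f))"]
        by (simp add: norm_minus_commute)
    qed
    then have "norm (S - T) \<le> 2 * r / 3"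
      using r by (intro norm_blinfun_bound) auto
    then have "dist S T < r" using r by (simp add: dist_norm)
    moreover have "S \<in> A"
      unfolding S_def using A units by (intro closed_algebra_sum) (auto simp: closed_algebra_def)
    ultimately show ?thesis by blast
  qed
  ultimately show ?thesis using closed_approachable by blast
qed

section \<open>Monomial representations\<close>

text \<open>By the parallelogram law \<open>f + U j\<close> is shorter than \<open>2 * norm f\<close> by a definite factor, and every
  other summand contributes at most \<open>norm f\<close>.\<close>

lemma average_contraction:
  fixes f :: "'a::real_inner" and U :: "'j \<Rightarrow> 'a"
  assumes J: "finite J" "j \<in> J" and U: "\<And>i. i \<in> J \<Longrightarrow> norm (U i) \<le> norm f"
    and move: "norm (f - U j) \<ge> \<delta> * norm f" and \<delta>: "0 \<le> \<delta>" "\<delta> \<le> 2"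
  shows "norm (f + (\<Sum>i\<in>J. U i)) \<le> (real (card J) - 1 + sqrt (4 - \<delta>\<^sup>2)) * norm f"
proof -
  have "(norm (f + U j))\<^sup>2 = 2 * (norm f)\<^sup>2 + 2 * (norm (U j))\<^sup>2 - (norm (f - U j))\<^sup>2"
    by (simp add: power2_norm_eq_inner inner_add_left inner_add_right inner_diff_left inner_diff_right
        inner_commute)
  also have "\<dots> \<le> 2 * (norm f)\<^sup>2 + 2 * (norm f)\<^sup>2 - (\<delta> * norm f)\<^sup>2"
  proof -
    have "(norm (U j))\<^sup>2 \<le> (norm f)\<^sup>2" by (rule power_mono[OF U[OF J(2)]]) simp
    moreover have "(\<delta> * norm f)\<^sup>2 \<le> (norm (f - U j))\<^sup>2"
      by (rule power_mono[OF move]) (use \<delta> in simp)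
    ultimately show ?thesis by linarith
  qed
  also have "\<dots> = (sqrt (4 - \<delta>\<^sup>2) * norm f)\<^sup>2"
    using \<delta> power_mono[OF \<delta>(2,1), of 2] by (simp add: power_mult_distrib algebra_simps)
  finally have pair: "norm (f + U j) \<le> sqrt (4 - \<delta>\<^sup>2) * norm f"
    using \<delta> power_mono[OF \<delta>(2,1), of 2] by (intro power2_le_imp_le[OF _ mult_nonneg_nonneg]) auto
  have "norm (\<Sum>i\<in>J - {j}. U i) \<le> real (card (J - {j})) * norm f"
    by (rule sum_norm_bound) (use U in auto)
  also have "real (card (J - {j})) = real (card J) - 1"
    using card.remove[OF J] by simp
  finally have rest: "norm (\<Sum>i\<in>J - {j}. U i) \<le> (real (card J) - 1) * norm f" .
  have split: "f + (\<Sum>i\<in>J. U i) = (f + U j) + (\<Sum>i\<in>J - {j}. U i)"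
    using J by (simp add: sum.remove add.assoc)
  have "norm (f + (\<Sum>i\<in>J. U i)) \<le> norm (f + U j) + norm (\<Sum>i\<in>J - {j}. U i)"
    unfolding split by (rule norm_triangle_ineq)
  also have "\<dots> \<le> sqrt (4 - \<delta>\<^sup>2) * norm f + (real (card J) - 1) * norm f"
    using pair rest by (rule add_mono)
  finally show ?thesis by (simp add: algebra_simps)
qed

lemma (in group) inv_cancel [simp]:
  assumes "x \<in> carrier G" "y \<in> carrier G"
  shows "inv x \<otimes> (x \<otimes> y) = y" "x \<otimes> (inv x \<otimes> y) = y"
  using assms by (simp_all add: m_assoc[symmetric])

text \<open>Coset representatives indexed by the natural numbers identify the square-summable functions on the
  coset space with \<^typ>\<open>ell2\<close>. The sequence \<open>s\<close> witnesses that the index is infinite.\<close>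

lemma (in group) coset_enumeration:
  assumes L: "subgroup L G" and count: "countable (carrier G)"
    and s: "\<And>i :: nat. s i \<in> carrier G" "\<And>i j. inv s i \<otimes> s j \<in> L \<Longrightarrow> i = j"
  shows "\<exists>e :: nat \<Rightarrow> 'a. (\<forall>k. e k \<in> carrier G) \<and> (\<forall>x\<in>carrier G. \<exists>!k. inv e k \<otimes> x \<in> L)"
proof -
  define R where "R = rcong\<^bsub>G\<^esub> L"
  have R: "equiv (carrier G) R"
    unfolding R_def using L by (rule subgroup.equiv_rcong) (rule is_group)
  have R_iff: "(x, y) \<in> R \<longleftrightarrow> x \<in> carrier G \<and> y \<in> carrier G \<and> inv x \<otimes> y \<in> L" for x y
    by (simp add: R_def r_congruent_def)
  define Q where "Q = carrier G // R"
  have "countable Q" using count by (simp add: Q_def quotient_def)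
  moreover have "infinite Q"
  proof
    assume "finite Q"
    moreover have "range (\<lambda>i. R `` {s i}) \<subseteq> Q" using s(1) by (auto simp: Q_def quotient_def)
    ultimately have "finite (range (\<lambda>i. R `` {s i}))" by (rule rev_finite_subset)
    moreover have "inj (\<lambda>i. R `` {s i})"
      using eq_equiv_class_iff[OF R] s by (auto intro!: injI simp: R_iff)
    ultimately show False using finite_imageD by blast
  qed
  ultimately have bij: "bij_betw (from_nat_into Q) UNIV Q" by (rule bij_betw_from_nat_into)
  have "\<forall>k. \<exists>x. x \<in> carrier G \<and> R `` {x} = from_nat_into Q k"
    using bij_betw_apply[OF bij] unfolding Q_def by (metis UNIV_I quotientE)
  then obtain e where e: "\<And>k. e k \<in> carrier G" "\<And>k. R `` {e k} = from_nat_into Q k" by metis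
  have "\<exists>!k. inv e k \<otimes> x \<in> L" if x: "x \<in> carrier G" for x
  proof -
    have "R `` {x} \<in> Q" using x by (simp add: Q_def quotientI)
    then have "R `` {x} \<in> range (from_nat_into Q)" using bij_betw_imp_surj_on[OF bij] by simp
    then have "\<exists>!k. from_nat_into Q k = R `` {x}"
      using injD[OF bij_betw_imp_inj_on[OF bij]] by auto
    moreover have "from_nat_into Q k = R `` {x} \<longleftrightarrow> inv e k \<otimes> x \<in> L" for k
      using eq_equiv_class_iff[OF R e(1) x] e x by (simp add: R_iff)
    ultimately show ?thesis by simp
  qed
  then show ?thesis using e(1) by blast
qed

text \<open>The data for inducing a unitary character \<open>\<theta>\<close> of \<open>L\<close> to \<open>G\<close>; the basis vectors \<open>ket k\<close> stand
  for the left cosets \<open>e k L\<close>.\<close>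

locale monomial = group G + subgroup L G for G (structure) and L +
  fixes \<theta> :: "'a \<Rightarrow> complex" and e :: "nat \<Rightarrow> 'a"
  assumes \<theta>_mult: "x \<in> L \<Longrightarrow> y \<in> L \<Longrightarrow> \<theta> (x \<otimes> y) = \<theta> x * \<theta> y"
    and \<theta>_norm: "x \<in> L \<Longrightarrow> cmod (\<theta> x) = 1"
    and e_closed [simp]: "e k \<in> carrier G"
    and e_ex1: "x \<in> carrier G \<Longrightarrow> \<exists>!k. inv e k \<otimes> x \<in> L"
begin

definition idx :: "'a \<Rightarrow> nat" where "idx x = (THE k. inv e k \<otimes> x \<in> L)"

definition phase :: "'a \<Rightarrow> complex" where "phase x = \<theta> (inv e (idx x) \<otimes> x)"

text \<open>Vectors correspond to functions \<open>F\<close> on \<open>G\<close> with \<open>F (x \<otimes> l) = cnj (\<theta> l) * F x\<close> for \<open>l\<close> in \<open>L\<close>. In this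
  picture, where no representatives occur, \<open>rep g\<close> is just left translation (\<open>ext_rep\<close>), and all
  computations are made there.\<close>

definition ext :: "ell2 \<Rightarrow> 'a \<Rightarrow> complex" where "ext f x = cnj (phase x) * coord f (idx x)"

definition rep :: "'a \<Rightarrow> ell2 \<Rightarrow>\<^sub>L ell2" where
  "rep g = weighted_comp (\<lambda>k. idx (inv g \<otimes> e k)) (\<lambda>k. cnj (phase (inv g \<otimes> e k)))"

lemma \<theta>_one: "\<theta> \<one> = 1"
  using \<theta>_mult[of \<one> \<one>] \<theta>_norm[of \<one>] by auto

lemma \<theta>_inv: "x \<in> L \<Longrightarrow> \<theta> (inv x) = cnj (\<theta> x)"
proof -
  assume x: "x \<in> L"
  have "\<theta> x * \<theta> (inv x) = 1" using \<theta>_mult[OF x, of "inv x"] x \<theta>_one by simp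
  moreover have "\<theta> x * cnj (\<theta> x) = 1" using \<theta>_norm[OF x] by (simp add: complex_norm_square[symmetric])
  ultimately show ?thesis by (metis mult_left_cancel mult_zero_left zero_neq_one)
qed

lemma idx_mem: "x \<in> carrier G \<Longrightarrow> inv e (idx x) \<otimes> x \<in> L"
  unfolding idx_def by (rule theI'[OF e_ex1])

lemma idx_eq: "x \<in> carrier G \<Longrightarrow> inv e k \<otimes> x \<in> L \<Longrightarrow> idx x = k"
  using e_ex1 idx_mem by blast

lemma idx_eq_iff:
  assumes x: "x \<in> carrier G" and y: "y \<in> carrier G"
  shows "idx x = idx y \<longleftrightarrow> inv x \<otimes> y \<in> L"
proof
  assume eq: "idx x = idx y"
  have "inv (inv e (idx x) \<otimes> x) \<otimes> (inv e (idx y) \<otimes> y) \<in> L"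
    by (rule m_closed[OF m_inv_closed[OF idx_mem[OF x]] idx_mem[OF y]])
  then show "inv x \<otimes> y \<in> L"
    using x y by (simp add: eq inv_mult_group m_assoc)
next
  assume "inv x \<otimes> y \<in> L"
  then have "(inv e (idx x) \<otimes> x) \<otimes> (inv x \<otimes> y) \<in> L" using idx_mem[OF x] by (rule m_closed[rotated])
  then have "inv e (idx x) \<otimes> y \<in> L" using x y by (simp add: m_assoc)
  then show "idx x = idx y" using idx_eq[OF y] by simp
qed

lemma idx_e [simp]: "idx (e k) = k"
  by (rule idx_eq) auto

lemma phase_e [simp]: "phase (e k) = 1"
  by (simp add: phase_def \<theta>_one)

lemma norm_phase: "x \<in> carrier G \<Longrightarrow> cmod (phase x) = 1"
  unfolding phase_def by (rule \<theta>_norm[OF idx_mem])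

lemma idx_right: "x \<in> carrier G \<Longrightarrow> l \<in> L \<Longrightarrow> idx (x \<otimes> l) = idx x"
  using idx_eq_iff[of x "x \<otimes> l"] by (simp add: m_assoc)

lemma ext_right:
  assumes x: "x \<in> carrier G" and l: "l \<in> L"
  shows "ext f (x \<otimes> l) = cnj (\<theta> l) * ext f x"
proof -
  have "phase (x \<otimes> l) = phase x * \<theta> l"
    using \<theta>_mult[OF idx_mem[OF x] l] x l by (simp add: phase_def idx_right m_assoc)
  then show ?thesis using x l by (simp add: ext_def idx_right)
qed

lemma ext_e [simp]: "ext f (e k) = coord f k"
  by (simp add: ext_def)

lemma ext_eqI: "(\<And>x. x \<in> carrier G \<Longrightarrow> ext f x = ext h x) \<Longrightarrow> f = h"
  by (rule ell2_eqI) (metis e_closed ext_e)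

lemma ext_linear [simp]:
  "ext 0 x = 0" "ext (f + h) x = ext f x + ext h x" "ext (f - h) x = ext f x - ext h x"
  "ext (c *\<^sub>C f) x = c * ext f x"
  by (simp_all add: ext_def algebra_simps)

lemma inj_idx_translate: "g \<in> carrier G \<Longrightarrow> inj (\<lambda>k. idx (inv g \<otimes> e k))"
proof (rule injI)
  fix k l assume g: "g \<in> carrier G" and "idx (inv g \<otimes> e k) = idx (inv g \<otimes> e l)"
  then have "inv (inv g \<otimes> e k) \<otimes> (inv g \<otimes> e l) \<in> L" using idx_eq_iff[of "inv g \<otimes> e k" "inv g \<otimes> e l"] by simp
  then have "inv e k \<otimes> e l \<in> L"
    using g by (simp add: inv_mult_group m_assoc)
  then show "k = l" using idx_eq_iff[of "e k" "e l"] by simp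
qed

lemma weights_rep: "g \<in> carrier G \<Longrightarrow> cmod (cnj (phase (inv g \<otimes> e k))) \<le> 1"
  by (simp add: norm_phase)

lemma ext_rep:
  assumes g: "g \<in> carrier G" and x: "x \<in> carrier G"
  shows "ext (rep g f) x = ext f (inv g \<otimes> x)"
proof -
  define k where "k = idx x"
  define l where "l = inv e k \<otimes> x"
  have l: "l \<in> L" unfolding l_def k_def by (rule idx_mem[OF x])
  have x_eq: "x = e k \<otimes> l" using x by (simp add: l_def m_assoc)
  have "ext (rep g f) x = cnj (\<theta> l) * coord (rep g f) k"
    using l by (simp add: x_eq ext_right)
  also have "coord (rep g f) k = ext f (inv g \<otimes> e k)"
    unfolding rep_def ext_def by (rule coord_weighted_comp[OF inj_idx_translate[OF g] weights_rep[OF g]])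
  also have "cnj (\<theta> l) * \<dots> = ext f (inv g \<otimes> e k \<otimes> l)"
    using g l by (simp add: ext_right)
  finally show ?thesis using g l by (simp add: x_eq m_assoc)
qed

lemma rep_one: "rep \<one> f = f"
  by (rule ext_eqI) (simp add: ext_rep)

lemma rep_mult:
  "g \<in> carrier G \<Longrightarrow> h \<in> carrier G \<Longrightarrow> rep (g \<otimes> h) f = rep g (rep h f)"
  by (rule ext_eqI) (simp add: ext_rep inv_mult_group m_assoc)

lemma clinear_rep: "g \<in> carrier G \<Longrightarrow> clinear_op (rep g)"
  unfolding rep_def by (rule clinear_weighted_comp[OF inj_idx_translate weights_rep])

lemma norm_rep:
  assumes g: "g \<in> carrier G" shows "norm (rep g f) = norm f"
proof (rule antisym)
  have le: "norm (rep h f) \<le> norm f" if "h \<in> carrier G" for h f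
    unfolding rep_def by (rule norm_weighted_comp_le[OF inj_idx_translate weights_rep]) fact+
  show "norm (rep g f) \<le> norm f" by (rule le[OF g])
  have "norm (rep (inv g) (rep g f)) \<le> norm (rep g f)" using g by (intro le) auto
  then show "norm f \<le> norm (rep g f)"
    using g by (simp add: rep_mult[symmetric] rep_one)
qed

lemma unitary_rep_op:
  assumes g: "g \<in> carrier G" shows "unitary (rep g)"
  unfolding unitary_def
proof (intro conjI allI)
  show "clinear_op (rep g)" by (rule clinear_rep[OF g])
  have "rep g (rep (inv g) f) = f" for f using g by (simp add: rep_mult[symmetric] rep_one)
  then show "surj (rep g)" by (metis surjI)
  have re: "inner (rep g x) (rep g y) = inner x y" for x y
  proof -
    have "(norm (rep g (x + y)))\<^sup>2 = (norm (x + y))\<^sup>2" "(norm (rep g x))\<^sup>2 = (norm x)\<^sup>2"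
      "(norm (rep g y))\<^sup>2 = (norm y)\<^sup>2" by (simp_all add: norm_rep[OF g])
    then show ?thesis
      by (simp add: power2_norm_eq_inner blinfun.add_right inner_add_left inner_add_right inner_commute)
  qed
  show "cinner (rep g x) (rep g y) = cinner x y" for x y
  proof (rule complex_eqI)
    show "Re (cinner (rep g x) (rep g y)) = Re (cinner x y)" using re by (simp add: inner_cinner)
    have "Im (cinner u v) = - inner (\<i> *\<^sub>C u) v" for u v :: ell2
      by (simp add: inner_cinner cinner_scaleC_left)
    moreover have "\<i> *\<^sub>C rep g x = rep g (\<i> *\<^sub>C x)"
      using clinear_rep[OF g] by (simp add: clinear_op_def)
    ultimately show "Im (cinner (rep g x) (rep g y)) = Im (cinner x y)" using re by simp
  qed
qed

lemma unitary_rep: "unitary_rep G rep"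
  unfolding unitary_rep_def hom_def
  by (auto simp: unitary_group_def unitary_rep_op rep_mult intro!: blinfun_eqI)

end

text \<open>An intertwining operator maps the basis vector of \<open>L1\<close> to a vector \<open>u\<close> that is an eigenvector of
  \<open>L1\<close> with character \<open>\<theta>1\<close>. The absolute value of \<open>u\<close> is constant on the orbits of \<open>L1\<close>, so the
  orbit of a coset \<open>g L2\<close> in the support of \<open>u\<close> is finite: no sequence in \<open>L1\<close> moves this coset to
  pairwise different ones. The characters agree because \<open>l \<otimes> g = g \<otimes> (inv g \<otimes> l \<otimes> g)\<close> allows to compute
  the value of \<open>u\<close> there in two ways.\<close>

lemma equivalent_monomial:
  assumes "monomial G L1 \<theta>1 e1" "monomial G L2 \<theta>2 e2"
    and "equivalent_reps G (monomial.rep G L1 \<theta>1 e1) (monomial.rep G L2 \<theta>2 e2)"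
  shows "\<exists>g\<in>carrier G.
    (\<forall>s :: nat \<Rightarrow> 'a. range s \<subseteq> L1 \<longrightarrow> (\<exists>i j. i \<noteq> j \<and> inv\<^bsub>G\<^esub> (s i \<otimes>\<^bsub>G\<^esub> g) \<otimes>\<^bsub>G\<^esub> (s j \<otimes>\<^bsub>G\<^esub> g) \<in> L2)) \<and>
    (\<forall>l\<in>L1. inv\<^bsub>G\<^esub> g \<otimes>\<^bsub>G\<^esub> l \<otimes>\<^bsub>G\<^esub> g \<in> L2 \<longrightarrow> \<theta>2 (inv\<^bsub>G\<^esub> g \<otimes>\<^bsub>G\<^esub> l \<otimes>\<^bsub>G\<^esub> g) = \<theta>1 l)"
proof -
  interpret A: monomial G L1 \<theta>1 e1 by fact
  interpret B: monomial G L2 \<theta>2 e2 by fact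
  obtain U where U: "unitary U" "\<And>g. g \<in> carrier G \<Longrightarrow> U o\<^sub>L A.rep g = B.rep g o\<^sub>L U"
    using assms(3) by (auto simp: equivalent_reps_def)
  define d where "d = ket (A.idx \<one>\<^bsub>G\<^esub>)"
  define u where "u = U d"
  have d_ext: "A.ext d x = (if x \<in> L1 then cnj (A.phase \<one>\<^bsub>G\<^esub>) * cnj (\<theta>1 x) else 0)"
    if x: "x \<in> carrier G" for x
  proof (cases "x \<in> L1")
    case True
    then have "A.ext d (\<one>\<^bsub>G\<^esub> \<otimes>\<^bsub>G\<^esub> x) = cnj (\<theta>1 x) * A.ext d \<one>\<^bsub>G\<^esub>" by (intro A.ext_right) auto
    then show ?thesis using x True by (simp add: A.ext_def d_def)
  next
    case False
    then have "A.idx x \<noteq> A.idx \<one>\<^bsub>G\<^esub>" using A.idx_eq_iff[of "\<one>\<^bsub>G\<^esub>" x] x by auto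
    then show ?thesis using False by (simp add: A.ext_def d_def)
  qed
  have d_eigen: "A.rep l d = \<theta>1 l *\<^sub>C d" if l: "l \<in> L1" for l
  proof (rule A.ext_eqI)
    fix x assume x: "x \<in> carrier G"
    have lc: "l \<in> carrier G" using l by simp
    have "inv\<^bsub>G\<^esub> l \<otimes>\<^bsub>G\<^esub> x \<in> L1 \<longleftrightarrow> x \<in> L1"
    proof
      assume "inv\<^bsub>G\<^esub> l \<otimes>\<^bsub>G\<^esub> x \<in> L1"
      then have "l \<otimes>\<^bsub>G\<^esub> (inv\<^bsub>G\<^esub> l \<otimes>\<^bsub>G\<^esub> x) \<in> L1" using l by simp
      then show "x \<in> L1" using x lc by (simp add: A.m_assoc)
    qed (use l in simp)
    then show "A.ext (A.rep l d) x = A.ext (\<theta>1 l *\<^sub>C d) x"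
      using l lc x by (simp add: A.ext_rep d_ext A.\<theta>_mult A.\<theta>_inv)
  qed
  have u_ext: "B.ext u (l \<otimes>\<^bsub>G\<^esub> x) = cnj (\<theta>1 l) * B.ext u x" if l: "l \<in> L1" and x: "x \<in> carrier G" for l x
  proof -
    have li: "inv\<^bsub>G\<^esub> l \<in> L1" and lc: "l \<in> carrier G" using l by auto
    have "B.rep (inv\<^bsub>G\<^esub> l) u = (B.rep (inv\<^bsub>G\<^esub> l) o\<^sub>L U) d" by (simp add: u_def)
    also have "\<dots> = U (A.rep (inv\<^bsub>G\<^esub> l) d)" using U(2)[of "inv\<^bsub>G\<^esub> l"] lc by (metis A.inv_closed blinfun_apply_blinfun_compose)
    also have "\<dots> = cnj (\<theta>1 l) *\<^sub>C u"
      using U(1) l li by (simp add: d_eigen A.\<theta>_inv unitary_def clinear_op_def u_def)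
    finally have "B.ext (B.rep (inv\<^bsub>G\<^esub> l) u) x = cnj (\<theta>1 l) * B.ext u x" by simp
    then show ?thesis using lc x by (simp add: B.ext_rep)
  qed
  have "cinner u u = cinner d d" using U(1) by (simp add: unitary_def u_def)
  then have "norm u = norm d" by (simp add: norm_eq_sqrt_inner inner_cinner)
  then have "u \<noteq> 0" by (auto simp: d_def norm_ket)
  then obtain k where k: "coord u k \<noteq> 0" using ell2_eqI[of u 0] by auto
  define g where "g = e2 k"
  have g: "g \<in> carrier G" by (simp add: g_def)
  have ext_g: "B.ext u g \<noteq> 0" using k by (simp add: g_def)
  have "\<exists>i j. i \<noteq> j \<and> inv\<^bsub>G\<^esub> (s i \<otimes>\<^bsub>G\<^esub> g) \<otimes>\<^bsub>G\<^esub> (s j \<otimes>\<^bsub>G\<^esub> g) \<in> L2" if s: "range s \<subseteq> L1" for s :: "nat \<Rightarrow> 'a"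
  proof (rule ccontr)
    assume no: "\<nexists>i j. i \<noteq> j \<and> inv\<^bsub>G\<^esub> (s i \<otimes>\<^bsub>G\<^esub> g) \<otimes>\<^bsub>G\<^esub> (s j \<otimes>\<^bsub>G\<^esub> g) \<in> L2"
    have s1: "s i \<in> L1" "s i \<in> carrier G" for i using s A.subset by auto
    define t where "t i = B.idx (s i \<otimes>\<^bsub>G\<^esub> g)" for i
    have sg: "s i \<otimes>\<^bsub>G\<^esub> g \<in> carrier G" for i using s1(2) g by simp
    have inj: "inj t"
    proof (rule injI)
      fix i j assume "t i = t j"
      then have "inv\<^bsub>G\<^esub> (s i \<otimes>\<^bsub>G\<^esub> g) \<otimes>\<^bsub>G\<^esub> (s j \<otimes>\<^bsub>G\<^esub> g) \<in> L2"
        unfolding t_def using B.idx_eq_iff[OF sg sg] by blast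
      then show "i = j" using no by blast
    qed
    have val: "cmod (coord u (t i)) = cmod (B.ext u g)" for i
    proof -
      have "cmod (B.ext u (s i \<otimes>\<^bsub>G\<^esub> g)) = cmod (B.ext u g)"
        using u_ext[OF s1(1) g] A.\<theta>_norm[OF s1(1)] by (simp add: norm_mult)
      then show ?thesis
        unfolding t_def using B.norm_phase[of "s i \<otimes>\<^bsub>G\<^esub> g"] g s1(2)[of i] by (simp add: B.ext_def norm_mult)
    qed
    have "(\<lambda>k. (cmod (coord u k))\<^sup>2) \<longlonglongrightarrow> 0" by (rule summable_LIMSEQ_zero[OF summable_coord])
    moreover have "(cmod (B.ext u g))\<^sup>2 > 0" using ext_g by simp
    ultimately have "\<forall>\<^sub>F k in sequentially. (cmod (coord u k))\<^sup>2 < (cmod (B.ext u g))\<^sup>2"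
      by (rule order_tendstoD)
    then have "\<forall>\<^sub>F k in cofinite. (cmod (coord u k))\<^sup>2 < (cmod (B.ext u g))\<^sup>2"
      by (simp add: cofinite_eq_sequentially)
    then have "finite {k. \<not> (cmod (coord u k))\<^sup>2 < (cmod (B.ext u g))\<^sup>2}" by (simp add: eventually_cofinite)
    moreover have "range t \<subseteq> {k. \<not> (cmod (coord u k))\<^sup>2 < (cmod (B.ext u g))\<^sup>2}" using val by auto
    ultimately have "finite (range t)" using finite_subset by blast
    then show False using inj finite_imageD by blast
  qed
  moreover have "\<theta>2 (inv\<^bsub>G\<^esub> g \<otimes>\<^bsub>G\<^esub> l \<otimes>\<^bsub>G\<^esub> g) = \<theta>1 l"
    if l: "l \<in> L1" and m: "inv\<^bsub>G\<^esub> g \<otimes>\<^bsub>G\<^esub> l \<otimes>\<^bsub>G\<^esub> g \<in> L2" for l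
  proof -
    have lc: "l \<in> carrier G" using l by simp
    have "B.ext u (g \<otimes>\<^bsub>G\<^esub> (inv\<^bsub>G\<^esub> g \<otimes>\<^bsub>G\<^esub> l \<otimes>\<^bsub>G\<^esub> g)) = cnj (\<theta>2 (inv\<^bsub>G\<^esub> g \<otimes>\<^bsub>G\<^esub> l \<otimes>\<^bsub>G\<^esub> g)) * B.ext u g"
      by (rule B.ext_right[OF g m])
    moreover have "g \<otimes>\<^bsub>G\<^esub> (inv\<^bsub>G\<^esub> g \<otimes>\<^bsub>G\<^esub> l \<otimes>\<^bsub>G\<^esub> g) = l \<otimes>\<^bsub>G\<^esub> g"
      using g lc by (simp add: A.m_assoc)
    ultimately show ?thesis using u_ext[OF l g] ext_g by simp
  qed
  ultimately show ?thesis using g by blast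
qed

lemma equivalent_reps_refl: "equivalent_reps G \<pi> \<pi>"
  unfolding equivalent_reps_def unitary_def clinear_op_def
  by (intro exI[of _ id_blinfun]) (auto intro: blinfun_eqI simp: surj_def)

section \<open>A spectral gap from disjoint translates\<close>

text \<open>On the range of \<open>P\<close> all powers of \<open>T\<close> are the identity, and on its kernel they tend to 0
  geometrically, so they converge to \<open>P\<close> in norm.\<close>

lemma projection_in_closed_algebra:
  fixes T P :: "ell2 \<Rightarrow>\<^sub>L ell2"
  assumes A: "closed_algebra A" "id_blinfun \<in> A" "T \<in> A"
    and fix_range: "\<And>f. T (P f) = P f"
    and idem: "\<And>f. P (P f) = P f"
    and kernel: "\<And>f. P f = 0 \<Longrightarrow> P (T f) = 0"
    and contract: "\<And>f. P f = 0 \<Longrightarrow> norm (T f) \<le> r * norm f"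
    and r: "0 \<le> r" "r < 1"
  shows "P \<in> A"
proof -
  define pw where "pw j = ((o\<^sub>L) T ^^ j) id_blinfun" for j :: nat
  have pw_A: "pw j \<in> A" for j
    by (induction j) (use A in \<open>auto simp: pw_def closed_algebra_def\<close>)
  have pw_Suc: "pw (Suc j) f = T (pw j f)" for j f by (simp add: pw_def)
  have pw_0: "pw 0 f = f" for f by (simp add: pw_def)
  have on_kernel: "P (pw j f) = 0 \<and> norm (pw j f) \<le> r ^ j * norm f" if "P f = 0" for j f
  proof (induction j)
    case (Suc j)
    have "norm (pw (Suc j) f) \<le> r * norm (pw j f)"
      unfolding pw_Suc using Suc by (intro contract) simp
    also have "\<dots> \<le> r * (r ^ j * norm f)" using Suc r by (intro mult_left_mono) auto
    finally show ?case using Suc kernel by (simp add: pw_Suc mult.assoc)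
  qed (simp add: pw_0 that)
  have on_range: "pw j (P f) = P f" for j f
    by (induction j) (simp_all add: pw_0 pw_Suc fix_range)
  \<comment> \<open>The constant bounds the norm of the projection onto the kernel of \<open>P\<close>.\<close>
  define C where "C = 1 + norm P"
  have bound: "norm (pw j - P) \<le> r ^ j * C" for j
  proof (rule norm_blinfun_bound)
    show "0 \<le> r ^ j * C" using r by (simp add: C_def)
    fix f
    have "P (f - P f) = 0" by (simp add: blinfun.diff_right idem)
    then have "norm (pw j (f - P f)) \<le> r ^ j * norm (f - P f)" using on_kernel by blast
    also have "norm (f - P f) \<le> C * norm f"
      using norm_triangle_ineq4[of f "P f"] norm_blinfun[of P f] by (simp add: C_def algebra_simps)
    finally show "norm ((pw j - P) f) \<le> r ^ j * C * norm f"
      using r by (simp add: blinfun.diff_left blinfun.diff_right on_range mult_left_mono mult.assoc)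
  qed
  have "pw \<longlonglongrightarrow> P"
  proof -
    have "(\<lambda>j. r ^ j * C) \<longlonglongrightarrow> 0"
      using r by (intro tendsto_mult_left_zero LIMSEQ_power_zero) auto
    then have "(\<lambda>j. pw j - P) \<longlonglongrightarrow> 0"
      by (rule Lim_null_comparison[rotated]) (simp add: bound)
    then show ?thesis by (simp add: LIM_zero_iff)
  qed
  then show ?thesis
    using A(1) pw_A closed_sequentially unfolding closed_algebra_def by blast
qed

context monomial
begin

text \<open>Unions of left cosets of \<open>L\<close>, that is, subsets of the coset space.\<close>

definition saturated :: "'a set \<Rightarrow> bool" where
  "saturated S \<longleftrightarrow> S \<subseteq> carrier G \<and> (\<forall>x\<in>S. \<forall>l\<in>L. x \<otimes> l \<in> S)"

definition restrict_to :: "'a set \<Rightarrow> ell2 \<Rightarrow>\<^sub>L ell2" where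
  "restrict_to S = cut {k. e k \<in> S}"

definition translate :: "'a \<Rightarrow> 'a set \<Rightarrow> 'a set" where
  "translate g S = {x \<in> carrier G. inv g \<otimes> x \<in> S}"

lemma saturated_e_idx:
  assumes "saturated S" "x \<in> carrier G"
  shows "e (idx x) \<in> S \<longleftrightarrow> x \<in> S"
proof
  assume "e (idx x) \<in> S"
  then have "e (idx x) \<otimes> (inv e (idx x) \<otimes> x) \<in> S"
    using assms(1) idx_mem[OF assms(2)] unfolding saturated_def by blast
  then show "x \<in> S" using assms by simp
next
  assume "x \<in> S"
  then have "x \<otimes> inv (inv e (idx x) \<otimes> x) \<in> S"
    using assms(1) m_inv_closed[OF idx_mem[OF assms(2)]] unfolding saturated_def by blast
  then show "e (idx x) \<in> S" using assms by (simp add: inv_mult_group m_assoc)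
qed

lemma ext_restrict:
  "saturated S \<Longrightarrow> x \<in> carrier G \<Longrightarrow> ext (restrict_to S f) x = (if x \<in> S then ext f x else 0)"
  by (simp add: ext_def restrict_to_def saturated_e_idx)

lemma saturated_translate:
  "g \<in> carrier G \<Longrightarrow> saturated S \<Longrightarrow> saturated (translate g S)"
  by (auto simp: saturated_def translate_def m_assoc[symmetric])

lemma restrict_translate_rep:
  assumes g: "g \<in> carrier G" and S: "saturated S"
  shows "restrict_to (translate g S) (rep g f) = rep g (restrict_to S f)"
proof (rule ext_eqI)
  fix x assume x: "x \<in> carrier G"
  then have "x \<in> translate g S \<longleftrightarrow> inv g \<otimes> x \<in> S" by (simp add: translate_def)
  then show "ext (restrict_to (translate g S) (rep g f)) x = ext (rep g (restrict_to S f)) x"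
    using assms x by (simp add: ext_restrict saturated_translate ext_rep)
qed

text \<open>With \<open>q = card I\<close>, some \<open>C i\<close> carries at least \<open>1/q\<close> of the square norm of \<open>f\<close>, so \<open>rep (g i k) f\<close> has as
  much of it on the \<open>k\<close>-th translate of \<open>C i\<close>. But \<open>f\<close> itself has at most \<open>1/(q+1)\<close> of its square norm on
  one of the \<open>q + 1\<close> disjoint translates.\<close>

lemma displacement:
  assumes I: "finite I" and C: "\<And>i. i \<in> I \<Longrightarrow> saturated (C i)"
    and cover: "\<And>x. x \<in> carrier G \<Longrightarrow> ext f x \<noteq> 0 \<Longrightarrow> \<exists>i\<in>I. x \<in> C i"
    and g: "\<And>i k. i \<in> I \<Longrightarrow> k \<le> card I \<Longrightarrow> g i k \<in> carrier G"
    and disj: "\<And>i k l x y. \<lbrakk>i \<in> I; k \<le> card I; l \<le> card I; x \<in> C i; y \<in> C i; g i k \<otimes> x = g i l \<otimes> y\<rbrakk> \<Longrightarrow> k = l"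
    and ne: "f \<noteq> 0"
  shows "\<exists>i\<in>I. \<exists>k\<le>card I.
    norm (f - rep (g i k) f) \<ge> (1 / sqrt (card I) - 1 / sqrt (real (card I) + 1)) * norm f"
proof -
  define q where "q = card I"
  obtain j where "coord f j \<noteq> 0" using ne ell2_eqI[of f 0] by auto
  then have "I \<noteq> {}" using cover[of "e j"] by auto
  then have q: "q > 0" using I by (simp add: q_def card_gt_0_iff)
  have "(norm f)\<^sup>2 \<le> (\<Sum>i\<in>I. (norm (restrict_to (C i) f))\<^sup>2)"
    unfolding restrict_to_def
  proof (rule sum_cut_cover[OF I])
    fix k assume "coord f k \<noteq> 0"
    then show "\<exists>i\<in>I. k \<in> {k. e k \<in> C i}" using cover[of "e k"] by simp
  qed
  also have "(norm f)\<^sup>2 = (\<Sum>i\<in>I. (norm f)\<^sup>2 / q)" using q by (simp add: q_def)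
  finally have "\<not> (\<Sum>i\<in>I. (norm (restrict_to (C i) f))\<^sup>2) < (\<Sum>i\<in>I. (norm f)\<^sup>2 / q)"
    by (simp only: not_less)
  then have "\<exists>i\<in>I. \<not> (norm (restrict_to (C i) f))\<^sup>2 < (norm f)\<^sup>2 / q"
    using sum_strict_mono[OF I \<open>I \<noteq> {}\<close>, of "\<lambda>i. (norm (restrict_to (C i) f))\<^sup>2" "\<lambda>_. (norm f)\<^sup>2 / q"]
    by blast
  then obtain i where i: "i \<in> I" "(norm f)\<^sup>2 / q \<le> (norm (restrict_to (C i) f))\<^sup>2"
    by (auto simp only: not_less)
  have large: "norm f / sqrt q \<le> norm (restrict_to (C i) f)"
    using i(2) by (intro power2_le_imp_le[OF _ norm_ge_zero]) (auto simp: power_divide)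
  define D where "D k = translate (g i k) (C i)" for k
  have gk: "g i k \<in> carrier G" if "k \<le> q" for k using g[OF i(1)] that by (simp add: q_def)
  have D: "saturated (D k)" if "k \<le> q" for k
    unfolding D_def using gk[OF that] C[OF i(1)] by (rule saturated_translate)
  have "disjoint_family_on (\<lambda>k. {n. e n \<in> D k}) {..q}"
    unfolding disjoint_family_on_def
  proof (intro ballI impI equals0I)
    fix k l n assume kl: "k \<in> {..q}" "l \<in> {..q}" "k \<noteq> l" and n: "n \<in> {n. e n \<in> D k} \<inter> {n. e n \<in> D l}"
    have "g i k \<otimes> (inv g i k \<otimes> e n) = g i l \<otimes> (inv g i l \<otimes> e n)" using gk kl by simp
    then have "k = l"
      using n kl by (intro disj[OF i(1)]) (auto simp: D_def translate_def q_def)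
    then show False using kl by simp
  qed
  then have "(\<Sum>k\<le>q. (norm (restrict_to (D k) f))\<^sup>2) \<le> (norm f)\<^sup>2"
    unfolding restrict_to_def by (intro sum_cut_disjoint) auto
  also have "(norm f)\<^sup>2 = (\<Sum>k\<in>{..q}. (norm f)\<^sup>2 / (q + 1))" by (simp add: field_simps)
  finally have "\<not> (\<Sum>k\<le>q. (norm f)\<^sup>2 / (q + 1)) < (\<Sum>k\<le>q. (norm (restrict_to (D k) f))\<^sup>2)"
    by (simp only: not_less)
  then have "\<exists>k\<in>{..q}. \<not> (norm f)\<^sup>2 / (q + 1) < (norm (restrict_to (D k) f))\<^sup>2"
    using sum_strict_mono[of "{..q}" "\<lambda>_. (norm f)\<^sup>2 / (q + 1)" "\<lambda>k. (norm (restrict_to (D k) f))\<^sup>2"]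
    by blast
  then obtain k where "k \<in> {..q}" and "\<not> (norm f)\<^sup>2 / (q + 1) < (norm (restrict_to (D k) f))\<^sup>2"
    by (rule bexE)
  then have k: "k \<le> q" "(norm (restrict_to (D k) f))\<^sup>2 \<le> (norm f)\<^sup>2 / (q + 1)"
    unfolding not_less atMost_iff .
  have small: "norm (restrict_to (D k) f) \<le> norm f / sqrt (real q + 1)"
    using k(2) by (intro power2_le_imp_le[OF _ divide_nonneg_nonneg]) (auto simp: power_divide add.commute)
  have "norm (restrict_to (C i) f) = norm (restrict_to (D k) (rep (g i k) f))"
    unfolding D_def by (simp add: restrict_translate_rep gk[OF k(1)] C[OF i(1)] norm_rep)
  also have "restrict_to (D k) (rep (g i k) f) = restrict_to (D k) f - restrict_to (D k) (f - rep (g i k) f)"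
    by (simp add: blinfun.diff_right)
  also have "norm \<dots> \<le> norm (restrict_to (D k) f) + norm (f - rep (g i k) f)"
    using norm_triangle_ineq4 norm_cut_le unfolding restrict_to_def by (meson add_left_mono order_trans)
  finally have "norm f / sqrt q - norm f / sqrt (real q + 1) \<le> norm (f - rep (g i k) f)"
    using large small by linarith
  then have "(1 / sqrt q - 1 / sqrt (real q + 1)) * norm f \<le> norm (f - rep (g i k) f)"
    by (simp add: algebra_simps)
  then show ?thesis using i(1) k(1) unfolding q_def by blast
qed

end

text \<open>The assumption on \<open>g\<close> that involves \<open>\<theta>\<close> says that \<open>g i k\<close> fixes the basis vectors belonging to \<open>H\<close>.
  Each \<open>C i\<close> has one translate more than there are sets \<open>C i\<close>, as the pigeonhole argument of
  \<open>displacement\<close> requires.\<close>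

locale monomial_gap = monomial +
  fixes H :: "'a set" and I :: "'i set" and C :: "'i \<Rightarrow> 'a set" and g :: "'i \<Rightarrow> nat \<Rightarrow> 'a"
  assumes H: "saturated H" and one_H: "\<one> \<in> H"
    and finite_I: "finite I" and C: "\<And>i. i \<in> I \<Longrightarrow> saturated (C i)"
    and cover: "\<And>x. x \<in> carrier G \<Longrightarrow> x \<notin> H \<Longrightarrow> \<exists>i\<in>I. x \<in> C i"
    and g_closed: "\<And>i k. i \<in> I \<Longrightarrow> k \<le> card I \<Longrightarrow> g i k \<in> carrier G"
    and g_disj: "\<And>i k l x y. \<lbrakk>i \<in> I; k \<le> card I; l \<le> card I; x \<in> C i; y \<in> C i; g i k \<otimes> x = g i l \<otimes> y\<rbrakk> \<Longrightarrow> k = l"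
    and g_trivial: "\<And>i k h. \<lbrakk>i \<in> I; k \<le> card I; h \<in> H\<rbrakk> \<Longrightarrow> inv h \<otimes> g i k \<otimes> h \<in> L \<and> \<theta> (inv h \<otimes> g i k \<otimes> h) = 1"
begin

lemma H_closed: "h \<in> H \<Longrightarrow> h \<in> carrier G"
  using H by (auto simp: saturated_def)

lemma ext_rep_on_H:
  assumes "n \<in> carrier G" "h \<in> H" "inv h \<otimes> n \<otimes> h \<in> L"
  shows "ext (rep n f) h = \<theta> (inv h \<otimes> n \<otimes> h) * ext f h"
proof -
  have h: "h \<in> carrier G" using assms H_closed by blast
  have "inv n \<otimes> h = h \<otimes> inv (inv h \<otimes> n \<otimes> h)"
    using assms(1) h by (simp add: inv_mult_group m_assoc)
  then show ?thesis
    using assms h by (simp add: ext_rep ext_right \<theta>_inv)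
qed

lemma g_preserves_H:
  assumes "i \<in> I" "k \<le> card I" "x \<in> carrier G"
  shows "inv (g i k) \<otimes> x \<in> H \<longleftrightarrow> x \<in> H"
proof
  note gk = g_closed[OF assms(1,2)]
  { assume h: "inv (g i k) \<otimes> x \<in> H"
    let ?h = "inv (g i k) \<otimes> x"
    have "?h \<otimes> (inv ?h \<otimes> g i k \<otimes> ?h) \<in> H"
      using H h g_trivial[OF assms(1,2) h] by (auto simp: saturated_def)
    then show "x \<in> H" using gk assms(3) by (simp add: inv_mult_group m_assoc) }
  { assume h: "x \<in> H"
    have "x \<otimes> inv (inv x \<otimes> g i k \<otimes> x) \<in> H"
      using H h g_trivial[OF assms(1,2) h] by (auto simp: saturated_def)
    then show "inv (g i k) \<otimes> x \<in> H" using gk assms(3) by (simp add: inv_mult_group m_assoc) }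
qed

text \<open>Including the identity with positive weight makes a single vector moved by some \<open>g i k\<close> enough for a
  strict contraction.\<close>

definition mean_op :: "ell2 \<Rightarrow>\<^sub>L ell2" where
  "mean_op = scale_op (1 / (of_nat (card (I \<times> {..card I})) + 1))
     (id_blinfun + (\<Sum>(i, k)\<in>I \<times> {..card I}. rep (g i k)))"

lemma mean_op_apply:
  "mean_op f = (1 / (of_nat (card (I \<times> {..card I})) + 1)) *\<^sub>C (f + (\<Sum>p\<in>I \<times> {..card I}. rep (g (fst p) (snd p)) f))"
  by (simp add: mean_op_def blinfun.add_left blinfun.sum_left case_prod_beta)

lemma ext_sum [simp]: "ext (\<Sum>j\<in>J. f j) x = (\<Sum>j\<in>J. ext (f j) x)"
  by (simp add: ext_def sum_distrib_left)

text \<open>The mean is the identity on vectors supported in \<open>H\<close>, and by \<open>displacement\<close> a strict contraction on those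
  that vanish on \<open>H\<close>.\<close>

lemma restrict_H_in_closed_algebra:
  assumes A: "closed_algebra A" and rep_A: "\<And>x. x \<in> carrier G \<Longrightarrow> rep x \<in> A"
  shows "restrict_to H \<in> A"
proof (cases "I = {}")
  case True
  then have "x \<in> H" if "x \<in> carrier G" for x using cover[OF that] by blast
  then have "restrict_to H f = rep \<one> f" for f
    by (intro ext_eqI) (simp add: ext_restrict[OF H] rep_one)
  then have "restrict_to H = rep \<one>" by (rule blinfun_eqI)
  then show ?thesis using rep_A by simp
next
  case False
  define q where "q = card I"
  define J where "J = I \<times> {..card I}"
  \<comment> \<open>The distance by which a unit vector is moved, and the resulting contraction factor of the mean.\<close>
  define \<delta> where "\<delta> = 1 / sqrt q - 1 / sqrt (real q + 1)"
  define r where "r = (real (card J) - 1 + sqrt (4 - \<delta>\<^sup>2)) / (real (card J) + 1)"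
  have q: "q \<ge> 1" using False finite_I by (simp add: q_def Suc_le_eq card_gt_0_iff)
  have J: "finite J" "card J \<ge> 1" using finite_I q by (auto simp: J_def q_def card_cartesian_product)
  have "1 / sqrt (real q + 1) < 1 / sqrt q" using q by (intro divide_strict_left_mono) auto
  moreover have "1 / sqrt q \<le> 1" using q by simp
  moreover have "1 / sqrt (real q + 1) > 0" by simp
  ultimately have \<delta>: "0 < \<delta>" "\<delta> < 1" unfolding \<delta>_def by linarith+
  have "\<delta>\<^sup>2 < 1" using \<delta> by (simp add: power_less_one_iff abs_square_less_1)
  then have "sqrt (4 - \<delta>\<^sup>2) \<ge> 0" by simp
  moreover have "sqrt (4 - \<delta>\<^sup>2) < sqrt 4" using \<delta>
    by (intro real_sqrt_less_mono) auto
  moreover have "real (card J) \<ge> 1" using J(2) by linarith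
  ultimately have r: "0 \<le> r" "r < 1"
    unfolding r_def by (auto simp: divide_less_eq intro!: divide_nonneg_pos)
  have rep_id: "rep \<one> = id_blinfun" by (rule blinfun_eqI) (simp add: rep_one)
  show ?thesis
  proof (rule projection_in_closed_algebra[OF A _ _ _ _ _ _ r, of mean_op])
    show "id_blinfun \<in> A" using rep_A[of \<one>] by (simp add: rep_id)
    show "mean_op \<in> A"
    proof -
      have "(\<Sum>(i, k)\<in>I \<times> {..card I}. rep (g i k)) \<in> A"
        using rep_A g_closed by (intro closed_algebra_sum[OF A]) auto
      then show ?thesis
        using A \<open>id_blinfun \<in> A\<close> by (simp add: mean_op_def closed_algebra_def)
    qed
    show "restrict_to H (restrict_to H f) = restrict_to H f" for f
      by (rule ext_eqI) (simp add: ext_restrict[OF H])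
    have ext_J: "ext (rep (g (fst p) (snd p)) f) x = ext f x" if "p \<in> J" "x \<in> H" for p f x
      using that g_trivial[of "fst p" "snd p" x] g_closed[of "fst p" "snd p"]
      by (subst ext_rep_on_H) (auto simp: J_def)
    have ext_J0: "ext (rep (g (fst p) (snd p)) f) x = 0"
      if "p \<in> J" "x \<in> carrier G" "\<And>y. y \<in> carrier G \<Longrightarrow> (y \<in> H \<longleftrightarrow> x \<in> H) \<Longrightarrow> ext f y = 0" for p f x
      using that g_closed[of "fst p" "snd p"] g_preserves_H[of "fst p" "snd p" x]
      by (auto simp: J_def ext_rep)
    show "mean_op (restrict_to H f) = restrict_to H f" for f
    proof (rule ext_eqI)
      fix x assume x: "x \<in> carrier G"
      show "ext (mean_op (restrict_to H f)) x = ext (restrict_to H f) x"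
      proof (cases "x \<in> H")
        case True
        define y where "y = ext (restrict_to H f) x"
        have nz: "of_nat (card J) + (1::complex) \<noteq> 0"
          by (metis of_nat_Suc of_nat_eq_0_iff add.commute nat.distinct(1))
        have "ext (mean_op (restrict_to H f)) x = 1 / (of_nat (card J) + 1) * (y + of_nat (card J) * y)"
          using True by (simp add: mean_op_apply J_def[symmetric] ext_J y_def)
        also have "y + of_nat (card J) * y = (of_nat (card J) + 1) * y" by (simp add: algebra_simps)
        also have "1 / (of_nat (card J) + 1) * \<dots> = y" using nz by simp
        finally show ?thesis by (simp add: y_def)
      next
        case False
        then show ?thesis
          using x by (simp add: mean_op_apply J_def[symmetric] ext_J0 ext_restrict[OF H])
      qed
    qed
    fix f assume f0: "restrict_to H f = 0"
    have off_H: "ext f x = 0" if "x \<in> H" for x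
      using ext_restrict[OF H H_closed[OF that], of f] f0 that by simp
    show "restrict_to H (mean_op f) = 0"
      by (rule ext_eqI)
         (auto simp: ext_restrict[OF H] mean_op_apply J_def[symmetric] ext_J off_H)
    show "norm (mean_op f) \<le> r * norm f"
    proof (cases "f = 0")
      case False
      have "\<exists>i\<in>I. \<exists>k\<le>card I. norm (f - rep (g i k) f) \<ge> \<delta> * norm f"
        unfolding \<delta>_def q_def
        by (rule displacement[OF finite_I C _ g_closed g_disj False]) (use cover off_H in auto)
      then obtain p where p: "p \<in> J" "norm (f - rep (g (fst p) (snd p)) f) \<ge> \<delta> * norm f"
        by (force simp: J_def)
      have "norm (f + (\<Sum>p\<in>J. rep (g (fst p) (snd p)) f)) \<le> (real (card J) - 1 + sqrt (4 - \<delta>\<^sup>2)) * norm f"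
      proof (rule average_contraction[OF J(1) p(1)])
        show "norm (rep (g (fst j) (snd j)) f) \<le> norm f" if "j \<in> J" for j
          using that g_closed by (auto simp: norm_rep J_def)
      qed (use \<delta> p(2) in auto)
      moreover have "cmod (1 / (of_nat (card J) + 1)) = 1 / (real (card J) + 1)"
        using norm_of_nat[of "Suc (card J)", where 'a = complex] by (simp add: norm_divide add.commute)
      ultimately show ?thesis
        by (simp add: mean_op_apply J_def[symmetric] norm_scaleC r_def divide_right_mono)
    qed simp
  qed
qed

end

text \<open>\<open>F\<close> contains representatives of the finitely many cosets of \<open>L\<close> in \<open>H\<close>. The elements \<open>n\<close> act on the basis
  vectors belonging to \<open>H\<close> diagonally, on that of \<open>h\<close> with eigenvalue \<open>\<theta> (inv h \<otimes> n \<otimes> h)\<close>.\<close>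

locale monomial_separated = monomial_gap +
  fixes F :: "'a set"
  assumes L_H: "L \<subseteq> H"
    and F: "finite F" "F \<subseteq> H" "\<And>h. h \<in> H \<Longrightarrow> \<exists>s\<in>F. inv s \<otimes> h \<in> L"
    and separate: "\<And>h. h \<in> H \<Longrightarrow> h \<notin> L \<Longrightarrow>
      \<exists>n\<in>carrier G. (\<forall>x\<in>H. inv x \<otimes> n \<otimes> x \<in> L) \<and> \<theta> (inv h \<otimes> n \<otimes> h) \<noteq> \<theta> n"
begin

lemma conj_character_right:
  assumes "x \<in> H" "l \<in> L" "n \<in> carrier G" "inv x \<otimes> n \<otimes> x \<in> L"
  shows "\<theta> (inv (x \<otimes> l) \<otimes> n \<otimes> (x \<otimes> l)) = \<theta> (inv x \<otimes> n \<otimes> x)"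
proof -
  have "inv (x \<otimes> l) \<otimes> n \<otimes> (x \<otimes> l) = inv l \<otimes> ((inv x \<otimes> n \<otimes> x) \<otimes> l)"
    using assms H_closed by (simp add: inv_mult_group m_assoc)
  then have "\<theta> (inv (x \<otimes> l) \<otimes> n \<otimes> (x \<otimes> l)) = cnj (\<theta> l) * (\<theta> (inv x \<otimes> n \<otimes> x) * \<theta> l)"
    using assms by (simp add: \<theta>_mult \<theta>_inv)
  moreover have "cnj (\<theta> l) * \<theta> l = 1"
    using \<theta>_norm[OF assms(2)] by (simp add: complex_norm_square[symmetric] mult.commute)
  ultimately show ?thesis by (simp add: mult.left_commute)
qed

text \<open>Each coset in \<open>E\<close> is killed by a factor \<open>(rep n - a) / (\<theta> n - a)\<close>, where \<open>a\<close> is the eigenvalue of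
  \<open>rep n\<close> there; this factor is 1 on the coset \<open>L\<close>.\<close>

lemma separating_operator:
  assumes A: "closed_algebra A" and rep_A: "\<And>x. x \<in> carrier G \<Longrightarrow> rep x \<in> A"
    and E: "finite E" "E \<subseteq> H - L"
  shows "\<exists>D\<in>A. \<exists>d. (\<forall>f. \<forall>x\<in>H. ext (blinfun_apply D f) x = d x * ext f x) \<and>
    (\<forall>x\<in>L. d x = 1) \<and> (\<forall>s\<in>E. \<forall>l\<in>L. d (s \<otimes> l) = 0)"
  using E
proof (induction E)
  case empty
  show ?case by (intro bexI[of _ "rep \<one>"] exI[of _ "\<lambda>_. 1"]) (auto simp: rep_one rep_A)
next
  case (insert s E)
  then obtain D d where D: "D \<in> A" "\<And>f x. x \<in> H \<Longrightarrow> ext (blinfun_apply D f) x = d x * ext f x"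
    "\<And>x. x \<in> L \<Longrightarrow> d x = 1" "\<And>s l. s \<in> E \<Longrightarrow> l \<in> L \<Longrightarrow> d (s \<otimes> l) = 0"
    by blast
  have s: "s \<in> H" "s \<notin> L" using insert.prems by auto
  obtain n where n: "n \<in> carrier G" "\<And>x. x \<in> H \<Longrightarrow> inv x \<otimes> n \<otimes> x \<in> L" "\<theta> (inv s \<otimes> n \<otimes> s) \<noteq> \<theta> n"
    using separate[OF s] by blast
  define a where "a = \<theta> (inv s \<otimes> n \<otimes> s)"
  define D' where "D' = scale_op (1 / (\<theta> n - a)) (rep n + scale_op (- a) (rep \<one>))"
  define d' where "d' x = (\<theta> (inv x \<otimes> n \<otimes> x) - a) / (\<theta> n - a)" for x
  have D'A: "D' \<in> A" using A rep_A n(1) by (simp add: D'_def closed_algebra_def)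
  have D': "ext (blinfun_apply D' f) x = d' x * ext f x" if "x \<in> H" for f x
    using n that
    by (simp add: D'_def d'_def blinfun.add_left rep_one ext_rep_on_H diff_divide_distrib ring_distribs
        mult.commute)
  have nL: "n \<in> L" using n(1) n(2)[OF one_H] by simp
  have "d' x = 1" if "x \<in> L" for x
    using conj_character_right[OF one_H that n(1)] nL n that by (simp add: d'_def a_def)
  moreover have "d' (s \<otimes> l) = 0" if "l \<in> L" for l
    using conj_character_right[OF s(1) that n(1) n(2)[OF s(1)]] by (simp add: d'_def a_def)
  moreover have "D o\<^sub>L D' \<in> A" using A D(1) D'A by (simp add: closed_algebra_def)
  ultimately show ?case
    by (intro bexI[of _ "D o\<^sub>L D'"] exI[of _ "\<lambda>x. d x * d' x"]) (auto simp: D D')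
qed

lemma restrict_L_in_closed_algebra:
  assumes A: "closed_algebra A" and rep_A: "\<And>x. x \<in> carrier G \<Longrightarrow> rep x \<in> A"
  shows "restrict_to L \<in> A"
proof -
  have sat_L: "saturated L" using subset by (auto simp: saturated_def)
  have "finite (F - L)" "F - L \<subseteq> H - L" using F(1,2) by auto
  from separating_operator[OF A rep_A this] obtain D d where "D \<in> A"
    and "\<forall>f. \<forall>x\<in>H. ext (blinfun_apply D f) x = d x * ext f x"
    and "\<forall>x\<in>L. d x = 1" and "\<forall>s\<in>F - L. \<forall>l\<in>L. d (s \<otimes> l) = 0"
    by auto
  then have D: "D \<in> A" "\<And>f x. x \<in> H \<Longrightarrow> ext (blinfun_apply D f) x = d x * ext f x"
    "\<And>x. x \<in> L \<Longrightarrow> d x = 1" "\<And>s l. s \<in> F - L \<Longrightarrow> l \<in> L \<Longrightarrow> d (s \<otimes> l) = 0"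
    by auto
  have d0: "d x = 0" if x: "x \<in> H" "x \<notin> L" for x
  proof -
    obtain s where s: "s \<in> F" "inv s \<otimes> x \<in> L" using F(3)[OF x(1)] by blast
    have sc: "s \<in> carrier G" and xc: "x \<in> carrier G" using F(2) s(1) x(1) H_closed by auto
    have "s \<notin> L"
    proof
      assume "s \<in> L"
      then have "s \<otimes> (inv s \<otimes> x) \<in> L" using s(2) by (rule m_closed)
      then show False using sc xc x(2) by simp
    qed
    then have "d (s \<otimes> (inv s \<otimes> x)) = 0" using s by (intro D(4)) auto
    then show ?thesis using sc xc by simp
  qed
  have "restrict_to L = restrict_to H o\<^sub>L D"
    by (intro blinfun_eqI ext_eqI)
       (use L_H in \<open>auto simp: ext_restrict[OF sat_L] ext_restrict[OF H] D d0\<close>)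
  then show ?thesis
    using A D(1) restrict_H_in_closed_algebra[OF A rep_A] by (simp add: closed_algebra_def)
qed

lemma matrix_unit_in_closed_algebra:
  assumes A: "closed_algebra A" and rep_A: "\<And>x. x \<in> carrier G \<Longrightarrow> rep x \<in> A"
  shows "matrix_unit k l \<in> A"
proof -
  have sat_L: "saturated L" using subset by (auto simp: saturated_def)
  have "matrix_unit k l f = rep (e k) (restrict_to L (rep (inv e l) f))" for f
  proof (rule ell2_eqI)
    fix j
    have "coord (rep (e k) (restrict_to L (rep (inv e l) f))) j
        = ext (rep (e k) (restrict_to L (rep (inv e l) f))) (e j)" by simp
    also have "\<dots> = (if inv e k \<otimes> e j \<in> L then ext f (e l \<otimes> (inv e k \<otimes> e j)) else 0)"
      by (subst ext_rep) (auto simp: ext_restrict[OF sat_L] ext_rep)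
    also have "inv e k \<otimes> e j \<in> L \<longleftrightarrow> j = k"
      using idx_eq_iff[of "e k" "e j"] by auto
    also have "(if j = k then ext f (e l \<otimes> (inv e k \<otimes> e j)) else 0) = coord (matrix_unit k l f) j"
      by simp
    finally show "coord (matrix_unit k l f) j = coord (rep (e k) (restrict_to L (rep (inv e l) f))) j" ..
  qed
  then have "matrix_unit k l = rep (e k) o\<^sub>L (restrict_to L o\<^sub>L rep (inv e l))"
    by (intro blinfun_eqI) simp
  then show ?thesis
    using A rep_A restrict_L_in_closed_algebra[OF A rep_A] by (simp add: closed_algebra_def)
qed

text \<open>The operators preserving an invariant closed subspace \<open>V\<close> form a closed algebra, so it contains all
  matrix units. If \<open>V\<close> is nonzero, then these produce all basis vectors.\<close>

theorem irreducible: "irreducible_rep G rep"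
  unfolding irreducible_rep_def
proof (intro conjI allI impI)
  show "unitary_rep G rep" by (rule unitary_rep)
  have "ket 0 \<noteq> 0" using norm_ket[of 0] by auto
  then show "(UNIV :: ell2 set) \<noteq> {0}" by blast
  fix V :: "ell2 set"
  assume V: "csubspace V \<and> closed V \<and> (\<forall>g\<in>carrier G. blinfun_apply (rep g) ` V \<subseteq> V)"
  define A where "A = {T :: ell2 \<Rightarrow>\<^sub>L ell2. blinfun_apply T ` V \<subseteq> V}"
  have A_eq: "A = (\<Inter>v\<in>V. (\<lambda>T. blinfun_apply T v) -` V)" by (auto simp: A_def)
  have "closed ((\<lambda>T. blinfun_apply T v) -` V)" for v :: ell2
    using V by (intro closed_vimage continuous_intros) auto
  then have "closed A" unfolding A_eq by (intro closed_INT) auto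
  then have "closed_algebra A"
    using V unfolding closed_algebra_def A_def
    by (auto simp: image_subset_iff blinfun.add_left complex_vector.subspace_0 complex_vector.subspace_add
        complex_vector.subspace_scale)
  moreover have "rep x \<in> A" if "x \<in> carrier G" for x using V that by (simp add: A_def)
  ultimately have units: "matrix_unit k l \<in> A" for k l by (rule matrix_unit_in_closed_algebra)
  show "V = {0} \<or> V = UNIV"
  proof (rule disjCI)
    assume "V \<noteq> UNIV"
    have "v = 0" if v: "v \<in> V" for v
    proof (rule ccontr)
      assume "v \<noteq> 0"
      then obtain l where l: "coord v l \<noteq> 0" using ell2_eqI[of v 0] by auto
      have "ket k \<in> V" for k
      proof -
        have "coord v l *\<^sub>C ket k \<in> V" using units[of k l] v by (auto simp: A_def)
        then have "(1 / coord v l) *\<^sub>C coord v l *\<^sub>C ket k \<in> V"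
          using V complex_vector.subspace_scale by blast
        then show ?thesis using l by (simp add: scaleC_scaleC)
      qed
      then have "cut {..<n} f \<in> V" for n f
        unfolding cut_eq_sum_ket using V
        by (intro complex_vector.subspace_sum complex_vector.subspace_scale) auto
      then have "f \<in> V" for f
        using V by (intro closed_sequentially[of V "\<lambda>n. cut {..<n} f" f] cut_tendsto) auto
      then show False using \<open>V \<noteq> UNIV\<close> by blast
    qed
    moreover have "0 \<in> V" using V complex_vector.subspace_0 by auto
    ultimately show "V = {0}" by auto
  qed
qed

theorem traceable: "traceable G rep"
  unfolding traceable_def
proof (intro conjI subsetI)
  show "irreducible_rep G rep" by (rule irreducible)
  fix T :: "ell2 \<Rightarrow>\<^sub>L ell2" assume "T \<in> {T. compact_op T}"
  then have T: "compact_op T" by simp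
  show "T \<in> cstar_generated (rep ` carrier G)"
    unfolding cstar_generated_def
  proof (rule InterI, clarify)
    fix A :: "(ell2 \<Rightarrow>\<^sub>L ell2) set" assume A: "cstar_subalgebra A" "rep ` carrier G \<subseteq> A"
    have cl: "closed_algebra A" using A(1) by (auto simp: cstar_subalgebra_def closed_algebra_def)
    show "T \<in> A"
      by (rule compact_op_in_closed_algebra[OF cl matrix_unit_in_closed_algebra[OF cl] T]) (use A(2) in auto)
  qed
qed

end

section \<open>Representations trivial on the center\<close>

context group
begin

lemma center_normal: "center G \<lhd> G"
proof -
  have "subgroup (center G) G"
  proof (rule subgroupI)
    show "inv z \<in> center G" if z: "z \<in> center G" for z
    proof -
      have zc: "z \<in> carrier G" and com: "\<And>g. g \<in> carrier G \<Longrightarrow> z \<otimes> g = g \<otimes> z"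
        using z by (auto simp: center_def)
      have "inv z \<otimes> g = g \<otimes> inv z" if g: "g \<in> carrier G" for g
      proof -
        have "inv z \<otimes> g = inv z \<otimes> (g \<otimes> z) \<otimes> inv z" using zc g by (simp add: m_assoc)
        also have "\<dots> = g \<otimes> inv z" using zc g by (simp add: com[symmetric] m_assoc)
        finally show ?thesis .
      qed
      then show ?thesis using zc by (simp add: center_def)
    qed
    show "y \<otimes> z \<in> center G" if y: "y \<in> center G" and z: "z \<in> center G" for y z
    proof -
      have yc: "y \<in> carrier G" and zc: "z \<in> carrier G" using y z by (auto simp: center_def)
      have "y \<otimes> z \<otimes> g = g \<otimes> (y \<otimes> z)" if g: "g \<in> carrier G" for g
      proof -
        have "y \<otimes> z \<otimes> g = y \<otimes> (g \<otimes> z)" using z g yc by (simp add: center_def m_assoc)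
        also have "\<dots> = y \<otimes> g \<otimes> z" using yc zc g by (simp add: m_assoc)
        also have "y \<otimes> g = g \<otimes> y" using y g by (simp add: center_def)
        finally show ?thesis using yc zc g by (simp add: m_assoc)
      qed
      then show ?thesis using yc zc by (simp add: center_def)
    qed
  qed (auto simp: center_def)
  moreover have "x \<otimes> z \<otimes> inv x \<in> center G" if "x \<in> carrier G" "z \<in> center G" for x z
  proof -
    have "x \<otimes> z = z \<otimes> x" "z \<in> carrier G" using that by (auto simp: center_def)
    then show ?thesis using that by (simp add: m_assoc)
  qed
  ultimately show ?thesis unfolding normal_inv_iff by blast
qed

text \<open>Elements of the same coset of the center differ by a factor that \<open>\<pi>\<close> maps to the identity.\<close>

lemma rep_mod_center:
  assumes rep: "unitary_rep G \<pi>" and triv: "trivial_central_character G \<pi>"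
  shows "\<exists>\<rho>. unitary_rep (G Mod center G) \<rho> \<and> (\<forall>g\<in>carrier G. \<pi> g = \<rho> (center G #> g))"
proof -
  have hom: "\<pi> \<in> hom G unitary_group" using rep by (simp add: unitary_rep_def)
  have "\<pi> x = \<pi> y" if xy: "x \<in> carrier G" "y \<in> carrier G" "center G #> x = center G #> y" for x y
  proof -
    have "x \<in> center G #> y"
      using xy center_normal by (metis normal_imp_subgroup rcos_self)
    then obtain z where z: "z \<in> center G" "x = z \<otimes> y" by (auto simp: r_coset_def)
    then have "z \<in> carrier G" by (simp add: center_def)
    then have "\<pi> x = \<pi> z o\<^sub>L \<pi> y"
      using hom_mult[OF hom, of z y] xy z by (simp add: unitary_group_def)
    also have "\<pi> z = id_blinfun" using triv z by (simp add: trivial_central_character_def)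
    also have "id_blinfun o\<^sub>L \<pi> y = \<pi> y" by (rule blinfun_eqI) simp
    finally show ?thesis .
  qed
  from FactGroup_universal[OF hom center_normal this] show ?thesis
    unfolding unitary_rep_def by metis
qed

end

lemma (in monomial) rep_central:
  assumes z: "z \<in> L" "\<theta> z = 1" and com: "\<And>x. x \<in> carrier G \<Longrightarrow> z \<otimes> x = x \<otimes> z"
  shows "rep z = id_blinfun"
proof (rule blinfun_eqI)
  fix f
  have zc: "z \<in> carrier G" using z by simp
  show "rep z f = id_blinfun f"
  proof (rule ext_eqI)
    fix x assume x: "x \<in> carrier G"
    have "inv z \<otimes> x = inv z \<otimes> (x \<otimes> z) \<otimes> inv z" using zc x by (simp add: m_assoc)
    also have "\<dots> = x \<otimes> inv z" using zc x by (simp add: com[symmetric] m_assoc)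
    finally show "ext (rep z f) x = ext (id_blinfun f) x"
      using z zc x by (simp add: ext_rep ext_right \<theta>_inv)
  qed
qed

section \<open>Nontrivial valuation rings\<close>

definition is_subring :: "'a::field set \<Rightarrow> bool" where
  "is_subring R \<longleftrightarrow> 1 \<in> R \<and> (\<forall>x\<in>R. \<forall>y\<in>R. x - y \<in> R \<and> x * y \<in> R)"

context
  fixes R :: "'a::field set"
  assumes R: "is_subring R"
begin

lemma is_subring_1: "1 \<in> R" and is_subring_diff: "x \<in> R \<Longrightarrow> y \<in> R \<Longrightarrow> x - y \<in> R"
  and is_subring_mult: "x \<in> R \<Longrightarrow> y \<in> R \<Longrightarrow> x * y \<in> R"
  using R by (auto simp: is_subring_def)

lemma is_subring_0: "0 \<in> R"
  using is_subring_diff[OF is_subring_1 is_subring_1] by simp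

lemma is_subring_minus: "x \<in> R \<Longrightarrow> - x \<in> R"
  using is_subring_diff[OF is_subring_0, of x] by simp

lemma is_subring_add: "x \<in> R \<Longrightarrow> y \<in> R \<Longrightarrow> x + y \<in> R"
  using is_subring_diff[OF _ is_subring_minus, of x y] by simp

lemma is_subring_sum: "(\<And>i. i \<in> I \<Longrightarrow> f i \<in> R) \<Longrightarrow> sum f I \<in> R"
  by (induction I rule: infinite_finite_induct) (auto simp: is_subring_0 is_subring_add)

lemma is_subring_power: "x \<in> R \<Longrightarrow> x ^ n \<in> R"
  by (induction n) (auto simp: is_subring_1 is_subring_mult)

lemma is_subring_poly: "(\<And>i. poly.coeff p i \<in> R) \<Longrightarrow> x \<in> R \<Longrightarrow> poly p x \<in> R"
  unfolding poly_altdef by (intro is_subring_sum is_subring_mult is_subring_power)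

lemma coeff_mult_in_subring:
  "(\<And>i. poly.coeff p i \<in> R) \<Longrightarrow> (\<And>i. poly.coeff q i \<in> R) \<Longrightarrow> poly.coeff (p * q) i \<in> R"
  unfolding coeff_mult by (intro is_subring_sum is_subring_mult)

lemma is_subring_adjoin:
  "is_subring {poly p x |p. \<forall>i. poly.coeff p i \<in> R}" "R \<subseteq> {poly p x |p. \<forall>i. poly.coeff p i \<in> R}"
  "x \<in> {poly p x |p. \<forall>i. poly.coeff p i \<in> R}"
proof -
  show "is_subring {poly p x |p. \<forall>i. poly.coeff p i \<in> R}"
    unfolding is_subring_def
  proof (intro conjI ballI)
    show "1 \<in> {poly p x |p. \<forall>i. poly.coeff p i \<in> R}"
      by (intro CollectI exI[of _ 1]) (auto simp: is_subring_0 is_subring_1)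
    fix a b assume "a \<in> {poly p x |p. \<forall>i. poly.coeff p i \<in> R}" "b \<in> {poly p x |p. \<forall>i. poly.coeff p i \<in> R}"
    then obtain p q where "a = poly p x" "b = poly q x" "\<And>i. poly.coeff p i \<in> R" "\<And>i. poly.coeff q i \<in> R"
      by blast
    then show "a - b \<in> {poly p x |p. \<forall>i. poly.coeff p i \<in> R}" "a * b \<in> {poly p x |p. \<forall>i. poly.coeff p i \<in> R}"
      by (intro CollectI exI[of _ "p - q"] exI[of _ "p * q"];
          simp add: is_subring_diff coeff_mult_in_subring)+
  qed
  show "R \<subseteq> {poly p x |p. \<forall>i. poly.coeff p i \<in> R}"
  proof
    fix a assume "a \<in> R"
    then show "a \<in> {poly p x |p. \<forall>i. poly.coeff p i \<in> R}"
      by (intro CollectI exI[of _ "[:a:]"]) (auto simp: is_subring_0 coeff_pCons split: nat.split)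
  qed
  show "x \<in> {poly p x |p. \<forall>i. poly.coeff p i \<in> R}"
    by (intro CollectI exI[of _ "[:0, 1:]"])
       (auto simp: is_subring_0 is_subring_1 coeff_pCons split: nat.split)
qed

end

definition valuation_ring :: "'a::field set \<Rightarrow> bool" where
  "valuation_ring R \<longleftrightarrow> is_subring R \<and> (\<forall>x. x \<in> R \<or> inverse x \<in> R)"

text \<open>Write \<open>inverse t\<close> as a polynomial in \<open>x\<close> of degree \<open>n\<close> and as a polynomial in \<open>inverse x\<close> of degree
  \<open>d \<le> n\<close>. As \<open>1 - t * b\<close> is a unit for the constant term \<open>b\<close> of the latter, \<open>x ^ d\<close> is a polynomial
  in \<open>x\<close> of smaller degree, and the leading term of the former can be eliminated.\<close>

lemma reduce_degree:
  fixes R :: "'a::field set"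
  assumes R: "is_subring R" and t: "t \<in> R" "inverse t \<notin> R"
    and unit: "\<And>a. a \<in> R \<Longrightarrow> inverse (1 - t * a) \<in> R"
    and p: "\<And>i. poly.coeff p i \<in> R" "poly p x = inverse t"
    and q: "\<And>i. poly.coeff q i \<in> R" "poly q (inverse x) = inverse t"
    and x: "x \<noteq> 0" and le: "Polynomial.degree q \<le> Polynomial.degree p"
  shows "\<exists>p'. (\<forall>i. poly.coeff p' i \<in> R) \<and> poly p' x = inverse t \<and> Polynomial.degree p' < Polynomial.degree p"
proof -
  have t0: "t \<noteq> 0" using t is_subring_0[OF R] by auto
  obtain b q' where q_eq: "q = pCons b q'" by (cases q)
  have b: "b \<in> R" and q': "poly.coeff q' i \<in> R" for i
    using q(1)[of 0] q(1)[of "Suc i"] by (simp_all add: q_eq)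
  define u where "u = 1 - t * b"
  have u0: "u \<noteq> 0"
  proof
    assume "u = 0"
    then have "b = inverse t" using t0 by (simp add: u_def field_simps)
    then show False using t b by simp
  qed
  have "q' \<noteq> 0" using q(2) b t by (auto simp: q_eq)
  then have deg_q: "Polynomial.degree q = Suc (Polynomial.degree q')" by (simp add: q_eq)
  define c where "c = t * inverse u"
  have c: "c \<in> R" unfolding c_def u_def using is_subring_mult[OF R t(1) unit[OF b]] .
  have "t * (b + inverse x * poly q' (inverse x)) = 1" using q(2) t0 by (simp add: q_eq)
  then have "u = t * (inverse x * poly q' (inverse x))" by (simp add: u_def algebra_simps)
  then have "c * (inverse x * poly q' (inverse x)) = 1" using u0 by (simp add: c_def field_simps)
  then have "x = c * poly q' (inverse x)" using x by (simp add: field_simps)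
  then have "x ^ Polynomial.degree q = c * (x ^ Polynomial.degree q' * poly q' (inverse x))"
    unfolding deg_q by (metis mult.left_commute mult.commute power_Suc)
  then have xm: "x ^ Polynomial.degree q = c * poly (reflect_poly q') x"
    using x by (simp add: poly_reflect_poly_nz)
  define n where "n = Polynomial.degree p"
  define r where "r = Polynomial.smult (poly.coeff p n * c) (Polynomial.monom 1 (n - Polynomial.degree q) * reflect_poly q')"
  define p' where "p' = p - Polynomial.monom (poly.coeff p n) n + r"
  have r_R: "poly.coeff r i \<in> R" for i
  proof -
    have "poly.coeff (Polynomial.monom 1 (n - Polynomial.degree q) * reflect_poly q') i \<in> R"
      using q' by (intro coeff_mult_in_subring[OF R])
        (auto simp: coeff_reflect_poly is_subring_0[OF R] is_subring_1[OF R])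
    then show ?thesis unfolding r_def coeff_smult
      using is_subring_mult[OF R is_subring_mult[OF R p(1) c]] by blast
  qed
  have "Polynomial.degree r \<le> (n - Polynomial.degree q) + Polynomial.degree q'"
    unfolding r_def
    by (intro order_trans[OF degree_smult_le] order_trans[OF degree_mult_le] add_mono degree_monom_le
        degree_reflect_poly_le)
  then have deg_r: "Polynomial.degree r < n" using le deg_q by (simp add: n_def)
  have "poly.coeff p' i = 0" if "i \<ge> n" for i
    using that deg_r coeff_eq_0[of r i] coeff_eq_0[of p i] by (cases "i = n") (auto simp: p'_def n_def)
  then have "Polynomial.degree p' < n"
    using deg_r by (intro degree_lessI) auto
  moreover have "poly.coeff p' i \<in> R" for i
    unfolding p'_def using p(1) r_R
    by (auto intro!: is_subring_add[OF R] is_subring_diff[OF R] simp: is_subring_0[OF R])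
  moreover have "poly p' x = inverse t"
  proof -
    have "x ^ n = x ^ (n - Polynomial.degree q) * x ^ Polynomial.degree q" using le by (simp add: n_def flip: power_add)
    then have "poly r x = poly.coeff p n * x ^ n"
      by (simp add: r_def poly_monom xm mult_ac)
    then show ?thesis using p(2) by (simp add: p'_def poly_monom)
  qed
  ultimately show ?thesis unfolding n_def by blast
qed

text \<open>By Zorn's lemma there is a maximal subring \<open>V\<close> that contains \<open>R\<close> but not \<open>inverse t\<close>. Adjoining an element
  outside \<open>V\<close> makes \<open>inverse t\<close> a polynomial in this element. Applied to \<open>inverse (1 - t * a)\<close> this shows that
  \<open>1 - t * a\<close> is a unit of \<open>V\<close>; applied to \<open>x\<close> and \<open>inverse x\<close> it contradicts \<open>reduce_degree\<close>.\<close>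

theorem valuation_ring_exists:
  fixes R :: "'a::field set"
  assumes R: "is_subring R" and t: "t \<in> R" "inverse t \<notin> R"
  shows "\<exists>V. valuation_ring V \<and> R \<subseteq> V \<and> inverse t \<notin> V"
proof -
  define \<A> where "\<A> = {S. is_subring S \<and> R \<subseteq> S \<and> inverse t \<notin> S}"
  have "\<exists>V\<in>\<A>. \<forall>W\<in>\<A>. V \<subseteq> W \<longrightarrow> W = V"
  proof (rule subset_Zorn_nonempty)
    show "\<A> \<noteq> {}" using R t by (auto simp: \<A>_def)
    fix \<C> assume \<C>: "\<C> \<noteq> {}" "subset.chain \<A> \<C>"
    then have sub: "\<C> \<subseteq> \<A>" by (auto simp: subset.chain_def)
    have "is_subring (\<Union>\<C>)"
      unfolding is_subring_def
    proof (intro conjI ballI)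
      show "1 \<in> \<Union>\<C>" using \<C>(1) sub by (auto simp: \<A>_def is_subring_def)
      fix x y assume "x \<in> \<Union>\<C>" "y \<in> \<Union>\<C>"
      then obtain W Y where XY: "W \<in> \<C>" "Y \<in> \<C>" "x \<in> W" "y \<in> Y" by blast
      then have "W \<subseteq> Y \<or> Y \<subseteq> W" using \<C>(2) by (auto simp: subset_chain_def)
      then obtain Z where Z: "Z \<in> \<C>" "x \<in> Z" "y \<in> Z" using XY by blast
      then have "is_subring Z" using sub by (auto simp: \<A>_def)
      then show "x - y \<in> \<Union>\<C>" "x * y \<in> \<Union>\<C>" using Z by (auto simp: is_subring_def)
    qed
    then show "\<Union>\<C> \<in> \<A>" using \<C>(1) sub by (auto simp: \<A>_def)
  qed
  then obtain V where "V \<in> \<A>" and maximal: "\<forall>W\<in>\<A>. V \<subseteq> W \<longrightarrow> W = V" by (rule bexE)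
  then have V: "is_subring V" "R \<subseteq> V" "inverse t \<notin> V" by (simp_all add: \<A>_def)
  have max: "W = V" if "is_subring W" "V \<subseteq> W" "inverse t \<notin> W" for W
    using maximal that V(2) by (simp add: \<A>_def)
  have tV: "t \<in> V" using t V by blast
  have t0: "t \<noteq> 0" using V is_subring_0[OF V(1)] by auto
  have adjoin: "\<exists>p. (\<forall>i. poly.coeff p i \<in> V) \<and> poly p y = inverse t" if y: "y \<notin> V" for y
  proof -
    have "{poly p y |p. \<forall>i. poly.coeff p i \<in> V} \<noteq> V" using is_subring_adjoin(3)[OF V(1), of y] y by blast
    then have "inverse t \<in> {poly p y |p. \<forall>i. poly.coeff p i \<in> V}"
      using max[OF is_subring_adjoin(1,2)[OF V(1)]] by blast
    then show ?thesis by force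
  qed
  have unit: "inverse (1 - t * a) \<in> V" if a: "a \<in> V" for a
  proof (rule ccontr)
    define u where "u = 1 - t * a"
    assume nV: "inverse (1 - t * a) \<notin> V"
    then have u0: "u \<noteq> 0" using is_subring_0[OF V(1)] by (auto simp: u_def)
    obtain p where p: "\<And>i. poly.coeff p i \<in> V" "poly p (inverse u) = inverse t"
      using adjoin nV unfolding u_def by blast
    have uV: "u \<in> V" unfolding u_def using V(1) a tV
      by (intro is_subring_diff is_subring_mult is_subring_1)
    have "poly (reflect_poly p) u \<in> V"
      using p(1) uV by (intro is_subring_poly[OF V(1)]) (auto simp: coeff_reflect_poly is_subring_0[OF V(1)])
    then have mem: "u ^ Polynomial.degree p * inverse t \<in> V" using u0 p(2) by (simp add: poly_reflect_poly_nz)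
    have "\<exists>b\<in>V. u ^ n = 1 - t * b" for n
    proof (induction n)
      case 0
      then show ?case using is_subring_0[OF V(1)] by (intro bexI[of _ 0]) auto
    next
      case (Suc n)
      then obtain b where "b \<in> V" "u ^ n = 1 - t * b" by blast
      then have "u ^ Suc n = u * (1 - t * b)" by simp
      also have "\<dots> = 1 - t * (a + u * b)" by (simp add: u_def algebra_simps)
      finally show ?case
        using is_subring_add[OF V(1) a is_subring_mult[OF V(1) uV \<open>b \<in> V\<close>]] by blast
    qed
    then obtain b where b: "b \<in> V" "u ^ Polynomial.degree p = 1 - t * b" by blast
    have "u ^ Polynomial.degree p * inverse t + b = inverse t"
      using t0 by (simp add: b(2) field_simps)
    then show False using is_subring_add[OF V(1) mem b(1)] V(3) by simp
  qed
  have "x \<in> V \<or> inverse x \<in> V" for x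
  proof (rule ccontr)
    assume "\<not> ?thesis"
    then have nx: "x \<notin> V" "inverse x \<notin> V" by auto
    then have x0: "x \<noteq> 0" using is_subring_0[OF V(1)] by auto
    \<comment> \<open>Of two such expressions the one of larger degree can be shortened, which cannot go on forever.\<close>
    have "\<not> ((\<forall>i. poly.coeff p i \<in> V) \<and> poly p x = inverse t \<and> (\<forall>i. poly.coeff q i \<in> V) \<and>
        poly q (inverse x) = inverse t)" for p q
    proof (induction "Polynomial.degree p + Polynomial.degree q" arbitrary: p q rule: less_induct)
      case less
      show ?case
      proof
        assume pq: "(\<forall>i. poly.coeff p i \<in> V) \<and> poly p x = inverse t \<and> (\<forall>i. poly.coeff q i \<in> V) \<and>
          poly q (inverse x) = inverse t"
        show False
        proof (cases "Polynomial.degree q \<le> Polynomial.degree p")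
          case True
          then obtain p' where "\<forall>i. poly.coeff p' i \<in> V" "poly p' x = inverse t" "Polynomial.degree p' < Polynomial.degree p"
            using reduce_degree[OF V(1) tV V(3) unit, of p x q] pq x0 by blast
          then show False using less[of p' q] pq by auto
        next
          case False
          then obtain q' where "\<forall>i. poly.coeff q' i \<in> V" "poly q' (inverse x) = inverse t" "Polynomial.degree q' < Polynomial.degree q"
            using reduce_degree[OF V(1) tV V(3) unit, of q "inverse x" p] pq x0 by auto
          then show False using less[of p q'] pq by auto
        qed
      qed
    qed
    then show False using adjoin[OF nx(1)] adjoin[OF nx(2)] by blast
  qed
  then show ?thesis using V unfolding valuation_ring_def by blast
qed

lemma is_subring_iff: "is_subring R \<longleftrightarrow> subring R (ring_of_type_algebra :: 'a::field ring)"
proof -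
  interpret K: field "ring_of_type_algebra :: 'a ring" by (rule field_from_type_algebra)
  have minus: "\<ominus>\<^bsub>ring_of_type_algebra\<^esub> x = - x" for x :: 'a
    using K.minus_equality[of "- x" x] by (simp add: ring_of_type_algebra_def)
  show ?thesis
  proof
    assume "is_subring R"
    note R = this
    show "subring R (ring_of_type_algebra :: 'a ring)"
    proof (rule K.subringI)
      show "\<ominus>\<^bsub>ring_of_type_algebra\<^esub> x \<in> R" if "x \<in> R" for x
        unfolding minus by (rule is_subring_minus[OF R that])
    qed (auto simp: ring_of_type_algebra_def is_subring_1[OF R] is_subring_mult[OF R] is_subring_add[OF R])
  next
    assume R: "subring R (ring_of_type_algebra :: 'a ring)"
    note E = subringE[OF R, unfolded minus]
    have "x - y \<in> R" if "x \<in> R" "y \<in> R" for x y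
      using E(7)[OF that(1) E(5)[OF that(2)]] by (simp add: ring_of_type_algebra_def)
    then show "is_subring R"
      using E(3,6) by (auto simp: is_subring_def ring_of_type_algebra_def)
  qed
qed

lemma subfield_of_subring:
  fixes R :: "'a::field set"
  assumes "is_subring R" "\<And>x. x \<in> R \<Longrightarrow> inverse x \<in> R"
  shows "subfield R ring_of_type_algebra"
proof -
  interpret K: field "ring_of_type_algebra :: 'a ring" by (rule field_from_type_algebra)
  have "inv\<^bsub>ring_of_type_algebra\<^esub> x = inverse x" if "x \<noteq> 0" for x :: 'a
    using that by (intro K.comm_inv_char) (auto simp: ring_of_type_algebra_def)
  then show ?thesis
    using assms is_subring_iff by (intro K.subfieldI') (auto simp: ring_of_type_algebra_def)
qed

text \<open>If all subrings were fields, then the one generated by 1 would be a finite field, and every \<open>x\<close> would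
  be algebraic over it because adjoining \<open>x\<close> gives a field.\<close>

lemma non_field_subring_exists:
  assumes "\<not> algebraic_over_finite_field TYPE('a::field)"
  shows "\<exists>R (t :: 'a). is_subring R \<and> t \<in> R \<and> inverse t \<notin> R"
proof (rule ccontr)
  assume "\<not> ?thesis"
  then have closed: "inverse x \<in> R" if "is_subring R" "x \<in> R" for R :: "'a set" and x
    using that by blast
  interpret K: field "ring_of_type_algebra :: 'a ring" by (rule field_from_type_algebra)
  define Z where "Z = range (of_int :: int \<Rightarrow> 'a)"
  have Z: "is_subring Z"
    unfolding is_subring_def Z_def
    by (auto intro: range_eqI[of _ _ 1] simp flip: of_int_diff of_int_mult)
  have "CHAR('a) \<noteq> 0"
  proof
    assume char: "CHAR('a) = 0"
    then have inj: "(of_int k :: 'a) = 0 \<longleftrightarrow> k = 0" for k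
      by (simp add: of_int_eq_0_iff_char_dvd)
    have "of_int 2 \<in> Z" by (simp only: Z_def rangeI)
    then have "inverse (of_int 2) \<in> Z" by (rule closed[OF Z])
    then obtain k where k: "inverse (of_int 2 :: 'a) = of_int k" by (auto simp: Z_def)
    have "(of_int 2 :: 'a) * of_int k = 1" using inj[of 2] by (simp flip: k)
    then have "(of_int (2 * k - 1) :: 'a) = 0" by simp
    then show False unfolding inj by presburger
  qed
  then have pos: "int CHAR('a) > 0" by simp
  have "Z \<subseteq> of_int ` {0..<int CHAR('a)}"
  proof
    fix x assume "x \<in> Z"
    then obtain k where k: "x = of_int k" by (auto simp: Z_def)
    have "(of_int (k - k mod int CHAR('a)) :: 'a) = 0"
      by (simp only: of_int_eq_0_iff_char_dvd) (simp add: minus_mod_eq_mult_div)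
    then have "x = of_int (k mod int CHAR('a))" by (simp add: k)
    then show "x \<in> of_int ` {0..<int CHAR('a)}" using pos by auto
  qed
  then have fin: "finite Z" by (rule finite_subset) simp
  have sub: "subfield Z ring_of_type_algebra" using Z closed by (intro subfield_of_subring)
  have "ring.algebraic ring_of_type_algebra Z x" for x
  proof -
    have x: "x \<in> carrier ring_of_type_algebra" by (simp add: ring_of_type_algebra_def)
    have "subring Z ring_of_type_algebra" using Z by (simp add: is_subring_iff)
    then have "is_subring (K.simple_extension Z x)"
      unfolding is_subring_iff using x by (rule K.simple_extension_is_subring)
    then have "subfield (K.simple_extension Z x) ring_of_type_algebra"
      using closed by (intro subfield_of_subring)
    then show ?thesis
      using K.simple_extension_is_subfield[OF sub x] by (simp add: over_def)
  qed
  then show False using assms fin sub unfolding algebraic_over_finite_field_def by blast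
qed

section \<open>Characters of the multiplicative group of a field\<close>

definition unit_character :: "('a::field \<Rightarrow> complex) \<Rightarrow> bool" where
  "unit_character \<psi> \<longleftrightarrow> (\<forall>x y. x \<noteq> 0 \<longrightarrow> y \<noteq> 0 \<longrightarrow> \<psi> (x * y) = \<psi> x * \<psi> y) \<and> (\<forall>x. x \<noteq> 0 \<longrightarrow> cmod (\<psi> x) = 1)"

text \<open>Graphs of unitary characters of subgroups of the multiplicative group; single-valuedness is
  expressed at 1, where it suffices.\<close>

definition partial_character :: "('a::field \<times> complex) set \<Rightarrow> bool" where
  "partial_character S \<longleftrightarrow> (1, 1) \<in> S \<and>
     (\<forall>x u y v. (x, u) \<in> S \<longrightarrow> (y, v) \<in> S \<longrightarrow> (x / y, u / v) \<in> S) \<and>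
     (\<forall>x u. (x, u) \<in> S \<longrightarrow> x \<noteq> 0 \<and> cmod u = 1) \<and> (\<forall>u. (1, u) \<in> S \<longrightarrow> u = 1)"

context
  fixes S :: "('a::field \<times> complex) set"
  assumes S: "partial_character S"
begin

lemma partial_character_mult:
  assumes "(x, u) \<in> S" "(y, v) \<in> S" shows "(x * y, u * v) \<in> S"
proof -
  have "(1 / y, 1 / v) \<in> S" using S assms unfolding partial_character_def by blast
  then have "(x / (1 / y), u / (1 / v)) \<in> S" using S assms unfolding partial_character_def by blast
  then show ?thesis by simp
qed

lemma partial_character_powi: "(x, u) \<in> S \<Longrightarrow> (x powi k, u powi k) \<in> S"
proof -
  assume xu: "(x, u) \<in> S"
  have pos: "(x ^ n, u ^ n) \<in> S" for n
    by (induction n) (use S xu partial_character_mult in \<open>auto simp: partial_character_def\<close>)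
  have "(1 / x ^ n, 1 / u ^ n) \<in> S" for n
    using S pos[of n] unfolding partial_character_def by blast
  then show ?thesis using pos
    by (cases k rule: int_cases2) (auto simp: power_int_minus inverse_eq_divide)
qed

lemma partial_character_unique:
  assumes "(x, u) \<in> S" "(x, v) \<in> S" shows "u = v"
proof -
  have "(x / x, u / v) \<in> S" "x \<noteq> 0" "cmod v = 1" using S assms unfolding partial_character_def by blast+
  then have "u / v = 1" "v \<noteq> 0" using S by (auto simp: partial_character_def)
  then show ?thesis by simp
qed

text \<open>The circle is divisible: if \<open>n\<close> is the least positive exponent such that \<open>y ^ n\<close> is in the domain, then any
  \<open>n\<close>-th root of the value at \<open>y ^ n\<close> can serve as the value \<open>w\<close> at \<open>y\<close>; if there is no such exponent, then
  \<open>w = 1\<close> can.\<close>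

lemma partial_character_extend:
  assumes y: "y \<noteq> 0"
  shows "\<exists>T w. partial_character T \<and> S \<subseteq> T \<and> (y, w) \<in> T"
proof -
  obtain w where w: "cmod w = 1" "\<And>x u k. (x, u) \<in> S \<Longrightarrow> x * y powi k = 1 \<Longrightarrow> u * w powi k = 1"
  proof (cases "\<exists>n>0. y ^ n \<in> Domain S")
    case False
    have "u * 1 powi k = 1" if xu: "(x, u) \<in> S" "x * y powi k = 1" for x u k
    proof (cases "k = 0")
      case True
      then show ?thesis using S xu by (auto simp: partial_character_def)
    next
      case k: False
      have xk: "x = y powi (- k)" using xu(2) y by (simp add: power_int_minus field_simps)
      have "y powi \<bar>k\<bar> \<in> Domain S"
      proof (cases "k < 0")
        case True
        then show ?thesis using xu xk by auto
      next
        case False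
        then show ?thesis using partial_character_powi[OF xu(1), of "-1"] xk
          by (auto simp: power_int_minus)
      qed
      moreover have "y powi \<bar>k\<bar> = y ^ nat \<bar>k\<bar>" by (simp add: power_int_def)
      ultimately show ?thesis using False k by (metis zero_less_abs_iff zero_less_nat_eq)
    qed
    then show ?thesis using that[of 1] by simp
  next
    case True
    define n where "n = (LEAST n. n > 0 \<and> y ^ n \<in> Domain S)"
    have n: "n > 0" "y ^ n \<in> Domain S"
      using LeastI_ex[OF True[simplified]] unfolding n_def by auto
    have least: "\<not> (m > 0 \<and> y ^ m \<in> Domain S)" if "m < n" for m
      using not_less_Least that unfolding n_def by blast
    obtain v where v: "(y ^ n, v) \<in> S" using n(2) by blast
    obtain w where w: "w ^ n = v" using exists_complex_root[of n v] n(1) by auto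
    have "cmod v = 1" using S v by (auto simp: partial_character_def)
    then have "cmod w ^ n = 1" using w by (simp flip: norm_power)
    then have w1: "cmod w = 1" using power_eq_imp_eq_base[of "cmod w" n 1] n(1) by simp
    then have w0: "w \<noteq> 0" by auto
    have "u * w powi k = 1" if xu: "(x, u) \<in> S" "x * y powi k = 1" for x u k
    proof -
      have k_eq: "k = int n * (k div int n) + k mod int n" by simp
      have yk: "(y powi k, 1 / u) \<in> S"
      proof -
        have "(1 / x, 1 / u) \<in> S" using S xu(1) unfolding partial_character_def by blast
        moreover have "1 / x = y powi k" using xu(2) by (metis eq_divide_eq mult.commute mult_zero_left zero_neq_one)
        ultimately show ?thesis by simp
      qed
      have step: "(y powi (int n * j), w powi (int n * j)) \<in> S" for j
        using partial_character_powi[OF v, of j] by (simp add: power_int_mult flip: w)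
      have "(y powi k / y powi (int n * (k div int n)), (1 / u) / w powi (int n * (k div int n))) \<in> S"
        using S yk step unfolding partial_character_def by blast
      moreover have "y powi k / y powi (int n * (k div int n)) = y powi (k mod int n)"
        using y by (simp add: minus_mult_div_eq_mod flip: power_int_diff)
      ultimately have "y powi (k mod int n) \<in> Domain S" by auto
      moreover have "y powi (k mod int n) = y ^ nat (k mod int n)" using n(1) by (simp add: power_int_def)
      moreover have "nat (k mod int n) < n" using n(1) by (simp add: nat_less_iff)
      ultimately have "nat (k mod int n) = 0" using least[of "nat (k mod int n)"] by auto
      then have "k mod int n = 0" using n(1) by (metis nat_eq_iff2 of_nat_0 pos_mod_sign of_nat_0_less_iff nat_0_iff order_antisym)
      then have "k = int n * (k div int n)" using k_eq by simp
      then have "(y powi k, w powi k) \<in> S" using step[of "k div int n"] by simp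
      then have "w powi k = 1 / u" using partial_character_unique yk by blast
      moreover have "cmod u = 1" using S xu(1) unfolding partial_character_def by blast
      then have "u \<noteq> 0" by auto
      ultimately show ?thesis by simp
    qed
    then show ?thesis using that w1 by blast
  qed
  have w0: "w \<noteq> 0" using w(1) by auto
  define T where "T = {(x * y powi k, u * w powi k) |x u k. (x, u) \<in> S}"
  have in_T: "(x, u) \<in> S \<Longrightarrow> (x * y powi k, u * w powi k) \<in> T" for x u k by (auto simp: T_def)
  have "partial_character T"
    unfolding partial_character_def
  proof (intro conjI allI impI)
    have "(1, 1) \<in> S" using S by (simp add: partial_character_def)
    then show "(1, 1) \<in> T" using in_T[of 1 1 0] by simp
  next
    fix a b c d assume ab: "(a, b) \<in> T" and cd: "(c, d) \<in> T"
    obtain x u k where 1: "(x, u) \<in> S" "a = x * y powi k" "b = u * w powi k"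
      using ab by (auto simp: T_def)
    obtain x' u' k' where 2: "(x', u') \<in> S" "c = x' * y powi k'" "d = u' * w powi k'"
      using cd by (auto simp: T_def)
    have "(x / x', u / u') \<in> S" using 1(1) 2(1) S unfolding partial_character_def by blast
    then show "(a / c, b / d) \<in> T"
      using in_T[of "x / x'" "u / u'" "k - k'"] y w0 by (simp add: 1 2 power_int_diff)
  next
    fix a b assume "(a, b) \<in> T"
    then obtain x u k where "(x, u) \<in> S" "a = x * y powi k" "b = u * w powi k" by (auto simp: T_def)
    moreover then have "x \<noteq> 0" "cmod u = 1" using S by (auto simp: partial_character_def)
    ultimately show "a \<noteq> 0" "cmod b = 1" using y w(1) by (auto simp: norm_mult norm_power_int)
  next
    fix b assume "(1, b) \<in> T"
    then obtain x u k where "(x, u) \<in> S" "1 = x * y powi k" "b = u * w powi k" by (auto simp: T_def)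
    then show "b = 1" using w(2) by auto
  qed
  moreover have "S \<subseteq> T" using in_T[of _ _ 0] by auto
  moreover have "(y, w) \<in> T" using in_T[of 1 1 1] S by (simp add: partial_character_def)
  ultimately show ?thesis by blast
qed

end

theorem unit_character_exists:
  fixes t :: "'a::field"
  assumes t: "t \<noteq> 0" "\<And>n. n > 0 \<Longrightarrow> t ^ n \<noteq> 1" and z: "cmod z = 1"
  shows "\<exists>\<psi>. unit_character \<psi> \<and> \<psi> t = z"
proof -
  define S0 where "S0 = {(t powi k, z powi k) |k. True}"
  have z0: "z \<noteq> 0" using z by auto
  have inf: "k = 0" if "t powi k = 1" for k
  proof (rule ccontr)
    assume "k \<noteq> 0"
    have "t powi \<bar>k\<bar> = 1" using that by (cases "k \<ge> 0") (auto simp: power_int_minus)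
    then have "t ^ nat \<bar>k\<bar> = 1" by (simp add: power_int_def)
    then show False using t(2)[of "nat \<bar>k\<bar>"] \<open>k \<noteq> 0\<close> by simp
  qed
  have S0: "partial_character S0"
    unfolding partial_character_def
  proof (intro conjI allI impI)
    show "(1, 1) \<in> S0" unfolding S0_def by (force intro: exI[of _ 0])
    fix x u y v assume "(x, u) \<in> S0" "(y, v) \<in> S0"
    then obtain k l where "x = t powi k" "u = z powi k" "y = t powi l" "v = z powi l" by (auto simp: S0_def)
    then show "(x / y, u / v) \<in> S0"
      using t z0 unfolding S0_def by (auto intro!: exI[of _ "k - l"] simp: power_int_diff)
  next
    fix x u assume "(x, u) \<in> S0"
    then show "x \<noteq> 0" "cmod u = 1" using t z by (auto simp: S0_def norm_power_int)
  next
    fix u assume "(1, u) \<in> S0"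
    then obtain k where "t powi k = 1" "u = z powi k" by (auto simp: S0_def)
    then show "u = 1" using inf[of k] by simp
  qed
  define \<A> where "\<A> = {S :: ('a \<times> complex) set. partial_character S \<and> S0 \<subseteq> S}"
  have "\<exists>M\<in>\<A>. \<forall>W\<in>\<A>. M \<subseteq> W \<longrightarrow> W = M"
  proof (rule subset_Zorn_nonempty)
    show "\<A> \<noteq> {}" using S0 by (auto simp: \<A>_def)
    fix \<C> assume \<C>: "\<C> \<noteq> {}" "subset.chain \<A> \<C>"
    then have sub: "\<And>W. W \<in> \<C> \<Longrightarrow> partial_character W \<and> S0 \<subseteq> W" by (auto simp: subset.chain_def \<A>_def)
    have "partial_character (\<Union>\<C>)"
      unfolding partial_character_def
    proof (intro conjI allI impI)
      show "(1, 1) \<in> \<Union>\<C>" using \<C>(1) sub by (auto simp: partial_character_def)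
      fix x u y v assume "(x, u) \<in> \<Union>\<C>" "(y, v) \<in> \<Union>\<C>"
      then obtain W Y where XY: "W \<in> \<C>" "Y \<in> \<C>" "(x, u) \<in> W" "(y, v) \<in> Y" by blast
      then have "W \<subseteq> Y \<or> Y \<subseteq> W" using \<C>(2) by (auto simp: subset_chain_def)
      then obtain Z where Z: "Z \<in> \<C>" "(x, u) \<in> Z" "(y, v) \<in> Z" using XY by blast
      then have "partial_character Z" using sub by blast
      then have "(x / y, u / v) \<in> Z" using Z unfolding partial_character_def by blast
      then show "(x / y, u / v) \<in> \<Union>\<C>" using Z by blast
    next
      fix x u assume "(x, u) \<in> \<Union>\<C>"
      then show "x \<noteq> 0" "cmod u = 1" using sub unfolding partial_character_def by blast+
    next
      fix u assume "(1, u) \<in> \<Union>\<C>"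
      then show "u = 1" using sub unfolding partial_character_def by blast
    qed
    then show "\<Union>\<C> \<in> \<A>" using \<C>(1) sub by (auto simp: \<A>_def)
  qed
  then obtain M where "M \<in> \<A>" and maximal: "\<forall>W\<in>\<A>. M \<subseteq> W \<longrightarrow> W = M" by (rule bexE)
  then have M: "partial_character M" "S0 \<subseteq> M" by (simp_all add: \<A>_def)
  have max: "W = M" if "partial_character W" "M \<subseteq> W" for W
    using maximal that M(2) by (simp add: \<A>_def)
  have "\<exists>u. (x, u) \<in> M" if "x \<noteq> 0" for x
    using partial_character_extend[OF M(1) that] max by blast
  then obtain \<psi> where \<psi>: "\<And>x. x \<noteq> 0 \<Longrightarrow> (x, \<psi> x) \<in> M" by metis
  have "unit_character \<psi>"
    unfolding unit_character_def
  proof (intro conjI allI impI)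
    fix x y :: 'a assume "x \<noteq> 0" "y \<noteq> 0"
    then have "(x * y, \<psi> (x * y)) \<in> M" "(x * y, \<psi> x * \<psi> y) \<in> M"
      using \<psi> partial_character_mult[OF M(1)] by auto
    then show "\<psi> (x * y) = \<psi> x * \<psi> y" by (rule partial_character_unique[OF M(1)])
  next
    fix x :: 'a assume "x \<noteq> 0"
    then show "cmod (\<psi> x) = 1" using \<psi> M(1) unfolding partial_character_def by blast
  qed
  moreover have "(t, z) \<in> M" using M(2) unfolding S0_def by (force intro: exI[of _ 1])
  then have "\<psi> t = z" using \<psi>[OF t(1)] partial_character_unique[OF M(1)] by blast
  ultimately show ?thesis by blast
qed

lemma uncountable_unit_circle: "uncountable {z. cmod z = 1}"
proof
  assume "countable {z. cmod z = 1}"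
  then have "countable (Re ` {z. cmod z = 1})" by simp
  moreover have "{0..1} \<subseteq> Re ` {z. cmod z = 1}"
  proof
    fix x :: real assume x: "x \<in> {0..1}"
    then have "cmod (Complex x (sqrt (1 - x\<^sup>2))) = 1" by (simp add: cmod_def power_le_one)
    then show "x \<in> Re ` {z. cmod z = 1}" by (intro image_eqI[of _ _ "Complex x (sqrt (1 - x\<^sup>2))"]) auto
  qed
  ultimately have "countable {0..1::real}" using countable_subset by blast
  then show False using uncountable_closed_interval[of 0 "1::real"] by simp
qed

section \<open>Transvections and sectors\<close>

lemma matrix_vector_scale: "A *v (c *s x) = c *s (A *v (x :: 'a::comm_ring_1 ^ 'n))"
  by (simp add: vec_eq_iff matrix_vector_mult_def sum_distrib_left mult.left_commute)

lemma matrix_vector_axis: "(A *v axis p 1) $ i = (A :: 'a::comm_ring_1 ^ 'n ^ 'm) $ i $ p"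
  by (simp add: matrix_vector_mult_def axis_def if_distrib cong: if_cong)

definition transvection :: "'n \<Rightarrow> 'n \<Rightarrow> 'a \<Rightarrow> 'a::comm_ring_1 ^ 'n ^ 'n" where
  "transvection i j a = (\<chi> k l. (if k = l then 1 else 0) + (if k = i \<and> l = j then a else 0))"

lemma transvection_vector:
  "(transvection i j a *v x) $ k = x $ k + (if k = i then a * x $ j else 0)"
proof -
  have "(transvection i j a *v x) $ k
      = (\<Sum>l\<in>UNIV. (if k = l then x $ l else 0) + (if l = j then (if k = i then a * x $ l else 0) else 0))"
    unfolding matrix_vector_mult_def transvection_def vec_lambda_beta
    by (rule sum.cong) (auto simp: distrib_right)
  then show ?thesis by (simp add: sum.distrib)
qed

lemma transvection_vector_eq: "transvection i j a *v x = x + (a * x $ j) *s axis i 1"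
  by (simp add: vec_eq_iff transvection_vector axis_def)

lemma det_transvection: "i \<noteq> j \<Longrightarrow> det (transvection i j a) = (1 :: 'a::comm_ring_1)"
proof -
  assume ij: "i \<noteq> j"
  have "transvection i j a = (\<chi> k. if k = i then row i (mat 1) + a *s row j (mat 1) else row k (mat 1))"
    by (simp add: vec_eq_iff transvection_def row_def mat_def)
  then show ?thesis using det_row_operation[OF ij, of "mat 1 :: 'a^_^_" a] by simp
qed

lemma finite_total_max:
  assumes "finite J" "J \<noteq> {}" and total: "\<And>x y. below x y \<or> below y x"
    and trans: "\<And>x y z. below x y \<Longrightarrow> below y z \<Longrightarrow> below x z"
  shows "\<exists>i\<in>J. \<forall>j\<in>J. below (v j) (v i)"
  using assms(1,2)
proof (induction J rule: finite_ne_induct)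
  case (singleton x)
  then show ?case using total by blast
next
  case (insert x J)
  then obtain i where i: "i \<in> J" "\<And>j. j \<in> J \<Longrightarrow> below (v j) (v i)" by blast
  show ?case
  proof (cases "below (v x) (v i)")
    case True
    then show ?thesis using i by (intro bexI[of _ i]) auto
  next
    case False
    then have xi: "below (v i) (v x)" using total by blast
    have "below (v j) (v x)" if "j \<in> insert x J" for j
      using that total[of "v x" "v x"] trans[OF i(2) xi] by auto
    then show ?thesis by blast
  qed
qed

text \<open>A matrix group that contains all transvections, with a relation \<open>below x y\<close> read as ``\<open>x\<close> is at most as
  large as \<open>y\<close>''. The assumption \<open>spread\<close> says that for a nonzero \<open>b\<close>, translation by the multiples
  \<open>a k * b\<close> makes the set of the elements below \<open>b\<close> disjoint from itself. The index \<open>p\<close> is that of the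
  distinguished coordinate line.\<close>

locale linear_group = group G for G :: "('a::comm_ring_1 ^ 'n ^ 'n) monoid" (structure) +
  fixes p :: 'n and below :: "'a \<Rightarrow> 'a \<Rightarrow> bool" and a :: "nat \<Rightarrow> 'a"
  assumes mult_eq: "A \<otimes> B = A ** B" and one_eq: "\<one> = mat 1"
    and transvection_in: "i \<noteq> j \<Longrightarrow> transvection i j b \<in> carrier G"
    and card: "CARD('n) \<ge> 3"
    and below_total: "below x y \<or> below y x" and below_trans: "below x y \<Longrightarrow> below y z \<Longrightarrow> below x z"
    and below_0: "below x 0 \<Longrightarrow> x = 0" and below_mult: "below x y \<Longrightarrow> below (c * x) (c * y)"
    and spread: "below x b \<Longrightarrow> below y b \<Longrightarrow> b \<noteq> 0 \<Longrightarrow> x + a k * b = y + a l * b \<Longrightarrow> k = l"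
begin

lemma mult_vector: "(x \<otimes> y) *v v = x *v (y *v v)"
  by (simp add: mult_eq matrix_vector_mul_assoc)

lemma one_vector: "\<one> *v v = v"
  by (simp add: one_eq)

lemma inv_vector:
  "x \<in> carrier G \<Longrightarrow> inv x *v (x *v v) = v" "x \<in> carrier G \<Longrightarrow> x *v (inv x *v v) = v"
  by (simp_all flip: mult_vector add: one_vector)

lemma inv_vector_iff: "x \<in> carrier G \<Longrightarrow> inv x *v v = w \<longleftrightarrow> v = x *v w"
  using inv_vector by metis

definition first :: "'a ^ 'n ^ 'n \<Rightarrow> 'a ^ 'n" where "first x = x *v axis p 1"

lemma first_nth: "first x $ i = x $ i $ p"
  by (simp add: first_def matrix_vector_axis)

definition mate :: "'n \<Rightarrow> 'n" where "mate i = (SOME j. j \<noteq> p \<and> j \<noteq> i)"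

lemma mate: "mate i \<noteq> p" "mate i \<noteq> i"
proof -
  have "\<exists>j. j \<noteq> p \<and> j \<noteq> i"
  proof (rule ccontr)
    assume "\<not> ?thesis"
    then have "(UNIV :: 'n set) \<subseteq> {p, i}" by auto
    then have "CARD('n) \<le> card {p, i}" by (intro card_mono) auto
    also have "\<dots> \<le> 2" by (simp add: card_insert_if)
    finally show False using card by simp
  qed
  then show "mate i \<noteq> p" "mate i \<noteq> i" unfolding mate_def by (metis (mono_tags, lifting) someI_ex)+
qed

text \<open>The group elements whose \<open>p\<close>-th column has its largest entry in row \<open>i\<close>, the entry in row \<open>p\<close> being
  disregarded.\<close>

definition sector :: "'n \<Rightarrow> ('a ^ 'n ^ 'n) set" where
  "sector i = {x \<in> carrier G. first x $ i \<noteq> 0 \<and> (\<forall>j. j \<noteq> p \<longrightarrow> below (first x $ j) (first x $ i))}"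

text \<open>Adding a multiple of a coordinate \<open>i\<close> different from \<open>p\<close> to another one fixes the distinguished line.
  The other coordinate is to be different from \<open>p\<close> as well, because sectors do not restrict the entry in
  row \<open>p\<close>. This is where the dimension has to be at least 3.\<close>

definition push :: "'n \<Rightarrow> nat \<Rightarrow> 'a ^ 'n ^ 'n" where "push i k = transvection (mate i) i (a k)"

lemma push_in: "push i k \<in> carrier G"
  unfolding push_def using transvection_in mate by blast

lemma sector_cover:
  assumes x: "x \<in> carrier G" and j: "j \<noteq> p" "first x $ j \<noteq> 0"
  shows "\<exists>i\<in>- {p}. x \<in> sector i"
proof -
  have "\<exists>i\<in>- {p}. \<forall>j\<in>- {p}. below (first x $ j) (first x $ i)"
    by (rule finite_total_max[OF _ _ below_total below_trans]) (use j in auto)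
  then obtain i where i: "i \<noteq> p" "\<And>j. j \<noteq> p \<Longrightarrow> below (first x $ j) (first x $ i)" by auto
  then have "first x $ i \<noteq> 0" using below_0 j by metis
  then show ?thesis using i x by (auto simp: sector_def)
qed

text \<open>A common element of two translates of the sector would have two entries of row \<open>mate i\<close> in it that are
  both below the entry of row \<open>i\<close> and differ by \<open>(a k - a l)\<close> times that entry.\<close>

lemma push_disjoint:
  assumes "i \<noteq> p" "x \<in> sector i" "y \<in> sector i" "push i k \<otimes> x = push i l \<otimes> y"
  shows "k = l"
proof -
  have "push i k *v first x = push i l *v first y"
    using assms(4) unfolding first_def by (metis mult_vector)
  then have eq: "(push i k *v first x) $ j = (push i l *v first y) $ j" for j by simp
  from eq[of i] mate[of i] have i: "first x $ i = first y $ i"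
    by (simp add: push_def transvection_vector)
  from eq[of "mate i"] have "first x $ mate i + a k * first x $ i = first y $ mate i + a l * first x $ i"
    by (simp add: push_def transvection_vector i)
  then show ?thesis
    by (rule spread[rotated 3]) (use assms mate[of i] i in \<open>auto simp: sector_def\<close>)
qed

lemma sector_scaled:
  assumes "x \<in> sector i" "y \<in> carrier G" "first y = c *s first x" "c * first x $ i \<noteq> 0"
  shows "y \<in> sector i"
  using assms by (auto simp: sector_def below_mult)

lemma a_inj: "a k = a l \<Longrightarrow> k = l"
proof -
  assume "a k = a l"
  moreover have "below 0 1" using below_total[of 0 1] below_0[of 1] by auto
  ultimately show "k = l" using spread[of 0 1 0 k l] by simp
qed

text \<open>Transvections into the distinguished line move every other line to infinitely many different ones; this
  is why the stabilizer of the line has no other finite orbit.\<close>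

lemma shear_separates:
  fixes v :: "'a ^ 'n"
  assumes j: "j \<noteq> p" "v $ j \<noteq> 0"
    and eq: "transvection p j (a k) *v v = c *s (transvection p j (a l) *v v)"
    and unit: "c * v $ j = v $ j \<Longrightarrow> c = 1" and reg: "a k * v $ j = a l * v $ j \<Longrightarrow> a k = a l"
  shows "k = l"
proof -
  have nth: "(transvection p j (a k) *v v) $ i = c * (transvection p j (a l) *v v) $ i" for i
    using arg_cong[OF eq, of "\<lambda>v. v $ i"] by simp
  have "c = 1" using nth[of j] j by (intro unit) (simp add: transvection_vector)
  then show ?thesis using nth[of p] reg a_inj by (simp add: transvection_vector)
qed

end

lemma countable_vec:
  assumes "countable (UNIV :: 'a set)"
  shows "countable (UNIV :: ('a ^ 'n) set)"
proof -
  have "countable (PiE (UNIV :: 'n set) (\<lambda>_. UNIV :: 'a set))"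
    by (rule countable_PiE) (use assms in auto)
  then have "countable (range (vec_nth :: 'a ^ 'n \<Rightarrow> 'n \<Rightarrow> 'a))"
    by (rule countable_subset[rotated]) auto
  then show ?thesis by (rule countable_image_inj_on) (auto simp: inj_on_def vec_nth_inject)
qed

section \<open>General linear groups over a field\<close>

lemma group_GL: "group (GL :: ('k::field ^ 'n ^ 'n) monoid)"
proof (rule groupI)
  show "\<one>\<^bsub>GL\<^esub> \<in> carrier (GL :: ('k ^ 'n ^ 'n) monoid)"
    by (auto simp: GL_def invertible_def intro!: exI[of _ "mat 1"])
next
  fix x :: "'k ^ 'n ^ 'n"
  assume "x \<in> carrier GL"
  then obtain y where "x ** y = mat 1" "y ** x = mat 1" by (auto simp: GL_def invertible_def)
  then show "\<exists>y\<in>carrier GL. y \<otimes>\<^bsub>GL\<^esub> x = \<one>\<^bsub>GL\<^esub>"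
    by (auto simp: GL_def invertible_def intro!: bexI[of _ y])
qed (auto simp: GL_def invertible_mult matrix_mul_assoc)

lemma GL_simps:
  "g \<in> carrier GL \<longleftrightarrow> invertible g" "x \<otimes>\<^bsub>GL\<^esub> y = x ** y" "\<one>\<^bsub>GL\<^esub> = mat 1"
  by (simp_all add: GL_def)

text \<open>Divisibility with respect to a valuation ring \<open>V\<close>, which is a total preorder.\<close>

definition multiple_in :: "'k::field set \<Rightarrow> 'k \<Rightarrow> 'k \<Rightarrow> bool" where
  "multiple_in V x y \<longleftrightarrow> (\<exists>c\<in>V. x = c * y)"

text \<open>Otherwise multiplying by \<open>t ^ (l - 1)\<close> would give an element of \<open>V\<close> that differs from \<open>inverse t\<close> by an
  element of \<open>V\<close>.\<close>

lemma powers_spread: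
  assumes V: "is_subring V" "t \<in> V" "inverse t \<notin> V" and kl: "k < l"
  shows "inverse t ^ l - inverse t ^ k \<notin> V"
proof
  assume mem: "inverse t ^ l - inverse t ^ k \<in> V"
  have t0: "t \<noteq> 0" using V is_subring_0[OF V(1)] by auto
  obtain d where d: "l = Suc (k + d)" using less_imp_Suc_add[OF kl] by blast
  have one: "t ^ n * inverse t ^ n = 1" for n using t0 by (simp flip: power_mult_distrib)
  have "t ^ (k + d) * inverse t ^ l = inverse t"
    using one[of "k + d"] by (simp add: d mult.left_commute)
  moreover have "t ^ (k + d) * inverse t ^ k = t ^ d"
    using one[of k] by (simp add: power_add mult.assoc mult.left_commute)
  ultimately have "t ^ (k + d) * (inverse t ^ l - inverse t ^ k) + t ^ d = inverse t"
    by (simp add: right_diff_distrib)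
  moreover have "t ^ (k + d) * (inverse t ^ l - inverse t ^ k) + t ^ d \<in> V"
    using V mem by (intro is_subring_add is_subring_mult is_subring_power)
  ultimately show False using V by simp
qed

lemma invertible_transvection: "i \<noteq> j \<Longrightarrow> transvection i j (b :: 'k::field) \<in> carrier GL"
  by (simp add: GL_simps invertible_det_nz det_transvection)

lemma linear_group_GL:
  fixes V :: "'k::field set"
  assumes V: "valuation_ring V" "t \<in> V" "inverse t \<notin> V" and card: "CARD('n) \<ge> 3"
  shows "linear_group (GL :: ('k ^ 'n ^ 'n) monoid) (multiple_in V) (\<lambda>k. inverse t ^ k)"
proof -
  interpret group "GL :: ('k ^ 'n ^ 'n) monoid" by (rule group_GL)
  have R: "is_subring V" using V by (simp add: valuation_ring_def)
  show ?thesis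
  proof unfold_locales
    fix x y z c b :: 'k and k l :: nat
    show "multiple_in V x y \<or> multiple_in V y x"
    proof (cases "x = 0 \<or> y = 0")
      case True
      then show ?thesis using is_subring_0[OF R] by (force simp: multiple_in_def)
    next
      case False
      have "x / y \<in> V \<or> y / x \<in> V"
        using V(1) unfolding valuation_ring_def by (metis inverse_divide)
      then show ?thesis using False unfolding multiple_in_def by (metis nonzero_eq_divide_eq)
    qed
    show "multiple_in V x z" if "multiple_in V x y" "multiple_in V y z"
    proof -
      obtain c d where cd: "c \<in> V" "x = c * y" "d \<in> V" "y = d * z" using \<open>multiple_in V x y\<close> \<open>multiple_in V y z\<close> by (auto simp: multiple_in_def)
      then have "x = (c * d) * z" by simp
      then show ?thesis using is_subring_mult[OF R cd(1,3)] unfolding multiple_in_def by blast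
    qed
    show "x = 0" if "multiple_in V x 0" using that by (auto simp: multiple_in_def)
    show "multiple_in V (c * x) (c * y)" if "multiple_in V x y"
      using that by (auto simp: multiple_in_def)
    show "k = l" if xb: "multiple_in V x b" and yb: "multiple_in V y b" and b: "b \<noteq> 0"
      and eq: "x + inverse t ^ k * b = y + inverse t ^ l * b"
    proof -
      obtain c d where cd: "c \<in> V" "x = c * b" "d \<in> V" "y = d * b" using xb yb by (auto simp: multiple_in_def)
      have "(c + inverse t ^ k) * b = (d + inverse t ^ l) * b" using eq cd by (simp add: distrib_right)
      then have "c + inverse t ^ k = d + inverse t ^ l" using b by simp
      then have "inverse t ^ l - inverse t ^ k = c - d" "inverse t ^ k - inverse t ^ l = d - c"
        by (simp_all add: algebra_simps)
      then have "inverse t ^ l - inverse t ^ k \<in> V" "inverse t ^ k - inverse t ^ l \<in> V"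
        using is_subring_diff[OF R] cd by simp_all
      then show ?thesis using powers_spread[OF R V(2,3)] by (metis nat_neq_iff)
    qed
  qed (use card in \<open>auto simp: invertible_transvection\<close>, simp_all add: GL_simps)
qed

definition line_stabilizer :: "'n \<Rightarrow> ('k::field ^ 'n ^ 'n) set" where
  "line_stabilizer p = {g \<in> carrier GL. \<exists>c. g *v axis p 1 = c *s axis p 1}"

text \<open>Here \<open>g $ p $ p\<close> is the eigenvalue of \<open>g\<close> on the line. The power of it makes the value at scalar matrices
  equal to \<open>\<psi> 1\<close>.\<close>

definition line_character :: "('k::field \<Rightarrow> complex) \<Rightarrow> 'n \<Rightarrow> 'k ^ 'n ^ 'n \<Rightarrow> complex" where
  "line_character \<psi> p g = \<psi> (det g / (g $ p $ p) ^ CARD('n))"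

lemma line_stabilizerI:
  "g \<in> carrier GL \<Longrightarrow> g *v axis p 1 = c *s axis p 1 \<Longrightarrow> g \<in> line_stabilizer p"
  unfolding line_stabilizer_def by blast

lemma line_stabilizer_eigenvalue:
  fixes g :: "'k::field ^ 'n ^ 'n"
  assumes "g \<in> line_stabilizer p"
  shows "g *v axis p 1 = g $ p $ p *s axis p 1" "g $ p $ p \<noteq> 0" "det g \<noteq> 0" "g \<in> carrier GL"
proof -
  obtain c where c: "g *v axis p 1 = c *s axis p 1" and g: "g \<in> carrier GL"
    using assms by (auto simp: line_stabilizer_def)
  have "(g *v axis p 1) $ p = (c *s axis p 1) $ p" using c by simp
  then have "g $ p $ p = c" by (simp add: matrix_vector_axis)
  then show eig: "g *v axis p 1 = g $ p $ p *s axis p 1" using c by simp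
  show "g \<in> carrier GL" by fact
  then show "det g \<noteq> 0" by (simp add: GL_simps invertible_det_nz)
  obtain h where "h ** g = mat 1" using g by (auto simp: GL_simps invertible_def)
  then have "h *v (g *v axis p 1) = axis p 1" by (simp add: matrix_vector_mul_assoc)
  moreover have "(axis p 1 :: 'k ^ 'n) $ p = 1" by simp
  ultimately show "g $ p $ p \<noteq> 0" using eig by (metis matrix_vector_mult_0_right vector_smult_lzero zero_index zero_neq_one)
qed

lemma line_stabilizer_mult:
  assumes "g \<in> line_stabilizer p" "h \<in> line_stabilizer p"
  shows "(g ** h) *v axis p 1 = (g $ p $ p * h $ p $ p) *s axis p 1" "(g ** h) $ p $ p = g $ p $ p * h $ p $ p"
proof -
  show eq: "(g ** h) *v axis p 1 = (g $ p $ p * h $ p $ p) *s axis p 1"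
    using line_stabilizer_eigenvalue(1)[OF assms(1)] line_stabilizer_eigenvalue(1)[OF assms(2)]
    by (simp add: matrix_vector_mul_assoc[symmetric] matrix_vector_scale vector_smult_assoc mult.commute)
  have "((g ** h) *v axis p 1) $ p = g $ p $ p * h $ p $ p" unfolding eq by simp
  then show "(g ** h) $ p $ p = g $ p $ p * h $ p $ p" by (simp add: matrix_vector_axis)
qed

lemma subgroup_line_stabilizer: "subgroup (line_stabilizer p) (GL :: ('k::field ^ 'n ^ 'n) monoid)"
proof -
  interpret group "GL :: ('k ^ 'n ^ 'n) monoid" by (rule group_GL)
  show ?thesis
  proof (rule subgroupI)
    show "(line_stabilizer p :: ('k ^ 'n ^ 'n) set) \<subseteq> carrier GL" by (auto simp: line_stabilizer_def)
    have "(mat 1 :: 'k ^ 'n ^ 'n) \<in> carrier GL" using one_closed by (simp add: GL_simps)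
    moreover have "(mat 1 :: 'k ^ 'n ^ 'n) *v axis p 1 = 1 *s axis p 1" by simp
    ultimately have "(mat 1 :: 'k ^ 'n ^ 'n) \<in> line_stabilizer p" unfolding line_stabilizer_def by blast
    then show "(line_stabilizer p :: ('k ^ 'n ^ 'n) set) \<noteq> {}" by auto
    fix g h :: "'k ^ 'n ^ 'n" assume g: "g \<in> line_stabilizer p"
    note e = line_stabilizer_eigenvalue[OF g]
    have "inv\<^bsub>GL\<^esub> g ** g = mat 1" using l_inv[OF e(4)] by (simp add: GL_simps)
    then have "axis p 1 = inv\<^bsub>GL\<^esub> g *v (g *v axis p 1)" by (simp add: matrix_vector_mul_assoc)
    also have "\<dots> = g $ p $ p *s (inv\<^bsub>GL\<^esub> g *v axis p 1)" unfolding e(1) by (rule matrix_vector_scale)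
    finally have "inv\<^bsub>GL\<^esub> g *v axis p 1 = (1 / g $ p $ p) *s axis p 1"
      using e(2) by (metis nonzero_divide_eq_eq vector_smult_assoc vector_smult_lid)
    then show "inv\<^bsub>GL\<^esub> g \<in> line_stabilizer p" using e(4) by (auto simp: line_stabilizer_def)
    assume h: "h \<in> line_stabilizer p"
    show "g \<otimes>\<^bsub>GL\<^esub> h \<in> line_stabilizer p"
      using m_closed[OF e(4) line_stabilizer_eigenvalue(4)[OF h]] line_stabilizer_mult(1)[OF g h]
      by (auto simp: line_stabilizer_def GL_simps)
  qed
qed

lemma line_character_props:
  fixes g h :: "'k::field ^ 'n ^ 'n"
  assumes \<psi>: "unit_character \<psi>" and g: "g \<in> line_stabilizer p"
  shows "h \<in> line_stabilizer p \<Longrightarrow>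
      line_character \<psi> p (g \<otimes>\<^bsub>GL\<^esub> h) = line_character \<psi> p g * line_character \<psi> p h"
    and "cmod (line_character \<psi> p g) = 1"
proof -
  note e = line_stabilizer_eigenvalue[OF g]
  show "cmod (line_character \<psi> p g) = 1"
    using \<psi> e by (simp add: line_character_def unit_character_def)
  assume h: "h \<in> line_stabilizer p"
  note e' = line_stabilizer_eigenvalue[OF h]
  have mult: "\<psi> (x * y) = \<psi> x * \<psi> y" if "x \<noteq> 0" "y \<noteq> 0" for x y
    using \<psi> that by (simp add: unit_character_def)
  have "\<psi> (det g / (g $ p $ p) ^ CARD('n) * (det h / (h $ p $ p) ^ CARD('n)))
      = line_character \<psi> p g * line_character \<psi> p h"
    unfolding line_character_def by (rule mult) (use e e' in auto)
  then show "line_character \<psi> p (g \<otimes>\<^bsub>GL\<^esub> h) = line_character \<psi> p g * line_character \<psi> p h"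
    by (simp add: line_character_def GL_simps line_stabilizer_mult(2)[OF g h] det_mul power_mult_distrib)
qed

lemma unit_character_1: "unit_character \<psi> \<Longrightarrow> \<psi> 1 = 1"
  unfolding unit_character_def by (metis mult.right_neutral mult_cancel_left norm_zero one_neq_zero)

text \<open>Commuting with the transvection of row \<open>i\<close> and column \<open>j\<close> forces column \<open>i\<close> to be the multiple
  of the basis vector by the \<open>j\<close>-th diagonal entry.\<close>

lemma center_GL_scalar:
  fixes z :: "'k::field ^ 'n ^ 'n"
  assumes z: "z \<in> center GL" and card: "CARD('n) \<ge> 3"
  shows "z = mat (z $ p $ p)"
proof -
  have com: "z *v (transvection i j 1 *v v) = transvection i j 1 *v (z *v v)" if "i \<noteq> j" for i j v
  proof -
    have "z ** transvection i j 1 = transvection i j 1 ** z"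
      using z invertible_transvection[OF that, of 1] by (auto simp: center_def GL_simps)
    then show ?thesis by (metis matrix_vector_mul_assoc)
  qed
  have col: "z *v axis i 1 = z $ j $ j *s axis i 1" if "i \<noteq> j" for i j
  proof -
    have "z *v axis j 1 + z *v axis i 1 = z *v axis j 1 + z $ j $ j *s axis i 1"
      using com[OF that, of "axis j 1"]
      by (simp add: transvection_vector_eq matrix_vector_right_distrib matrix_vector_axis)
    then show ?thesis by simp
  qed
  have diag: "z $ i $ i = z $ j $ j" if "i \<noteq> j" for i j
    using arg_cong[OF col[OF that], of "\<lambda>v. v $ i"] by (simp add: matrix_vector_axis)
  have "z $ k $ i = mat (z $ p $ p) $ k $ i" for k i
  proof -
    have "\<exists>j. i \<noteq> j"
    proof (rule ccontr)
      assume "\<not> ?thesis"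
      then have "(UNIV :: 'n set) \<subseteq> {i}" by auto
      then have "CARD('n) \<le> card {i}" by (intro card_mono) auto
      then show False using card by simp
    qed
    then obtain j where j: "i \<noteq> j" by metis
    have "z $ k $ i = (z *v axis i 1) $ k" by (simp add: matrix_vector_axis)
    also have "\<dots> = (if k = i then z $ j $ j else 0)" unfolding col[OF j] by (simp add: axis_def)
    finally show ?thesis using diag[of j p] by (cases "j = p") (auto simp: mat_def)
  qed
  then show ?thesis unfolding vec_eq_iff by blast
qed

text \<open>The line stabilizer plays the role of both \<open>L\<close> and \<open>H\<close>, so that a single coset has to be cut out and
  nothing remains to be separated.\<close>

theorem GL_line_representation:
  fixes \<psi> :: "'k::field \<Rightarrow> complex" and p :: "'n::finite" and V :: "'k set"
  assumes V: "valuation_ring V" "t \<in> V" "inverse t \<notin> V" and card: "CARD('n) \<ge> 3"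
    and \<psi>: "unit_character \<psi>"
    and e: "\<And>k. e k \<in> carrier GL"
      "\<And>x. x \<in> carrier GL \<Longrightarrow> \<exists>!k :: nat. inv\<^bsub>GL\<^esub> e k \<otimes>\<^bsub>GL\<^esub> x \<in> line_stabilizer p"
  shows "monomial (GL :: ('k ^ 'n ^ 'n) monoid) (line_stabilizer p) (line_character \<psi> p) e" (is ?monomial)
    and "traceable GL (monomial.rep (GL :: ('k ^ 'n ^ 'n) monoid) (line_stabilizer p) (line_character \<psi> p) e)"
    and "trivial_central_character GL
      (monomial.rep (GL :: ('k ^ 'n ^ 'n) monoid) (line_stabilizer p) (line_character \<psi> p) e)"
proof -
  let ?G = "GL :: ('k ^ 'n ^ 'n) monoid" and ?L = "line_stabilizer p :: ('k ^ 'n ^ 'n) set"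
  show monomial: ?monomial
    using group_GL subgroup_line_stabilizer line_character_props[OF \<psi>] e
    by (intro monomial.intro monomial_axioms.intro) auto
  interpret LG: linear_group ?G p "multiple_in V" "\<lambda>k. inverse t ^ k"
    by (rule linear_group_GL[OF V card])
  interpret M: monomial ?G ?L "line_character \<psi> p" e by (rule monomial)
  have L_iff: "x \<in> ?L \<longleftrightarrow> x \<in> carrier ?G \<and> (\<forall>j. j \<noteq> p \<longrightarrow> LG.first x $ j = 0)" for x
  proof
    assume "x \<in> ?L"
    then show "x \<in> carrier ?G \<and> (\<forall>j. j \<noteq> p \<longrightarrow> LG.first x $ j = 0)"
      using line_stabilizer_eigenvalue[of x p] by (auto simp: LG.first_def axis_def)
  next
    assume x: "x \<in> carrier ?G \<and> (\<forall>j. j \<noteq> p \<longrightarrow> LG.first x $ j = 0)"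
    then have "LG.first x = LG.first x $ p *s axis p 1" by (auto simp: vec_eq_iff axis_def)
    then show "x \<in> ?L" using x unfolding line_stabilizer_def LG.first_def by blast
  qed
  have right: "x \<otimes>\<^bsub>?G\<^esub> l \<in> carrier ?G" "LG.first (x \<otimes>\<^bsub>?G\<^esub> l) = l $ p $ p *s LG.first x"
    if "x \<in> carrier ?G" "l \<in> ?L" for x l
    using that line_stabilizer_eigenvalue[OF that(2)]
    by (auto simp: LG.first_def LG.mult_vector matrix_vector_scale)
  have saturated_sector: "M.saturated (LG.sector i)" for i
    unfolding M.saturated_def
  proof (intro conjI ballI)
    show "LG.sector i \<subseteq> carrier ?G" by (auto simp: LG.sector_def)
    fix x l assume x: "x \<in> LG.sector i" and l: "l \<in> ?L"
    then have xc: "x \<in> carrier ?G" "LG.first x $ i \<noteq> 0" by (auto simp: LG.sector_def)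
    show "x \<otimes>\<^bsub>?G\<^esub> l \<in> LG.sector i"
      by (rule LG.sector_scaled[OF x right[OF xc(1) l]])
         (use xc line_stabilizer_eigenvalue(2)[OF l] in auto)
  qed
  have push_trivial: "inv\<^bsub>?G\<^esub> h \<otimes>\<^bsub>?G\<^esub> LG.push i k \<otimes>\<^bsub>?G\<^esub> h \<in> ?L"
      "line_character \<psi> p (inv\<^bsub>?G\<^esub> h \<otimes>\<^bsub>?G\<^esub> LG.push i k \<otimes>\<^bsub>?G\<^esub> h) = 1"
    if i: "i \<noteq> p" and h: "h \<in> ?L" for i k h
  proof -
    let ?x = "inv\<^bsub>?G\<^esub> h \<otimes>\<^bsub>?G\<^esub> LG.push i k \<otimes>\<^bsub>?G\<^esub> h"
    note eh = line_stabilizer_eigenvalue[OF h]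
    have "LG.push i k *v axis p 1 = axis p 1"
      using i by (simp add: LG.push_def transvection_vector_eq axis_def)
    then have "LG.push i k *v (h *v axis p 1) = h *v axis p 1"
      by (simp add: eh(1) matrix_vector_scale)
    then have fixed: "?x *v axis p 1 = axis p 1"
      using LG.inv_vector(1)[OF eh(4)] by (simp add: LG.mult_vector)
    have xc: "?x \<in> carrier ?G" using eh(4) LG.push_in by (intro LG.m_closed LG.inv_closed)
    show "?x \<in> ?L" by (rule line_stabilizerI[OF xc, where c = 1]) (unfold fixed, simp)
    have "(?x *v axis p 1) $ p = 1" unfolding fixed by simp
    then have "?x $ p $ p = 1" by (simp add: matrix_vector_axis)
    moreover have "det ?x = 1"
    proof -
      have "inv\<^bsub>?G\<^esub> h ** h = mat 1" using LG.l_inv[OF eh(4)] by (simp add: GL_simps)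
      then have "det (inv\<^bsub>?G\<^esub> h) * det h = 1" by (metis det_mul det_I)
      then show ?thesis
        by (simp add: LG.mult_eq det_mul LG.push_def det_transvection[OF LG.mate(2)])
    qed
    ultimately show "line_character \<psi> p ?x = 1"
      by (simp add: line_character_def unit_character_1[OF \<psi>])
  qed
  have sep: "monomial_separated ?G ?L (line_character \<psi> p) e ?L (- {p}) LG.sector LG.push {\<one>\<^bsub>?G\<^esub>}"
  proof unfold_locales
    show "M.saturated ?L" using M.subset M.m_closed by (auto simp: M.saturated_def)
    show "\<exists>i\<in>- {p}. x \<in> LG.sector i" if "x \<in> carrier ?G" "x \<notin> ?L" for x
      using that L_iff[of x] LG.sector_cover by blast
    show "\<exists>s\<in>{\<one>\<^bsub>?G\<^esub>}. inv\<^bsub>?G\<^esub> s \<otimes>\<^bsub>?G\<^esub> h \<in> ?L" if "h \<in> ?L" for h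
      using that by simp
  qed (use saturated_sector LG.push_in push_trivial LG.push_disjoint in auto)
  show "traceable GL M.rep" by (rule monomial_separated.traceable[OF sep])
  show "trivial_central_character GL M.rep"
    unfolding trivial_central_character_def
  proof
    fix z assume z: "z \<in> center ?G"
    then have zc: "z \<in> carrier ?G" by (simp add: center_def)
    have entry: "z $ i $ j = mat (z $ p $ p) $ i $ j" for i j
      using center_GL_scalar[OF z card, of p] by metis
    have off: "z $ i $ j = 0" if "i \<noteq> j" for i j using entry[of i j] that by (simp add: mat_def)
    have diag: "z $ i $ i = z $ p $ p" for i using entry[of i i] by (simp add: mat_def)
    have "z *v axis p 1 = z $ p $ p *s axis p 1"
      unfolding vec_eq_iff matrix_vector_axis using off by (auto simp: axis_def)
    then have zL: "z \<in> ?L" by (rule line_stabilizerI[OF zc])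
    have "det z = (\<Prod>i\<in>UNIV. z $ i $ i)"
      by (rule det_diagonal) (rule off)
    also have "\<dots> = (\<Prod>i\<in>(UNIV :: 'n set). z $ p $ p)"
      by (rule prod.cong[OF refl diag])
    also have "\<dots> = (z $ p $ p) ^ CARD('n)" by simp
    finally have "line_character \<psi> p z = 1"
      using line_stabilizer_eigenvalue(2)[OF zL] unit_character_1[OF \<psi>] by (simp add: line_character_def)
    then show "M.rep z = id_blinfun"
      using z by (intro M.rep_central zL) (auto simp: center_def)
  qed
qed

text \<open>Every line except the fixed one has an infinite orbit under the stabilizer, so the element \<open>g\<close> of
  \<open>equivalent_monomial\<close> lies in the stabilizer itself and the two characters coincide there. They are
  evaluated at a diagonal matrix with a single entry \<open>d\<close> different from 1.\<close>

lemma GL_line_inequivalent: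
  fixes \<psi> \<psi>' :: "'k::field \<Rightarrow> complex" and p :: "'n::finite" and V :: "'k set"
  assumes V: "valuation_ring V" "t \<in> V" "inverse t \<notin> V" and card: "CARD('n) \<ge> 3"
    and \<psi>: "unit_character \<psi>" "unit_character \<psi>'"
    and e: "\<And>k. e k \<in> carrier GL"
      "\<And>x. x \<in> carrier GL \<Longrightarrow> \<exists>!k :: nat. inv\<^bsub>GL\<^esub> e k \<otimes>\<^bsub>GL\<^esub> x \<in> line_stabilizer p"
    and eq: "equivalent_reps (GL :: ('k ^ 'n ^ 'n) monoid)
      (monomial.rep GL (line_stabilizer p) (line_character \<psi> p) e)
      (monomial.rep GL (line_stabilizer p) (line_character \<psi>' p) e)"
    and d: "d \<noteq> 0"
  shows "\<psi> d = \<psi>' d"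
proof -
  let ?G = "GL :: ('k ^ 'n ^ 'n) monoid" and ?L = "line_stabilizer p :: ('k ^ 'n ^ 'n) set"
  note monomial = GL_line_representation(1)[OF V card _ e]
  interpret LG: linear_group ?G p "multiple_in V" "\<lambda>k. inverse t ^ k"
    by (rule linear_group_GL[OF V card])
  interpret M': monomial ?G ?L "line_character \<psi>' p" e by (rule monomial[OF \<psi>(2)])
  obtain g where g: "g \<in> carrier ?G"
    and orbit: "\<And>s :: nat \<Rightarrow> _. range s \<subseteq> ?L \<Longrightarrow>
      \<exists>i j. i \<noteq> j \<and> inv\<^bsub>?G\<^esub> (s i \<otimes>\<^bsub>?G\<^esub> g) \<otimes>\<^bsub>?G\<^esub> (s j \<otimes>\<^bsub>?G\<^esub> g) \<in> ?L"
    and conj: "\<And>l. l \<in> ?L \<Longrightarrow> inv\<^bsub>?G\<^esub> g \<otimes>\<^bsub>?G\<^esub> l \<otimes>\<^bsub>?G\<^esub> g \<in> ?L \<Longrightarrow>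
      line_character \<psi>' p (inv\<^bsub>?G\<^esub> g \<otimes>\<^bsub>?G\<^esub> l \<otimes>\<^bsub>?G\<^esub> g) = line_character \<psi> p l"
    using equivalent_monomial[OF monomial[OF \<psi>(1)] monomial[OF \<psi>(2)] eq] by blast
  have "g \<in> ?L"
  proof (rule ccontr)
    assume "g \<notin> ?L"
    then obtain j where j: "j \<noteq> p" "LG.first g $ j \<noteq> 0"
    proof -
      have "LG.first g = LG.first g $ p *s axis p 1" if "\<forall>j. j \<noteq> p \<longrightarrow> LG.first g $ j = 0"
        using that by (auto simp: vec_eq_iff axis_def)
      then show ?thesis using that \<open>g \<notin> ?L\<close> g unfolding line_stabilizer_def LG.first_def by blast
    qed
    define s where "s k = (transvection p j (inverse t ^ k) :: 'k ^ 'n ^ 'n)" for k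
    have sG: "s k \<in> carrier ?G" for k unfolding s_def using j(1) by (intro invertible_transvection) auto
    have "s k *v axis p 1 = 1 *s axis p 1" for k
      using j(1) by (simp add: s_def transvection_vector_eq axis_def)
    then have "range s \<subseteq> ?L" using line_stabilizerI[OF sG] by blast
    then obtain k l where kl: "k \<noteq> l" "inv\<^bsub>?G\<^esub> (s k \<otimes>\<^bsub>?G\<^esub> g) \<otimes>\<^bsub>?G\<^esub> (s l \<otimes>\<^bsub>?G\<^esub> g) \<in> ?L"
      using orbit by blast
    obtain c where "(inv\<^bsub>?G\<^esub> (s k \<otimes>\<^bsub>?G\<^esub> g) \<otimes>\<^bsub>?G\<^esub> (s l \<otimes>\<^bsub>?G\<^esub> g)) *v axis p 1 = c *s axis p 1"
      using line_stabilizer_eigenvalue(1)[OF kl(2)] by blast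
    then have "(s l \<otimes>\<^bsub>?G\<^esub> g) *v axis p 1 = (s k \<otimes>\<^bsub>?G\<^esub> g) *v (c *s axis p 1)"
      using LG.inv_vector_iff[OF LG.m_closed[OF sG g]] by (simp add: LG.mult_vector)
    then have "s l *v LG.first g = c *s (s k *v LG.first g)"
      by (simp add: LG.mult_vector LG.first_def matrix_vector_scale)
    then have "l = k"
      unfolding s_def by (rule LG.shear_separates[OF j]) (use j in auto)
    then show False using kl by simp
  qed
  obtain r where r: "r \<noteq> p" using LG.mate(1) by blast
  define l :: "'k ^ 'n ^ 'n" where "l = (\<chi> i j. if i = j then (if i = r then d else 1) else 0)"
  have "det l = (\<Prod>i\<in>UNIV. l $ i $ i)" by (rule det_diagonal) (simp add: l_def)
  then have det_l: "det l = d" by (simp add: l_def prod.delta)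
  have lp: "l $ p $ p = 1" using r by (simp add: l_def)
  have "l *v axis p 1 = 1 *s axis p 1"
    unfolding vec_eq_iff matrix_vector_axis using r by (auto simp: l_def axis_def)
  moreover have "l \<in> carrier ?G" using d det_l by (simp add: GL_simps invertible_det_nz)
  ultimately have lL: "l \<in> ?L" by (intro line_stabilizerI)
  have "line_character \<psi>' p (inv\<^bsub>?G\<^esub> g \<otimes>\<^bsub>?G\<^esub> l \<otimes>\<^bsub>?G\<^esub> g)
      = line_character \<psi>' p g * cnj (line_character \<psi>' p g) * line_character \<psi>' p l"
    using \<open>g \<in> ?L\<close> lL by (simp add: M'.\<theta>_mult M'.\<theta>_inv)
  also have "line_character \<psi>' p g * cnj (line_character \<psi>' p g) = 1"
    using M'.\<theta>_norm[OF \<open>g \<in> ?L\<close>] by (simp flip: complex_norm_square)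
  finally have "line_character \<psi>' p l = line_character \<psi> p l"
    using conj[OF lL] \<open>g \<in> ?L\<close> lL by simp
  then show ?thesis by (simp add: line_character_def det_l lp)
qed

lemma GL_line_enumeration:
  fixes p :: "'n::finite" and V :: "'k::field set"
  assumes V: "valuation_ring V" "t \<in> V" "inverse t \<notin> V" and card: "CARD('n) \<ge> 3"
    and count: "countable (UNIV :: 'k set)"
  shows "\<exists>e :: nat \<Rightarrow> 'k ^ 'n ^ 'n. (\<forall>k. e k \<in> carrier GL) \<and>
    (\<forall>x\<in>carrier GL. \<exists>!k. inv\<^bsub>GL\<^esub> e k \<otimes>\<^bsub>GL\<^esub> x \<in> line_stabilizer p)"
proof -
  let ?G = "GL :: ('k ^ 'n ^ 'n) monoid" and ?L = "line_stabilizer p :: ('k ^ 'n ^ 'n) set"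
  interpret LG: linear_group ?G p "multiple_in V" "\<lambda>k. inverse t ^ k"
    using linear_group_GL[OF V card] .
  obtain r where r: "r \<noteq> p" using LG.mate(1) by blast
  define s where "s k = (transvection r p (inverse t ^ k) :: 'k ^ 'n ^ 'n)" for k
  have sG: "s k \<in> carrier ?G" for k unfolding s_def by (rule invertible_transvection[OF r])
  show ?thesis
  proof (rule LG.coset_enumeration[OF subgroup_line_stabilizer _ sG])
    show "countable (carrier ?G)"
      using countable_vec[OF countable_vec[OF count]] by (rule countable_subset[rotated]) simp
    fix k l assume kl: "inv\<^bsub>?G\<^esub> (s k) \<otimes>\<^bsub>?G\<^esub> s l \<in> ?L"
    obtain c where "inv\<^bsub>?G\<^esub> (s k) *v (s l *v axis p 1) = c *s axis p 1"
      using line_stabilizer_eigenvalue(1)[OF kl] unfolding LG.mult_vector by blast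
    then have eq: "(s l *v axis p 1) $ i = (c *s (s k *v axis p 1)) $ i" for i
      using LG.inv_vector_iff[OF sG] by (simp add: matrix_vector_scale)
    have "c = 1" using eq[of p] r by (simp add: s_def transvection_vector axis_def)
    then have "inverse t ^ l = inverse t ^ k"
      using eq[of r] r by (simp add: s_def transvection_vector axis_def)
    then show "k = l" using LG.a_inj by metis
  qed
qed

theorem GL_family:
  fixes p :: "'n::finite"
  assumes card: "CARD('n) \<ge> 3"
    and count: "countable (UNIV :: 'k::field set)" and K: "\<not> algebraic_over_finite_field TYPE('k)"
  shows "\<exists>F :: ('k ^ 'n ^ 'n \<Rightarrow> ell2 \<Rightarrow>\<^sub>L ell2) set. uncountable F \<and>
    pairwise (\<lambda>\<pi> \<rho>. \<not> equivalent_reps GL \<pi> \<rho>) F \<and>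
    (\<forall>\<pi>\<in>F. traceable GL \<pi> \<and> trivial_central_character GL \<pi>)"
proof -
  obtain R and t :: 'k where Rt: "is_subring R" "t \<in> R" "inverse t \<notin> R"
    using non_field_subring_exists[OF K] by blast
  then obtain V where V: "valuation_ring V" "t \<in> V" "inverse t \<notin> V"
    using valuation_ring_exists[OF Rt] by blast
  have Vs: "is_subring V" using V(1) by (simp add: valuation_ring_def)
  have t0: "t \<noteq> 0" using V(3) is_subring_0[OF Vs] by auto
  have inf: "t ^ n \<noteq> 1" if "n > 0" for n
  proof
    assume "t ^ n = 1"
    then have "t * t ^ (n - 1) = 1" using that by (simp flip: power_Suc)
    then have "inverse t = t ^ (n - 1)" by (rule inverse_unique)
    then show False using V(3) is_subring_power[OF Vs V(2)] by simp
  qed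
  obtain e :: "nat \<Rightarrow> 'k ^ 'n ^ 'n" where e_all: "(\<forall>k. e k \<in> carrier GL) \<and>
    (\<forall>x\<in>carrier GL. \<exists>!k. inv\<^bsub>GL\<^esub> e k \<otimes>\<^bsub>GL\<^esub> x \<in> line_stabilizer p)"
    using GL_line_enumeration[OF V card count, of p] by (elim exE)
  have e: "e k \<in> carrier GL"
    "x \<in> carrier GL \<Longrightarrow> \<exists>!k. inv\<^bsub>GL\<^esub> e k \<otimes>\<^bsub>GL\<^esub> x \<in> line_stabilizer p" for k x
    using conjunct1[OF e_all] conjunct2[OF e_all] by simp_all
  have "\<forall>z\<in>{z. cmod z = 1}. \<exists>\<psi>. unit_character \<psi> \<and> \<psi> t = z"
    using unit_character_exists[OF t0 inf] by blast
  then obtain \<Psi> where \<Psi>: "\<And>z. cmod z = 1 \<Longrightarrow> unit_character (\<Psi> z) \<and> \<Psi> z t = z"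
    unfolding bchoice_iff by auto
  \<comment> \<open>The value at \<open>t\<close> tells the characters apart, so the circle parametrizes the family.\<close>
  define \<pi> where "\<pi> z = monomial.rep GL (line_stabilizer p) (line_character (\<Psi> z) p) e" for z
  have ineq: "z = w" if "cmod z = 1" "cmod w = 1" "equivalent_reps GL (\<pi> z) (\<pi> w)" for z w
    using GL_line_inequivalent[OF V card _ _ e _ t0, of "\<Psi> z" "\<Psi> w"] \<Psi>[OF that(1)] \<Psi>[OF that(2)] that(3)
    by (simp add: \<pi>_def)
  have inj: "inj_on \<pi> {z. cmod z = 1}"
  proof (rule inj_onI)
    fix z w assume zw: "z \<in> {z. cmod z = 1}" "w \<in> {z. cmod z = 1}" "\<pi> z = \<pi> w"
    then have "equivalent_reps GL (\<pi> z) (\<pi> w)" by (simp add: equivalent_reps_refl)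
    then show "z = w" using ineq zw(1,2) by simp
  qed
  have "uncountable (\<pi> ` {z. cmod z = 1})"
    using uncountable_unit_circle countable_image_inj_on[OF _ inj] by blast
  moreover have "pairwise (\<lambda>\<pi> \<rho>. \<not> equivalent_reps GL \<pi> \<rho>) (\<pi> ` {z. cmod z = 1})"
    using ineq by (auto simp: pairwise_def)
  moreover have "traceable GL (\<pi> z) \<and> trivial_central_character GL (\<pi> z)" if "cmod z = 1" for z
    using GL_line_representation(2,3)[OF V card _ e, of "\<Psi> z"] \<Psi>[OF that] by (simp add: \<pi>_def)
  ultimately show ?thesis by blast
qed

section \<open>Special linear groups over the integers\<close>

definition adjugate :: "'a::comm_ring_1 ^ 'n ^ 'n \<Rightarrow> 'a ^ 'n ^ 'n" where
  "adjugate A = (\<chi> l k. det (\<chi> i. if i = k then axis l 1 else A $ i))"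

text \<open>By linearity in row \<open>k\<close>, an entry of the product is the determinant of \<open>A\<close> with row \<open>k\<close> replaced by
  row \<open>j\<close>.\<close>

lemma matrix_mult_adjugate: "A ** adjugate A = (mat (det A) :: 'a::comm_ring_1 ^ 'n ^ 'n)"
proof (rule vec_eq_iff[THEN iffD2], rule allI, rule vec_eq_iff[THEN iffD2], rule allI)
  fix j k
  have row: "A $ j = (\<Sum>l\<in>UNIV. A $ j $ l *s axis l 1)"
    by (simp add: vec_eq_iff axis_def if_distrib cong: if_cong)
  have "(A ** adjugate A) $ j $ k = (\<Sum>l\<in>UNIV. A $ j $ l * det (\<chi> i. if i = k then axis l 1 else A $ i))"
    by (simp add: matrix_matrix_mult_def adjugate_def)
  also have "\<dots> = (\<Sum>l\<in>UNIV. det (\<chi> i. if i = k then A $ j $ l *s axis l 1 else A $ i))"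
    by (simp add: det_row_mul)
  also have "\<dots> = det (\<chi> i. if i = k then (\<Sum>l\<in>UNIV. A $ j $ l *s axis l 1) else A $ i)"
    by (rule det_linear_row_sum[symmetric]) simp
  also have "\<dots> = det (\<chi> i. if i = k then A $ j else A $ i)" unfolding row[symmetric] ..
  also have "\<dots> = (if j = k then det A else 0)"
  proof (cases "j = k")
    case True
    then have "(\<chi> i. if i = k then A $ j else A $ i) = A" by (simp add: vec_eq_iff)
    then show ?thesis using True by simp
  next
    case False
    then show ?thesis by (simp add: det_identical_rows[OF False] row_def vec_eq_iff)
  qed
  finally show "(A ** adjugate A) $ j $ k = mat (det A) $ j $ k" by (simp add: mat_def)
qed

lemma group_SL_int: "group (SL_int :: (int ^ 'n ^ 'n) monoid)"
proof (rule groupI)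
  fix A :: "int ^ 'n ^ 'n"
  assume "A \<in> carrier SL_int"
  then have A: "det A = 1" by (simp add: SL_int_def)
  define B where "B = adjugate A"
  have AB: "A ** B = mat 1" using matrix_mult_adjugate[of A] by (simp add: B_def A)
  then have "det (A ** B) = 1" by simp
  then have B: "det B = 1" by (simp add: det_mul A)
  have BC: "B ** adjugate B = mat 1" using matrix_mult_adjugate[of B] by (simp add: B)
  have "A = A ** (B ** adjugate B)" by (simp add: BC)
  also have "\<dots> = adjugate B" by (simp add: matrix_mul_assoc AB)
  finally show "\<exists>B\<in>carrier SL_int. B \<otimes>\<^bsub>SL_int\<^esub> A = \<one>\<^bsub>SL_int\<^esub>"
    using B BC by (auto simp: SL_int_def)
qed (auto simp: SL_int_def det_mul matrix_mul_assoc)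

lemma SL_int_simps:
  "g \<in> carrier SL_int \<longleftrightarrow> det g = 1" "x \<otimes>\<^bsub>SL_int\<^esub> y = x ** y" "\<one>\<^bsub>SL_int\<^esub> = mat 1"
  by (simp_all add: SL_int_def)

lemma root_of_unity_eq_iff:
  fixes m x y :: int
  assumes m: "m > 0"
  shows "cis (2 * pi * of_int x / of_int m) = cis (2 * pi * of_int y / of_int m) \<longleftrightarrow> m dvd x - y"
proof -
  define t where "t = 2 * pi * of_int (x - y) / of_int m"
  have "cis (2 * pi * of_int x / of_int m) = cis t * cis (2 * pi * of_int y / of_int m)"
    by (simp add: t_def cis_mult diff_divide_distrib right_diff_distrib)
  then have "cis (2 * pi * of_int x / of_int m) = cis (2 * pi * of_int y / of_int m) \<longleftrightarrow> cis t = 1"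
    by (metis cis_neq_zero mult_cancel_right2)
  also have "\<dots> \<longleftrightarrow> cos t = 1"
  proof
    assume "cos t = 1"
    then have "sin t = 0" using sin_cos_squared_add[of t] by simp
    then show "cis t = 1" using \<open>cos t = 1\<close> by (simp add: complex_eq_iff)
  qed (auto simp: complex_eq_iff)
  also have "\<dots> \<longleftrightarrow> (\<exists>k::int. t = of_int k * 2 * pi)" by (rule cos_one_2pi_int)
  also have "\<dots> \<longleftrightarrow> (\<exists>k::int. x - y = m * k)"
  proof -
    have "t = of_int k * 2 * pi \<longleftrightarrow> x - y = m * k" for k :: int
    proof -
      have "t = of_int k * 2 * pi \<longleftrightarrow> real_of_int (x - y) = of_int (m * k)"
      proof -
        have "t = (2 * pi) * (of_int (x - y) / of_int m)" by (simp add: t_def)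
        moreover have "of_int k * 2 * pi = (2 * pi) * of_int k" by simp
        ultimately have "t = of_int k * 2 * pi \<longleftrightarrow> real_of_int (x - y) / of_int m = of_int k"
          using pi_gt_zero by (simp only: mult_cancel_left) simp
        then show ?thesis using m by (simp add: divide_eq_eq mult.commute)
      qed
      then show ?thesis by (simp only: of_int_eq_iff)
    qed
    then show ?thesis by simp
  qed
  also have "\<dots> \<longleftrightarrow> m dvd x - y" by (simp add: dvd_def)
  finally show ?thesis .
qed

text \<open>The factor 3 suffices because two integers of absolute value at most \<open>\<bar>b\<bar>\<close> differ by at most \<open>2 * \<bar>b\<bar>\<close>; the
  factor \<open>m\<close> makes the transvections trivial modulo \<open>m\<close>.\<close>

lemma linear_group_SL_int:
  assumes m: "m > 0" and card: "CARD('n) \<ge> 3"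
  shows "linear_group (SL_int :: (int ^ 'n ^ 'n) monoid) (\<lambda>x y. \<bar>x\<bar> \<le> \<bar>y\<bar>) (\<lambda>k. 3 * m * int k)"
proof -
  interpret group "SL_int :: (int ^ 'n ^ 'n) monoid" by (rule group_SL_int)
  show ?thesis
  proof unfold_locales
    fix x y z c b :: int and k l :: nat
    show "\<bar>x\<bar> \<le> \<bar>y\<bar> \<or> \<bar>y\<bar> \<le> \<bar>x\<bar>" by linarith
    show "\<bar>x\<bar> \<le> \<bar>z\<bar>" if "\<bar>x\<bar> \<le> \<bar>y\<bar>" "\<bar>y\<bar> \<le> \<bar>z\<bar>" using that by linarith
    show "x = 0" if "\<bar>x\<bar> \<le> \<bar>0\<bar>" using that by simp
    show "\<bar>c * x\<bar> \<le> \<bar>c * y\<bar>" if "\<bar>x\<bar> \<le> \<bar>y\<bar>" using that by (simp add: abs_mult mult_left_mono)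
    show "k = l" if x: "\<bar>x\<bar> \<le> \<bar>b\<bar>" and y: "\<bar>y\<bar> \<le> \<bar>b\<bar>" and b: "b \<noteq> 0"
      and eq: "x + 3 * m * int k * b = y + 3 * m * int l * b"
    proof (rule ccontr)
      assume "k \<noteq> l"
      then have "m * (int l - int k) \<noteq> 0" using m by simp
      then have "\<bar>m * (int l - int k)\<bar> \<ge> 1" by linarith
      then have "3 * \<bar>b\<bar> \<le> 3 * (\<bar>m * (int l - int k)\<bar> * \<bar>b\<bar>)"
        using mult_right_mono[of 1 "\<bar>m * (int l - int k)\<bar>" "\<bar>b\<bar>"] by simp
      also have "\<dots> = \<bar>3 * (m * (int l - int k) * b)\<bar>" by (simp only: abs_mult abs_numeral)
      also have "3 * (m * (int l - int k) * b) = x - y" using eq by (simp add: algebra_simps)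
      also have "\<bar>x - y\<bar> \<le> 2 * \<bar>b\<bar>" using x y by linarith
      finally show False using b by simp
    qed
  qed (use card in \<open>auto simp: SL_int_simps det_transvection\<close>)
qed

definition axis_stabilizer :: "'n \<Rightarrow> (int ^ 'n ^ 'n) set" where
  "axis_stabilizer p = {g \<in> carrier SL_int. \<exists>\<epsilon>. \<bar>\<epsilon>\<bar> = 1 \<and> g *v axis p 1 = \<epsilon> *s axis p 1}"

text \<open>The entry in row \<open>p\<close> and column \<open>r\<close> modulo \<open>m\<close> defines a character of order \<open>m\<close> of the group generated
  by the transvections into the line of \<open>p\<close>. The elements of the stabilizer of this line that fix the character
  under conjugation form this subgroup, to which the character extends.\<close>

definition frame_stabilizer :: "int \<Rightarrow> 'n \<Rightarrow> 'n \<Rightarrow> (int ^ 'n ^ 'n) set" where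
  "frame_stabilizer m p r = {g \<in> carrier SL_int. \<exists>\<epsilon> k z. \<bar>\<epsilon>\<bar> = 1 \<and> g *v axis p 1 = \<epsilon> *s axis p 1 \<and>
     g *v axis r 1 = \<epsilon> *s axis r 1 + k *s axis p 1 + m *s z}"

text \<open>The exponent is \<open>\<epsilon> * k\<close> modulo \<open>m\<close> for \<open>\<epsilon>\<close> and \<open>k\<close> as in the definition of the stabilizer; the sign makes
  it additive.\<close>

definition frame_character :: "int \<Rightarrow> 'n \<Rightarrow> 'n \<Rightarrow> int ^ 'n ^ 'n \<Rightarrow> complex" where
  "frame_character m p r g = cis (2 * pi * of_int (g $ p $ p * g $ p $ r) / of_int m)"

lemma unit_square: "\<bar>\<epsilon> :: int\<bar> = 1 \<Longrightarrow> \<epsilon> * \<epsilon> = 1"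
  by (metis abs_mult_self_eq mult_1)

lemma axis_stabilizerI:
  "g \<in> carrier SL_int \<Longrightarrow> \<bar>\<epsilon>\<bar> = 1 \<Longrightarrow> g *v axis p 1 = \<epsilon> *s axis p 1 \<Longrightarrow> g \<in> axis_stabilizer p"
  unfolding axis_stabilizer_def by blast

lemma axis_stabilizerD:
  assumes "g \<in> axis_stabilizer p"
  shows "g *v axis p 1 = g $ p $ p *s axis p 1" "\<bar>g $ p $ p\<bar> = 1" "g \<in> carrier SL_int"
proof -
  obtain \<epsilon> where e: "\<bar>\<epsilon>\<bar> = 1" "g *v axis p 1 = \<epsilon> *s axis p 1" "g \<in> carrier SL_int"
    using assms by (auto simp: axis_stabilizer_def)
  have "(g *v axis p 1) $ p = (\<epsilon> *s axis p 1) $ p" using e(2) by simp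
  then have "g $ p $ p = \<epsilon>" by (simp add: matrix_vector_axis)
  then show "g *v axis p 1 = g $ p $ p *s axis p 1" "\<bar>g $ p $ p\<bar> = 1" using e by simp_all
  show "g \<in> carrier SL_int" by fact
qed

lemma frame_stabilizerI:
  "g \<in> carrier SL_int \<Longrightarrow> \<bar>\<epsilon>\<bar> = 1 \<Longrightarrow> g *v axis p 1 = \<epsilon> *s axis p 1 \<Longrightarrow>
    g *v axis r 1 = \<epsilon> *s axis r 1 + k *s axis p 1 + m *s z \<Longrightarrow> g \<in> frame_stabilizer m p r"
  unfolding frame_stabilizer_def by blast

lemma frame_stabilizer_subset: "frame_stabilizer m p r \<subseteq> axis_stabilizer p"
  unfolding frame_stabilizer_def axis_stabilizer_def by blast

context
  fixes m :: int and p r :: "'n::finite"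
  assumes m: "m > 0" and r: "r \<noteq> p"
begin

lemma frame_character_eq:
  assumes "g *v axis p 1 = \<epsilon> *s axis p 1" "g *v axis r 1 = \<epsilon> *s axis r 1 + k *s axis p 1 + m *s z"
  shows "frame_character m p r g = cis (2 * pi * of_int (\<epsilon> * k) / of_int m)"
proof -
  have "g $ p $ p = (\<epsilon> *s axis p 1) $ p" unfolding assms(1)[symmetric] by (simp add: matrix_vector_axis)
  moreover have "g $ p $ r = (\<epsilon> *s axis r 1 + k *s axis p 1 + m *s z) $ p"
    unfolding assms(2)[symmetric] by (simp add: matrix_vector_axis)
  ultimately have "g $ p $ p * g $ p $ r - \<epsilon> * k = m * (\<epsilon> * z $ p)"
    using r by (simp add: axis_def algebra_simps)
  then have "m dvd g $ p $ p * g $ p $ r - \<epsilon> * k" by simp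
  then show ?thesis
    unfolding frame_character_def by (simp only: root_of_unity_eq_iff[OF m])
qed

lemma frame_mult:
  assumes "\<bar>\<epsilon>\<bar> = 1" "g *v axis p 1 = \<epsilon> *s axis p 1" "g *v axis r 1 = \<epsilon> *s axis r 1 + k *s axis p 1 + m *s z"
    and "\<bar>\<delta>\<bar> = 1" "h *v axis p 1 = \<delta> *s axis p 1" "h *v axis r 1 = \<delta> *s axis r 1 + l *s axis p 1 + m *s w"
  shows "(g ** h) *v axis p 1 = (\<epsilon> * \<delta>) *s axis p 1"
    and "(g ** h) *v axis r 1 = (\<epsilon> * \<delta>) *s axis r 1 + (\<delta> * k + \<epsilon> * l) *s axis p 1 + m *s (\<delta> *s z + g *v w)"
proof -
  show "(g ** h) *v axis p 1 = (\<epsilon> * \<delta>) *s axis p 1"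
    by (simp add: matrix_vector_mul_assoc[symmetric] assms(2,5) matrix_vector_scale vector_smult_assoc mult.commute)
  have "(g ** h) *v axis r 1 = \<delta> *s (g *v axis r 1) + l *s (g *v axis p 1) + m *s (g *v w)"
    by (simp add: matrix_vector_mul_assoc[symmetric] assms(6) matrix_vector_right_distrib matrix_vector_scale)
  then show "(g ** h) *v axis r 1 = (\<epsilon> * \<delta>) *s axis r 1 + (\<delta> * k + \<epsilon> * l) *s axis p 1 + m *s (\<delta> *s z + g *v w)"
    by (simp add: assms(2,3) vec_eq_iff algebra_simps)
qed

lemma frame_obtain:
  assumes "g \<in> frame_stabilizer m p r"
  obtains \<epsilon> k z where "\<bar>\<epsilon>\<bar> = 1" "g *v axis p 1 = \<epsilon> *s axis p 1"
    "g *v axis r 1 = \<epsilon> *s axis r 1 + k *s axis p 1 + m *s z" "g \<in> carrier SL_int"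
  using assms unfolding frame_stabilizer_def by blast

lemma frame_character_mult:
  assumes g: "g \<in> frame_stabilizer m p r" and h: "h \<in> frame_stabilizer m p r"
  shows "frame_character m p r (g \<otimes>\<^bsub>SL_int\<^esub> h) = frame_character m p r g * frame_character m p r h"
proof -
  obtain \<epsilon> k z where 1: "\<bar>\<epsilon>\<bar> = 1" "g *v axis p 1 = \<epsilon> *s axis p 1"
    "g *v axis r 1 = \<epsilon> *s axis r 1 + k *s axis p 1 + m *s z" by (rule frame_obtain[OF g])
  obtain \<delta> l w where 2: "\<bar>\<delta>\<bar> = 1" "h *v axis p 1 = \<delta> *s axis p 1"
    "h *v axis r 1 = \<delta> *s axis r 1 + l *s axis p 1 + m *s w" by (rule frame_obtain[OF h])
  have "\<epsilon> * \<delta> * (\<delta> * k + \<epsilon> * l) = \<epsilon> * (\<delta> * \<delta>) * k + (\<epsilon> * \<epsilon>) * \<delta> * l" by (simp add: algebra_simps)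
  also have "\<dots> = \<epsilon> * k + \<delta> * l" by (simp add: unit_square[OF 1(1)] unit_square[OF 2(1)])
  finally show ?thesis
    unfolding SL_int_simps frame_character_eq[OF frame_mult[OF 1 2]] frame_character_eq[OF 1(2,3)]
      frame_character_eq[OF 2(2,3)]
    by (simp add: cis_mult add_divide_distrib distrib_left)
qed

lemma subgroup_frame_stabilizer: "subgroup (frame_stabilizer m p r) SL_int"
proof -
  let ?G = "SL_int :: (int ^ 'n ^ 'n) monoid" and ?L = "frame_stabilizer m p r"
  interpret group ?G by (rule group_SL_int)
  show ?thesis
  proof (rule subgroupI)
    show "?L \<subseteq> carrier ?G" by (auto simp: frame_stabilizer_def)
    have "\<one>\<^bsub>?G\<^esub> \<in> ?L"
      by (rule frame_stabilizerI[OF one_closed, where \<epsilon> = 1 and k = 0 and z = 0]) (simp_all add: SL_int_simps)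
    then show "?L \<noteq> {}" by blast
    fix g h assume g: "g \<in> ?L"
    obtain \<epsilon> k z where e: "\<bar>\<epsilon>\<bar> = 1" "g *v axis p 1 = \<epsilon> *s axis p 1"
      "g *v axis r 1 = \<epsilon> *s axis r 1 + k *s axis p 1 + m *s z" "g \<in> carrier ?G" by (rule frame_obtain[OF g])
    let ?i = "inv\<^bsub>?G\<^esub> g"
    have "?i ** g = mat 1" using l_inv[OF e(4)] by (simp add: SL_int_simps)
    then have cancel: "?i *v (g *v v) = v" for v by (simp add: matrix_vector_mul_assoc)
    have "\<epsilon> *s (?i *v axis p 1) = axis p 1" using cancel[of "axis p 1"] by (simp add: e(2) matrix_vector_scale)
    then have "\<epsilon> *s (\<epsilon> *s (?i *v axis p 1)) = \<epsilon> *s axis p 1" by simp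
    then have ip: "?i *v axis p 1 = \<epsilon> *s axis p 1" by (simp add: vector_smult_assoc unit_square[OF e(1)])
    have "\<epsilon> *s (?i *v axis r 1) + k *s (\<epsilon> *s axis p 1) + m *s (?i *v z) = axis r 1"
      using cancel[of "axis r 1"] by (simp add: e(3) ip matrix_vector_scale matrix_vector_right_distrib)
    then have "\<epsilon> *s (?i *v axis r 1) = axis r 1 + (- k * \<epsilon>) *s axis p 1 + m *s (- (?i *v z))"
      by (simp add: vec_eq_iff algebra_simps)
    then have "\<epsilon> *s (\<epsilon> *s (?i *v axis r 1)) = \<epsilon> *s (axis r 1 + (- k * \<epsilon>) *s axis p 1 + m *s (- (?i *v z)))" by simp
    then have "?i *v axis r 1 = \<epsilon> *s (axis r 1 + (- k * \<epsilon>) *s axis p 1 + m *s (- (?i *v z)))"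
      by (simp only: vector_smult_assoc unit_square[OF e(1)] vector_smult_lid)
    also have "\<dots> = \<epsilon> *s axis r 1 + (- k * (\<epsilon> * \<epsilon>)) *s axis p 1 + m *s (- \<epsilon> *s (?i *v z))"
      by (simp add: vec_eq_iff algebra_simps)
    finally show "?i \<in> ?L" by (rule frame_stabilizerI[OF inv_closed[OF e(4)] e(1) ip])
    assume h: "h \<in> ?L"
    obtain \<delta> l w where d: "\<bar>\<delta>\<bar> = 1" "h *v axis p 1 = \<delta> *s axis p 1"
      "h *v axis r 1 = \<delta> *s axis r 1 + l *s axis p 1 + m *s w" "h \<in> carrier ?G" by (rule frame_obtain[OF h])
    show "g \<otimes>\<^bsub>?G\<^esub> h \<in> ?L"
      using m_closed[OF e(4) d(4)] e(1) d(1) unfolding SL_int_simps(2)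
      by (intro frame_stabilizerI[OF _ _ frame_mult[OF e(1-3) d(1-3)]]) (simp_all add: abs_mult)
  qed
qed

text \<open>The conjugate fixes the first basis vector since \<open>T\<close> does. It adds to the second one the multiple \<open>k\<close>
  of the first, corrected by the sign of \<open>h\<close> on the line.\<close>

lemma frame_conjugate:
  assumes h: "h \<in> axis_stabilizer p" and T: "T \<in> carrier SL_int" "T *v axis p 1 = axis p 1"
    and Tr: "T *v (h *v axis r 1) = h *v axis r 1 + k *s axis p 1 + m *s z"
  shows "inv\<^bsub>SL_int\<^esub> h \<otimes>\<^bsub>SL_int\<^esub> T \<otimes>\<^bsub>SL_int\<^esub> h \<in> frame_stabilizer m p r"
    and "frame_character m p r (inv\<^bsub>SL_int\<^esub> h \<otimes>\<^bsub>SL_int\<^esub> T \<otimes>\<^bsub>SL_int\<^esub> h)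
      = cis (2 * pi * of_int (k * h $ p $ p) / of_int m)"
proof -
  let ?G = "SL_int :: (int ^ 'n ^ 'n) monoid"
  interpret group ?G by (rule group_SL_int)
  let ?i = "inv\<^bsub>?G\<^esub> h" and ?x = "inv\<^bsub>SL_int\<^esub> h \<otimes>\<^bsub>SL_int\<^esub> T \<otimes>\<^bsub>SL_int\<^esub> h"
  note e = axis_stabilizerD[OF h]
  have "?i ** h = mat 1" using l_inv[OF e(3)] by (simp add: SL_int_simps)
  then have cancel: "?i *v (h *v v) = v" for v by (simp add: matrix_vector_mul_assoc)
  have x: "?x *v v = ?i *v (T *v (h *v v))" for v by (simp add: SL_int_simps matrix_vector_mul_assoc matrix_mul_assoc)
  have "h $ p $ p *s (?i *v axis p 1) = axis p 1" using cancel[of "axis p 1"] by (simp add: e(1) matrix_vector_scale)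
  then have "h $ p $ p *s (h $ p $ p *s (?i *v axis p 1)) = h $ p $ p *s axis p 1" by simp
  then have ip: "?i *v axis p 1 = h $ p $ p *s axis p 1" by (simp add: vector_smult_assoc unit_square[OF e(2)])
  have "T *v (h *v axis p 1) = h *v axis p 1" by (simp add: e(1) matrix_vector_scale T(2))
  then have xp: "?x *v axis p 1 = 1 *s axis p 1" by (simp add: x cancel)
  have xr: "?x *v axis r 1 = 1 *s axis r 1 + (k * h $ p $ p) *s axis p 1 + m *s (?i *v z)"
    by (simp add: x Tr matrix_vector_right_distrib cancel matrix_vector_scale ip vector_smult_assoc)
  have "?x \<in> carrier ?G" using e(3) T(1) by (intro m_closed inv_closed)
  then show "?x \<in> frame_stabilizer m p r" by (rule frame_stabilizerI[OF _ _ xp xr]) simp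
  show "frame_character m p r ?x = cis (2 * pi * of_int (k * h $ p $ p) / of_int m)"
    using frame_character_eq[OF xp xr] by simp
qed

text \<open>The transvections into the fixed line act diagonally on the basis vectors belonging to the stabilizer
  of the line. The eigenvalue at \<open>h\<close> is governed by the residues of column \<open>r\<close> of \<open>h\<close>.\<close>

lemma frame_conjugate_shear:
  assumes h: "h \<in> axis_stabilizer p" and j: "j \<noteq> p"
  shows "inv\<^bsub>SL_int\<^esub> h \<otimes>\<^bsub>SL_int\<^esub> transvection p j b \<otimes>\<^bsub>SL_int\<^esub> h \<in> frame_stabilizer m p r"
    and "frame_character m p r (inv\<^bsub>SL_int\<^esub> h \<otimes>\<^bsub>SL_int\<^esub> transvection p j b \<otimes>\<^bsub>SL_int\<^esub> h)
      = cis (2 * pi * of_int (b * h $ j $ r * h $ p $ p) / of_int m)"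
proof -
  have T: "transvection p j b \<in> carrier SL_int" using j by (simp add: SL_int_simps det_transvection)
  have Tp: "transvection p j b *v axis p 1 = axis p 1"
    using j by (simp add: transvection_vector_eq axis_def)
  have Tr: "transvection p j b *v (h *v axis r 1) = h *v axis r 1 + (b * h $ j $ r) *s axis p 1 + m *s 0"
    by (simp add: transvection_vector_eq matrix_vector_axis)
  show "inv\<^bsub>SL_int\<^esub> h \<otimes>\<^bsub>SL_int\<^esub> transvection p j b \<otimes>\<^bsub>SL_int\<^esub> h \<in> frame_stabilizer m p r"
    by (rule frame_conjugate(1)[OF h T Tp Tr])
  show "frame_character m p r (inv\<^bsub>SL_int\<^esub> h \<otimes>\<^bsub>SL_int\<^esub> transvection p j b \<otimes>\<^bsub>SL_int\<^esub> h)
      = cis (2 * pi * of_int (b * h $ j $ r * h $ p $ p) / of_int m)"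
    by (rule frame_conjugate(2)[OF h T Tp Tr])
qed

lemma frame_residues:
  assumes h: "h \<in> axis_stabilizer p" and res: "\<And>j. j \<noteq> p \<Longrightarrow> m dvd h $ j $ r - h $ p $ p * axis r 1 $ j"
  shows "h \<in> frame_stabilizer m p r"
proof -
  note e = axis_stabilizerD[OF h]
  define z where "z = (\<chi> j. if j = p then 0 else (h $ j $ r - h $ p $ p * axis r 1 $ j) div m)"
  have "h *v axis r 1 = h $ p $ p *s axis r 1 + (h $ p $ r) *s axis p 1 + m *s z"
    unfolding vec_eq_iff
  proof
    fix j
    show "(h *v axis r 1) $ j = (h $ p $ p *s axis r 1 + (h $ p $ r) *s axis p 1 + m *s z) $ j"
    proof (cases "j = p")
      case True
      then show ?thesis using r by (simp add: matrix_vector_axis z_def) (simp add: axis_def)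
    next
      case False
      have "m * z $ j = h $ j $ r - h $ p $ p * axis r 1 $ j"
        using res[OF False] False by (simp add: z_def)
      then show ?thesis using False by (simp add: matrix_vector_axis) (simp add: axis_def)
    qed
  qed
  then show ?thesis by (rule frame_stabilizerI[OF e(3,2,1)])
qed

text \<open>The coset of \<open>h\<close> is determined by the sign of \<open>h\<close> on the line and the residues of column \<open>r\<close>
  modulo \<open>m\<close>.\<close>

lemma frame_finite_index:
  "\<exists>F. finite F \<and> F \<subseteq> axis_stabilizer p \<and>
    (\<forall>h\<in>axis_stabilizer p. \<exists>s\<in>F. inv\<^bsub>SL_int\<^esub> s \<otimes>\<^bsub>SL_int\<^esub> h \<in> frame_stabilizer m p r)"
proof -
  let ?G = "SL_int :: (int ^ 'n ^ 'n) monoid" and ?H = "axis_stabilizer p :: (int ^ 'n ^ 'n) set"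
  interpret group ?G by (rule group_SL_int)
  \<comment> \<open>A map with finite range that takes different values on different cosets; one preimage for each
    value gives the representatives.\<close>
  define \<Phi> where "\<Phi> h = (h $ p $ p, \<lambda>j. h $ j $ r mod m)" for h :: "int ^ 'n ^ 'n"
  have "\<Phi> ` ?H \<subseteq> {-1, 1} \<times> PiE UNIV (\<lambda>_. {0..<m})"
  proof (rule image_subsetI)
    fix h assume "h \<in> ?H"
    then have "h $ p $ p \<in> {-1, 1}" using axis_stabilizerD(2)[of h p] by (auto simp: abs_if split: if_splits)
    then show "\<Phi> h \<in> {-1, 1} \<times> PiE UNIV (\<lambda>_. {0..<m})" using m by (auto simp: \<Phi>_def)
  qed
  then have fin: "finite (\<Phi> ` ?H)" by (rule finite_subset) (intro finite_cartesian_product finite_PiE; simp)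
  define c where "c y = (SOME h. h \<in> ?H \<and> \<Phi> h = y)" for y
  have c: "c (\<Phi> h) \<in> ?H" "\<Phi> (c (\<Phi> h)) = \<Phi> h" if "h \<in> ?H" for h
    using someI[of "\<lambda>h'. h' \<in> ?H \<and> \<Phi> h' = \<Phi> h" h] that unfolding c_def by auto
  have "inv\<^bsub>?G\<^esub> (c (\<Phi> h)) \<otimes>\<^bsub>?G\<^esub> h \<in> frame_stabilizer m p r" if h: "h \<in> ?H" for h
  proof -
    define s where "s = c (\<Phi> h)"
    have s: "s \<in> ?H" "\<Phi> s = \<Phi> h" unfolding s_def using c[OF h] by auto
    note e = axis_stabilizerD[OF h] and es = axis_stabilizerD[OF s(1)]
    have pp: "s $ p $ p = h $ p $ p" and mods: "s $ j $ r mod m = h $ j $ r mod m" for j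
      using s(2) by (auto simp: \<Phi>_def fun_eq_iff)
    define z where "z = (\<chi> j. (h $ j $ r - s $ j $ r) div m)"
    have "m dvd h $ j $ r - s $ j $ r" for j using mods[of j, symmetric] by (simp add: mod_eq_dvd_iff)
    then have hr: "h *v axis r 1 = s *v axis r 1 + m *s z"
      unfolding vec_eq_iff by (simp add: matrix_vector_axis z_def)
    let ?i = "inv\<^bsub>?G\<^esub> s"
    have "?i ** s = mat 1" using l_inv[OF es(3)] by (simp add: SL_int_simps)
    then have cancel: "?i *v (s *v v) = v" for v by (simp add: matrix_vector_mul_assoc)
    have x: "(?i \<otimes>\<^bsub>?G\<^esub> h) *v v = ?i *v (h *v v)" for v by (simp add: SL_int_simps matrix_vector_mul_assoc)
    have "h *v axis p 1 = s *v axis p 1" by (simp add: e(1) es(1) pp)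
    then have xp: "(?i \<otimes>\<^bsub>?G\<^esub> h) *v axis p 1 = 1 *s axis p 1" by (simp add: x cancel)
    have xr: "(?i \<otimes>\<^bsub>?G\<^esub> h) *v axis r 1 = 1 *s axis r 1 + 0 *s axis p 1 + m *s (?i *v z)"
      by (simp add: x hr matrix_vector_right_distrib cancel matrix_vector_scale)
    show ?thesis unfolding s_def[symmetric]
      by (rule frame_stabilizerI[OF m_closed[OF inv_closed[OF es(3)] e(3)] _ xp xr]) simp
  qed
  then show ?thesis using fin c(1)
    by (intro exI[of _ "c ` \<Phi> ` ?H"]) blast
qed

end

text \<open>An integer eigenvalue of a matrix with integer inverse is a unit.\<close>

lemma axis_stabilizer_iff:
  fixes x :: "int ^ 'n ^ 'n"
  shows "x \<in> axis_stabilizer p \<longleftrightarrow> x \<in> carrier SL_int \<and> (\<forall>j. j \<noteq> p \<longrightarrow> x $ j $ p = 0)"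
proof
  assume x: "x \<in> axis_stabilizer p"
  have col: "x $ j $ p = (x $ p $ p *s axis p 1) $ j" for j
    unfolding axis_stabilizerD(1)[OF x, symmetric] by (simp add: matrix_vector_axis)
  have "x $ j $ p = 0" if "j \<noteq> p" for j using col[of j] that by (simp add: axis_def)
  then show "x \<in> carrier SL_int \<and> (\<forall>j. j \<noteq> p \<longrightarrow> x $ j $ p = 0)"
    using axis_stabilizerD(3)[OF x] by blast
next
  interpret group "SL_int :: (int ^ 'n ^ 'n) monoid" by (rule group_SL_int)
  assume x: "x \<in> carrier SL_int \<and> (\<forall>j. j \<noteq> p \<longrightarrow> x $ j $ p = 0)"
  then have eig: "x *v axis p 1 = x $ p $ p *s axis p 1"
    unfolding vec_eq_iff matrix_vector_axis by (auto simp: axis_def)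
  have "inv\<^bsub>SL_int\<^esub> x ** x = mat 1" using l_inv x by (simp add: SL_int_simps)
  then have "inv\<^bsub>SL_int\<^esub> x *v (x *v axis p 1) = axis p 1" by (simp add: matrix_vector_mul_assoc)
  then have "(x $ p $ p *s (inv\<^bsub>SL_int\<^esub> x *v axis p 1)) $ p = (axis p 1 :: int ^ 'n) $ p"
    by (simp only: eig matrix_vector_scale)
  then have "x $ p $ p * (inv\<^bsub>SL_int\<^esub> x *v axis p 1) $ p = 1" by simp
  then have "\<bar>x $ p $ p\<bar> = 1" using zmult_eq_1_iff by fastforce
  then show "x \<in> axis_stabilizer p" using x eig by (intro axis_stabilizerI) auto
qed

text \<open>The stabilizer of the line is \<open>H\<close>. If \<open>h\<close> is in it but not in \<open>L\<close>, then some residue of column \<open>r\<close> of \<open>h\<close>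
  differs from that of the identity matrix times the sign of \<open>h\<close> on the line. The transvection that adds
  the coordinate in question to coordinate \<open>p\<close> then distinguishes the coset of \<open>h\<close> from \<open>L\<close>.\<close>

theorem SL_int_frame_representation:
  fixes p r :: "'n::finite"
  assumes m: "m > 0" and r: "r \<noteq> p" and card: "CARD('n) \<ge> 3"
    and e: "\<And>k. e k \<in> carrier SL_int"
      "\<And>x. x \<in> carrier SL_int \<Longrightarrow> \<exists>!k :: nat. inv\<^bsub>SL_int\<^esub> e k \<otimes>\<^bsub>SL_int\<^esub> x \<in> frame_stabilizer m p r"
  shows "monomial (SL_int :: (int ^ 'n ^ 'n) monoid) (frame_stabilizer m p r) (frame_character m p r) e" (is ?monomial)
    and "traceable SL_int
      (monomial.rep (SL_int :: (int ^ 'n ^ 'n) monoid) (frame_stabilizer m p r) (frame_character m p r) e)"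
proof -
  let ?G = "SL_int :: (int ^ 'n ^ 'n) monoid" and ?L = "frame_stabilizer m p r" and ?H = "axis_stabilizer p"
  let ?\<theta> = "frame_character m p r"
  have norm: "cmod (?\<theta> x) = 1" for x by (simp add: frame_character_def)
  show monomial: ?monomial
    using group_SL_int subgroup_frame_stabilizer[OF m r] frame_character_mult[OF m r] norm e
    by (intro monomial.intro monomial_axioms.intro) auto
  interpret LG: linear_group ?G p "\<lambda>x y. \<bar>x\<bar> \<le> \<bar>y\<bar>" "\<lambda>k. 3 * m * int k"
    by (rule linear_group_SL_int[OF m card])
  interpret M: monomial ?G ?L ?\<theta> e by (rule monomial)
  have right: "x \<otimes>\<^bsub>?G\<^esub> l \<in> carrier ?G" "LG.first (x \<otimes>\<^bsub>?G\<^esub> l) = l $ p $ p *s LG.first x"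
      "\<bar>l $ p $ p\<bar> = 1" if x: "x \<in> carrier ?G" and l: "l \<in> ?L" for x l
  proof -
    have "l \<in> ?H" using l frame_stabilizer_subset by blast
    note el = axis_stabilizerD[OF this]
    show "x \<otimes>\<^bsub>?G\<^esub> l \<in> carrier ?G" by (rule LG.m_closed[OF x el(3)])
    show "LG.first (x \<otimes>\<^bsub>?G\<^esub> l) = l $ p $ p *s LG.first x"
      by (simp add: LG.first_def LG.mult_vector el(1) matrix_vector_scale)
    show "\<bar>l $ p $ p\<bar> = 1" by (rule el(2))
  qed
  have saturated_sector: "M.saturated (LG.sector i)" for i
    unfolding M.saturated_def
  proof (intro conjI ballI)
    show "LG.sector i \<subseteq> carrier ?G" by (auto simp: LG.sector_def)
    fix x l assume x: "x \<in> LG.sector i" and l: "l \<in> ?L"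
    then have xc: "x \<in> carrier ?G" "LG.first x $ i \<noteq> 0" by (auto simp: LG.sector_def)
    have "l $ p $ p \<noteq> 0" using right(3)[OF xc(1) l] by auto
    then show "x \<otimes>\<^bsub>?G\<^esub> l \<in> LG.sector i"
      using xc by (intro LG.sector_scaled[OF x right(1,2)[OF xc(1) l]]) auto
  qed
  have saturated_H: "M.saturated ?H"
    unfolding M.saturated_def
  proof (intro conjI ballI)
    show "?H \<subseteq> carrier ?G" using axis_stabilizerD(3) by blast
    fix x l assume x: "x \<in> ?H" and l: "l \<in> ?L"
    note ex = axis_stabilizerD[OF x]
    have "(x \<otimes>\<^bsub>?G\<^esub> l) *v axis p 1 = (l $ p $ p * x $ p $ p) *s axis p 1"
      using right(2)[OF ex(3) l] by (simp add: LG.first_def ex(1) vector_smult_assoc)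
    then show "x \<otimes>\<^bsub>?G\<^esub> l \<in> ?H"
      using right(3)[OF ex(3) l] ex(2) by (intro axis_stabilizerI[OF right(1)[OF ex(3) l]]) (auto simp: abs_mult)
  qed
  have push_trivial: "inv\<^bsub>?G\<^esub> h \<otimes>\<^bsub>?G\<^esub> LG.push i k \<otimes>\<^bsub>?G\<^esub> h \<in> ?L"
      "?\<theta> (inv\<^bsub>?G\<^esub> h \<otimes>\<^bsub>?G\<^esub> LG.push i k \<otimes>\<^bsub>?G\<^esub> h) = 1"
    if i: "i \<noteq> p" and h: "h \<in> ?H" for i k h
  proof -
    have Tp: "LG.push i k *v axis p 1 = axis p 1"
      using i by (simp add: LG.push_def transvection_vector_eq axis_def)
    have Tr: "LG.push i k *v (h *v axis r 1)
        = h *v axis r 1 + 0 *s axis p 1 + m *s ((3 * int k * h $ i $ r) *s axis (LG.mate i) 1)"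
      unfolding LG.push_def transvection_vector_eq by (simp add: vec_eq_iff matrix_vector_axis mult_ac)
    show "inv\<^bsub>?G\<^esub> h \<otimes>\<^bsub>?G\<^esub> LG.push i k \<otimes>\<^bsub>?G\<^esub> h \<in> ?L"
      by (rule frame_conjugate(1)[OF m r h LG.push_in Tp Tr])
    show "?\<theta> (inv\<^bsub>?G\<^esub> h \<otimes>\<^bsub>?G\<^esub> LG.push i k \<otimes>\<^bsub>?G\<^esub> h) = 1"
      using frame_conjugate(2)[OF m r h LG.push_in Tp Tr] by simp
  qed
  obtain F where F: "finite F" "F \<subseteq> ?H" "\<And>h. h \<in> ?H \<Longrightarrow> \<exists>s\<in>F. inv\<^bsub>?G\<^esub> s \<otimes>\<^bsub>?G\<^esub> h \<in> ?L"
    using frame_finite_index[OF m r] by metis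
  have one_H: "\<one>\<^bsub>?G\<^esub> \<in> ?H"
    by (rule axis_stabilizerI[OF LG.one_closed, where \<epsilon> = 1]) (simp_all add: SL_int_simps)
  have sep: "monomial_separated ?G ?L ?\<theta> e ?H (- {p}) LG.sector LG.push F"
  proof unfold_locales
    show "?L \<subseteq> ?H" by (rule frame_stabilizer_subset)
    show "\<exists>i\<in>- {p}. x \<in> LG.sector i" if "x \<in> carrier ?G" "x \<notin> ?H" for x
      using that LG.sector_cover[of x] by (auto simp: axis_stabilizer_iff LG.first_nth)
    fix h assume h: "h \<in> ?H" "h \<notin> ?L"
    obtain j where j: "j \<noteq> p" "\<not> m dvd h $ j $ r - h $ p $ p * axis r 1 $ j"
      using frame_residues[OF m r h(1)] h(2) by blast
    let ?n = "transvection p j 1 :: int ^ 'n ^ 'n"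
    have nG: "?n \<in> carrier ?G" using j(1) by (simp add: SL_int_simps det_transvection)
    have \<theta>: "?\<theta> (inv\<^bsub>?G\<^esub> x \<otimes>\<^bsub>?G\<^esub> ?n \<otimes>\<^bsub>?G\<^esub> x) = cis (2 * pi * of_int (x $ j $ r * x $ p $ p) / of_int m)"
      if "x \<in> ?H" for x using frame_conjugate_shear(2)[OF m r that j(1), of 1] by simp
    have "?\<theta> ?n = ?\<theta> (inv\<^bsub>?G\<^esub> \<one>\<^bsub>?G\<^esub> \<otimes>\<^bsub>?G\<^esub> ?n \<otimes>\<^bsub>?G\<^esub> \<one>\<^bsub>?G\<^esub>)" using nG by simp
    also have "\<dots> = cis (2 * pi * of_int (axis r 1 $ j) / of_int m)"
      unfolding \<theta>[OF one_H] by (simp add: SL_int_simps mat_def axis_def)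
    finally have \<theta>n: "?\<theta> ?n = cis (2 * pi * of_int (axis r 1 $ j) / of_int m)" .
    have "?\<theta> (inv\<^bsub>?G\<^esub> h \<otimes>\<^bsub>?G\<^esub> ?n \<otimes>\<^bsub>?G\<^esub> h) \<noteq> ?\<theta> ?n"
    proof
      assume "?\<theta> (inv\<^bsub>?G\<^esub> h \<otimes>\<^bsub>?G\<^esub> ?n \<otimes>\<^bsub>?G\<^esub> h) = ?\<theta> ?n"
      then have "m dvd h $ j $ r * h $ p $ p - axis r 1 $ j"
        unfolding \<theta>[OF h(1)] \<theta>n root_of_unity_eq_iff[OF m] .
      then have "m dvd h $ p $ p * (h $ j $ r * h $ p $ p - axis r 1 $ j)" by (rule dvd_mult)
      also have "h $ p $ p * (h $ j $ r * h $ p $ p - axis r 1 $ j)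
          = (h $ p $ p * h $ p $ p) * h $ j $ r - h $ p $ p * axis r 1 $ j" by (simp add: algebra_simps)
      also have "\<dots> = h $ j $ r - h $ p $ p * axis r 1 $ j"
        unfolding unit_square[OF axis_stabilizerD(2)[OF h(1)]] by simp
      finally show False using j(2) by simp
    qed
    moreover have "\<forall>x\<in>?H. inv\<^bsub>?G\<^esub> x \<otimes>\<^bsub>?G\<^esub> ?n \<otimes>\<^bsub>?G\<^esub> x \<in> ?L"
      using frame_conjugate_shear(1)[OF m r _ j(1)] by blast
    ultimately show "\<exists>n\<in>carrier ?G. (\<forall>x\<in>?H. inv\<^bsub>?G\<^esub> x \<otimes>\<^bsub>?G\<^esub> n \<otimes>\<^bsub>?G\<^esub> x \<in> ?L) \<and>
        ?\<theta> (inv\<^bsub>?G\<^esub> h \<otimes>\<^bsub>?G\<^esub> n \<otimes>\<^bsub>?G\<^esub> h) \<noteq> ?\<theta> n"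
      using nG by blast
  qed (use saturated_sector saturated_H one_H LG.push_in push_trivial LG.push_disjoint F in auto)
  show "traceable SL_int M.rep" by (rule monomial_separated.traceable[OF sep])
qed

lemma SL_int_frame_enumeration:
  fixes p r :: "'n::finite"
  assumes m: "m > 0" and r: "r \<noteq> p" and card: "CARD('n) \<ge> 3"
  shows "\<exists>e :: nat \<Rightarrow> int ^ 'n ^ 'n. (\<forall>k. e k \<in> carrier SL_int) \<and>
    (\<forall>x\<in>carrier SL_int. \<exists>!k. inv\<^bsub>SL_int\<^esub> e k \<otimes>\<^bsub>SL_int\<^esub> x \<in> frame_stabilizer m p r)"
proof -
  let ?G = "SL_int :: (int ^ 'n ^ 'n) monoid"
  interpret LG: linear_group ?G p "\<lambda>x y. \<bar>x\<bar> \<le> \<bar>y\<bar>" "\<lambda>k. 3 * m * int k"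
    by (rule linear_group_SL_int[OF m card])
  define s where "s k = (transvection r p (3 * m * int k) :: int ^ 'n ^ 'n)" for k
  have sG: "s k \<in> carrier ?G" for k unfolding s_def using r by (simp add: SL_int_simps det_transvection)
  show ?thesis
  proof (rule LG.coset_enumeration[OF subgroup_frame_stabilizer[OF m r] _ sG])
    show "countable (carrier ?G)" by (rule countableI_type)
    fix k l assume "inv\<^bsub>?G\<^esub> (s k) \<otimes>\<^bsub>?G\<^esub> s l \<in> frame_stabilizer m p r"
    then have kl: "inv\<^bsub>?G\<^esub> (s k) \<otimes>\<^bsub>?G\<^esub> s l \<in> axis_stabilizer p" using frame_stabilizer_subset by blast
    obtain c where "inv\<^bsub>?G\<^esub> (s k) *v (s l *v axis p 1) = c *s axis p 1"
      using axis_stabilizerD(1)[OF kl] unfolding LG.mult_vector by blast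
    then have eq: "(s l *v axis p 1) $ i = (c *s (s k *v axis p 1)) $ i" for i
      using LG.inv_vector_iff[OF sG] by (simp add: matrix_vector_scale)
    have "c = 1" using eq[of p] r by (simp add: s_def transvection_vector axis_def)
    then have "3 * m * int l = 3 * m * int k"
      using eq[of r] r by (simp add: s_def transvection_vector axis_def)
    then show "k = l" using LG.a_inj by metis
  qed
qed

text \<open>The element \<open>g\<close> of \<open>equivalent_monomial\<close> stabilizes the line since all other orbits are infinite. The
  transvection with entry \<open>m'\<close> is in the kernel of the second character and of its conjugate by \<open>g\<close>, hence in
  the kernel of the first one, where its value is an \<open>m'\<close>-th power of a primitive \<open>m\<close>-th root of unity.\<close>

lemma SL_int_frame_inequivalent:
  fixes p r :: "'n::finite"
  assumes m: "m > 0" "m' > 0" and r: "r \<noteq> p" and card: "CARD('n) \<ge> 3"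
    and e: "\<And>k. e k \<in> carrier SL_int"
      "\<And>x. x \<in> carrier SL_int \<Longrightarrow> \<exists>!k :: nat. inv\<^bsub>SL_int\<^esub> e k \<otimes>\<^bsub>SL_int\<^esub> x \<in> frame_stabilizer m p r"
    and e': "\<And>k. e' k \<in> carrier SL_int"
      "\<And>x. x \<in> carrier SL_int \<Longrightarrow> \<exists>!k :: nat. inv\<^bsub>SL_int\<^esub> e' k \<otimes>\<^bsub>SL_int\<^esub> x \<in> frame_stabilizer m' p r"
    and eq: "equivalent_reps (SL_int :: (int ^ 'n ^ 'n) monoid)
      (monomial.rep SL_int (frame_stabilizer m p r) (frame_character m p r) e)
      (monomial.rep SL_int (frame_stabilizer m' p r) (frame_character m' p r) e')"
  shows "m dvd m'"
proof -
  let ?G = "SL_int :: (int ^ 'n ^ 'n) monoid"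
  let ?L = "frame_stabilizer m p r" and ?L' = "frame_stabilizer m' p r"
  interpret LG: linear_group ?G p "\<lambda>x y. \<bar>x\<bar> \<le> \<bar>y\<bar>" "\<lambda>k. 3 * m * int k"
    by (rule linear_group_SL_int[OF m(1) card])
  obtain g where g: "g \<in> carrier ?G"
    and orbit: "\<And>s :: nat \<Rightarrow> _. range s \<subseteq> ?L \<Longrightarrow>
      \<exists>i j. i \<noteq> j \<and> inv\<^bsub>?G\<^esub> (s i \<otimes>\<^bsub>?G\<^esub> g) \<otimes>\<^bsub>?G\<^esub> (s j \<otimes>\<^bsub>?G\<^esub> g) \<in> ?L'"
    and conj: "\<And>l. l \<in> ?L \<Longrightarrow> inv\<^bsub>?G\<^esub> g \<otimes>\<^bsub>?G\<^esub> l \<otimes>\<^bsub>?G\<^esub> g \<in> ?L' \<Longrightarrow>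
      frame_character m' p r (inv\<^bsub>?G\<^esub> g \<otimes>\<^bsub>?G\<^esub> l \<otimes>\<^bsub>?G\<^esub> g) = frame_character m p r l"
    using equivalent_monomial[OF SL_int_frame_representation(1)[OF m(1) r card e]
        SL_int_frame_representation(1)[OF m(2) r card e'] eq] by blast
  have one_H: "\<one>\<^bsub>?G\<^esub> \<in> axis_stabilizer p"
    by (rule axis_stabilizerI[OF LG.one_closed, where \<epsilon> = 1]) (simp_all add: SL_int_simps)
  have shear: "transvection p j b \<in> ?L" if "j \<noteq> p" for j b
  proof -
    have "transvection p j b \<in> carrier ?G" using that by (simp add: SL_int_simps det_transvection)
    then show ?thesis using frame_conjugate_shear(1)[OF m(1) r one_H that, of b] by simp
  qed
  have gH: "g \<in> axis_stabilizer p"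
  proof (rule ccontr)
    assume "g \<notin> axis_stabilizer p"
    then obtain j where j: "j \<noteq> p" "LG.first g $ j \<noteq> 0"
      using g by (auto simp: axis_stabilizer_iff LG.first_nth)
    define s where "s k = (transvection p j (3 * m * int k) :: int ^ 'n ^ 'n)" for k
    have sL: "range s \<subseteq> ?L" using shear[OF j(1)] by (auto simp: s_def)
    have sG: "s k \<in> carrier ?G" for k using j(1) by (simp add: s_def SL_int_simps det_transvection)
    obtain k l where kl: "k \<noteq> l" "inv\<^bsub>?G\<^esub> (s k \<otimes>\<^bsub>?G\<^esub> g) \<otimes>\<^bsub>?G\<^esub> (s l \<otimes>\<^bsub>?G\<^esub> g) \<in> ?L'"
      using orbit[OF sL] by blast
    then have "inv\<^bsub>?G\<^esub> (s k \<otimes>\<^bsub>?G\<^esub> g) \<otimes>\<^bsub>?G\<^esub> (s l \<otimes>\<^bsub>?G\<^esub> g) \<in> axis_stabilizer p"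
      using frame_stabilizer_subset by blast
    from axis_stabilizerD(1)[OF this]
    obtain c where "(inv\<^bsub>?G\<^esub> (s k \<otimes>\<^bsub>?G\<^esub> g) \<otimes>\<^bsub>?G\<^esub> (s l \<otimes>\<^bsub>?G\<^esub> g)) *v axis p 1 = c *s axis p 1"
      by blast
    then have "(s l \<otimes>\<^bsub>?G\<^esub> g) *v axis p 1 = (s k \<otimes>\<^bsub>?G\<^esub> g) *v (c *s axis p 1)"
      using LG.inv_vector_iff[OF LG.m_closed[OF sG g]] by (simp add: LG.mult_vector)
    then have "s l *v LG.first g = c *s (s k *v LG.first g)"
      by (simp add: LG.mult_vector LG.first_def matrix_vector_scale)
    then have "l = k"
      unfolding s_def by (rule LG.shear_separates[OF j]) (use j in auto)
    then show False using kl by simp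
  qed
  let ?l = "transvection p r m' :: int ^ 'n ^ 'n"
  have lG: "?l \<in> carrier ?G" using r by (simp add: SL_int_simps det_transvection)
  have "frame_character m p r ?l = frame_character m' p r (inv\<^bsub>?G\<^esub> g \<otimes>\<^bsub>?G\<^esub> ?l \<otimes>\<^bsub>?G\<^esub> g)"
    using conj[OF shear[OF r] frame_conjugate_shear(1)[OF m(2) r gH r]] by simp
  also have "\<dots> = cis (2 * pi * of_int (m' * g $ r $ r * g $ p $ p) / of_int m')"
    by (rule frame_conjugate_shear(2)[OF m(2) r gH r])
  also have "\<dots> = cis (2 * pi * of_int 0 / of_int m')"
    unfolding root_of_unity_eq_iff[OF m(2)] by simp
  finally have "frame_character m p r ?l = 1" by simp
  moreover have "frame_character m p r ?l = cis (2 * pi * of_int m' / of_int m)"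
  proof -
    have "frame_character m p r (inv\<^bsub>?G\<^esub> \<one>\<^bsub>?G\<^esub> \<otimes>\<^bsub>?G\<^esub> ?l \<otimes>\<^bsub>?G\<^esub> \<one>\<^bsub>?G\<^esub>)
        = cis (2 * pi * of_int m' / of_int m)"
      unfolding frame_conjugate_shear(2)[OF m(1) r one_H r] by (simp add: SL_int_simps mat_def)
    then show ?thesis using lG by simp
  qed
  ultimately have "cis (2 * pi * of_int m' / of_int m) = cis (2 * pi * of_int 0 / of_int m)" by simp
  then show ?thesis unfolding root_of_unity_eq_iff[OF m(1)] by simp
qed

theorem SL_int_family:
  fixes p :: "'n::finite"
  assumes card: "CARD('n) \<ge> 3"
  shows "\<exists>F :: (int ^ 'n ^ 'n \<Rightarrow> ell2 \<Rightarrow>\<^sub>L ell2) set. infinite F \<and>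
    pairwise (\<lambda>\<pi> \<rho>. \<not> equivalent_reps SL_int \<pi> \<rho>) F \<and> (\<forall>\<pi>\<in>F. traceable SL_int \<pi>)"
proof -
  interpret LG: linear_group "SL_int :: (int ^ 'n ^ 'n) monoid" p "\<lambda>x y. \<bar>x\<bar> \<le> \<bar>y\<bar>" "\<lambda>k. 3 * 1 * int k"
    by (rule linear_group_SL_int[OF _ card]) simp
  obtain r where r: "r \<noteq> p" using LG.mate(1) by blast
  have "\<forall>m\<in>{0<..}. \<exists>e :: nat \<Rightarrow> int ^ 'n ^ 'n. (\<forall>k. e k \<in> carrier SL_int) \<and>
    (\<forall>x\<in>carrier SL_int. \<exists>!k. inv\<^bsub>SL_int\<^esub> e k \<otimes>\<^bsub>SL_int\<^esub> x \<in> frame_stabilizer m p r)"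
    using SL_int_frame_enumeration[OF _ r card] by simp
  then obtain E :: "int \<Rightarrow> nat \<Rightarrow> int ^ 'n ^ 'n" where E_all: "\<forall>m\<in>{0<..}. (\<forall>k. E m k \<in> carrier SL_int) \<and>
    (\<forall>x\<in>carrier SL_int. \<exists>!k. inv\<^bsub>SL_int\<^esub> E m k \<otimes>\<^bsub>SL_int\<^esub> x \<in> frame_stabilizer m p r)"
    unfolding bchoice_iff by (elim exE)
  have E: "E m k \<in> carrier SL_int"
    "x \<in> carrier SL_int \<Longrightarrow> \<exists>!k. inv\<^bsub>SL_int\<^esub> E m k \<otimes>\<^bsub>SL_int\<^esub> x \<in> frame_stabilizer m p r" if "m > 0" for m k x
    using E_all that by simp_all
  \<comment> \<open>Divisibility between primes means equality, so the one-sided \<open>SL_int_frame_inequivalent\<close> is enough.\<close>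
  define P where "P = int ` {q :: nat. Factorial_Ring.prime q}"
  have P_pos: "m > 0" if "m \<in> P" for m using that by (auto simp: P_def prime_gt_0_nat)
  define \<pi> where "\<pi> m = monomial.rep SL_int (frame_stabilizer m p r) (frame_character m p r) (E m)" for m
  have ineq: "m = m'" if mm: "m \<in> P" "m' \<in> P" "equivalent_reps SL_int (\<pi> m) (\<pi> m')" for m m'
  proof -
    have "m dvd m'"
      using SL_int_frame_inequivalent[OF P_pos[OF mm(1)] P_pos[OF mm(2)] r card
          E[OF P_pos[OF mm(1)]] E[OF P_pos[OF mm(2)]]] mm(3) by (simp add: \<pi>_def)
    then show ?thesis using mm(1,2) by (auto simp: P_def primes_dvd_imp_eq)
  qed
  have inj: "inj_on \<pi> P"
  proof (rule inj_onI)
    fix m m' assume mm: "m \<in> P" "m' \<in> P" "\<pi> m = \<pi> m'"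
    then have "equivalent_reps SL_int (\<pi> m) (\<pi> m')" by (simp add: equivalent_reps_refl)
    then show "m = m'" using ineq mm(1,2) by simp
  qed
  have "infinite P" unfolding P_def using primes_infinite by (simp add: finite_image_iff)
  then have "infinite (\<pi> ` P)" using inj by (simp add: finite_image_iff)
  moreover have "pairwise (\<lambda>\<pi> \<rho>. \<not> equivalent_reps SL_int \<pi> \<rho>) (\<pi> ` P)"
    using ineq by (auto simp: pairwise_def)
  moreover have "traceable SL_int (\<pi> m)" if "m \<in> P" for m
    using SL_int_frame_representation(2)[OF P_pos[OF that] r card E[OF P_pos[OF that]]] by (simp add: \<pi>_def)
  ultimately show ?thesis by blast
qed

section \<open>The two families of traceable representations\<close>

theorem corollary4:
  assumes "CARD('n::finite) \<ge> 3"
  shows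
    "(countable (UNIV :: 'k::field set) \<and> \<not> algebraic_over_finite_field TYPE('k) \<longrightarrow>
       (\<exists>F :: ('k ^ 'n ^ 'n \<Rightarrow> ell2 \<Rightarrow>\<^sub>L ell2) set.
          uncountable F \<and>
          pairwise (\<lambda>\<pi> \<rho>. \<not> equivalent_reps GL \<pi> \<rho>) F \<and>
          (\<forall>\<pi>\<in>F. infinite_dim TYPE(ell2) \<and> irreducible_rep GL \<pi> \<and> traceable GL \<pi> \<and>
             trivial_central_character GL \<pi> \<and>
             (\<exists>\<rho>. unitary_rep PGL \<rho> \<and>
                (\<forall>g\<in>carrier GL. \<pi> g = \<rho> (center GL #>\<^bsub>GL\<^esub> g))))))
     \<and>
     (\<exists>F :: (int ^ 'n ^ 'n \<Rightarrow> ell2 \<Rightarrow>\<^sub>L ell2) set.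
        infinite F \<and>
        pairwise (\<lambda>\<pi> \<rho>. \<not> equivalent_reps SL_int \<pi> \<rho>) F \<and>
        (\<forall>\<pi>\<in>F. infinite_dim TYPE(ell2) \<and> irreducible_rep SL_int \<pi> \<and> traceable SL_int \<pi>))"
proof (intro conjI impI)
  assume "countable (UNIV :: 'k set) \<and> \<not> algebraic_over_finite_field TYPE('k)"
  then obtain F :: "('k ^ 'n ^ 'n \<Rightarrow> ell2 \<Rightarrow>\<^sub>L ell2) set" where F: "uncountable F"
    "pairwise (\<lambda>\<pi> \<rho>. \<not> equivalent_reps GL \<pi> \<rho>) F"
    "\<And>\<pi>. \<pi> \<in> F \<Longrightarrow> traceable GL \<pi> \<and> trivial_central_character GL \<pi>"
    using GL_family[OF assms, where 'k = 'k] by blast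
  have irr: "irreducible_rep GL \<pi>" if "\<pi> \<in> F" for \<pi> using F(3)[OF that] by (simp add: traceable_def)
  have fac: "\<exists>\<rho>. unitary_rep PGL \<rho> \<and> (\<forall>g\<in>carrier GL. \<pi> g = \<rho> (center GL #>\<^bsub>GL\<^esub> g))"
    if "\<pi> \<in> F" for \<pi>
  proof -
    have "unitary_rep GL \<pi>" using irr[OF that] by (simp add: irreducible_rep_def)
    then show ?thesis
      unfolding PGL_def using group.rep_mod_center[OF group_GL] F(3)[OF that] by blast
  qed
  show "\<exists>F :: ('k ^ 'n ^ 'n \<Rightarrow> ell2 \<Rightarrow>\<^sub>L ell2) set.
      uncountable F \<and>
      pairwise (\<lambda>\<pi> \<rho>. \<not> equivalent_reps GL \<pi> \<rho>) F \<and>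
      (\<forall>\<pi>\<in>F. infinite_dim TYPE(ell2) \<and> irreducible_rep GL \<pi> \<and> traceable GL \<pi> \<and>
         trivial_central_character GL \<pi> \<and>
         (\<exists>\<rho>. unitary_rep PGL \<rho> \<and>
            (\<forall>g\<in>carrier GL. \<pi> g = \<rho> (center GL #>\<^bsub>GL\<^esub> g))))"
    using F infinite_dim_ell2 irr fac by (intro exI[of _ F]) simp
next
  obtain F :: "(int ^ 'n ^ 'n \<Rightarrow> ell2 \<Rightarrow>\<^sub>L ell2) set" where F: "infinite F"
    "pairwise (\<lambda>\<pi> \<rho>. \<not> equivalent_reps SL_int \<pi> \<rho>) F" "\<And>\<pi>. \<pi> \<in> F \<Longrightarrow> traceable SL_int \<pi>"
    using SL_int_family[OF assms] by blast
  then show "\<exists>F :: (int ^ 'n ^ 'n \<Rightarrow> ell2 \<Rightarrow>\<^sub>L ell2) set.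
        infinite F \<and>
        pairwise (\<lambda>\<pi> \<rho>. \<not> equivalent_reps SL_int \<pi> \<rho>) F \<and>
        (\<forall>\<pi>\<in>F. infinite_dim TYPE(ell2) \<and> irreducible_rep SL_int \<pi> \<and> traceable SL_int \<pi>)"
    using infinite_dim_ell2 by (intro exI[of _ F]) (simp add: traceable_def)
qed

end
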